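(* Let $\mathbb{K}$ be an algebraically closed field, let $1\le s\le d\le n-1$, and let $L=\ker(C)\subset\mathbb{K}^n$ be a $d$-dimensional subspace, where $C$ is an $(n-d)\times n$-matrix of rank $n-d$. The variety $\mathcal{K}_{s,d,n}$ is the zero set of the $(n-s+1)\times(n-s+1)$-minors of the Kalman matrix $$\begin{pmatrix}C\\ CA\\ CA^2\\ \vdots\\ CA^d\end{pmatrix},$$ or equivalently (taking coordinates such that $L$ is spanned by the first $d$ standard basis vectors $e_1,\dots,e_d$) the zero set of the $(d-s+1)\times(d-s+1)$-minors of the reduced Kalman matrix $$\begin{pmatrix}A_{21}\\ A_{21}A_{11}\\ \vdots\\ A_{21}A_{11}^{d-1}\end{pmatrix}.$$ In particular, the singular locus $\mathrm{Sing}(\mathcal{K}_{d,n})$ of $\mathcal{K}_{d,n}=\mathcal{K}_{1,d,n}$ consists of all matrices $A$ such that the reduced Kalman matrix has rank $\le d-2$.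
   Context: $\mathcal{K}_{s,d,n}\subset\mathbb{P}^{n^2-1}=\mathbb{P}(\mathbb{K}^{n\times n})$ denotes the (reduced) closed subvariety of all $n\times n$-matrices $A$ (up to scaling) such that there is an $A$-invariant subspace of dimension $\ge s$ contained in $L$. For $s=1$, $\mathcal{K}_{1,d,n}=\mathcal{K}_{d,n}$ is the Kalman variety of all matrices having a nonzero eigenvector in $L$. When $L=\mathrm{span}(e_1,\dots,e_d)$, one takes $C=(\mathbf{0}_{(n-d)\times d}\mid \mathbf{I}_{(n-d)\times(n-d)})$, and $A_{11}$ denotes the upper left $d\times d$-block of $A$ and $A_{21}$ the lower left $(n-d)\times d$-block of $A$. The singular locus is the set of singular points of the reduced variety. *)

theory Defs
  imports
    "HOL-Library.Poly_Mapping"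
    "HOL-Library.Extended_Nat"
    "HOL-Computational_Algebra.Polynomial"
    "Jordan_Normal_Form.DL_Rank_Submatrix"
    "Jordan_Normal_Form.Matrix_Kernel"
begin

section \<open>Projective geometry of \<open>P(K\<^sup>n\<^sup>\<times>\<^sup>n)\<close>\<close>

text \<open>
  Polynomials in the entries of a matrix: the variables are index pairs, a monomial is a finitely
  supported exponent function, a polynomial is a finitely supported family of coefficients.
\<close>

type_synonym 'a entry_poly = "(nat \<times> nat \<Rightarrow>\<^sub>0 nat) \<Rightarrow>\<^sub>0 'a"

definition peval :: "'a::comm_ring_1 entry_poly \<Rightarrow> 'a mat \<Rightarrow> 'a" where
  "peval f A = (\<Sum>m\<in>Poly_Mapping.keys f.
     Poly_Mapping.lookup f m * (\<Prod>x\<in>Poly_Mapping.keys m. A $$ x ^ Poly_Mapping.lookup m x))"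

text \<open>
  Formal partial derivative. The subtraction of exponents is truncated, but it is only
  truncated for monomials not containing \<open>x\<close>, whose new coefficient is \<open>0\<close>.
\<close>

definition partial :: "nat \<times> nat \<Rightarrow> 'a::comm_ring_1 entry_poly \<Rightarrow> 'a entry_poly" where
  "partial x f = (\<Sum>m\<in>Poly_Mapping.keys f.
     Poly_Mapping.single (m - Poly_Mapping.single x 1)
       (of_nat (Poly_Mapping.lookup m x) * Poly_Mapping.lookup f m))"

definition homogeneous_polys :: "nat \<Rightarrow> 'a::comm_ring_1 entry_poly set" where
  "homogeneous_polys n = {f. \<exists>e. \<forall>m\<in>Poly_Mapping.keys f.
     Poly_Mapping.keys m \<subseteq> {..<n} \<times> {..<n} \<and>
     (\<Sum>x\<in>Poly_Mapping.keys m. Poly_Mapping.lookup m x) = e}"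

definition nonzero_mats :: "nat \<Rightarrow> 'a::field mat set" where
  "nonzero_mats n = carrier_mat n n - {0\<^sub>m n n}"

text \<open>The point of projective space with homogeneous coordinates \<open>A\<close>.\<close>

definition proj_point :: "'a::field mat \<Rightarrow> 'a mat set" where
  "proj_point A = {c \<cdot>\<^sub>m A | c. c \<noteq> 0}"

definition proj_zeros :: "nat \<Rightarrow> 'a::field entry_poly set \<Rightarrow> 'a mat set set" where
  "proj_zeros n F = {proj_point A | A. A \<in> nonzero_mats n \<and> (\<forall>f\<in>F. peval f A = 0)}"

definition proj_closed :: "nat \<Rightarrow> 'a::field mat set set \<Rightarrow> bool" where
  "proj_closed n Z \<longleftrightarrow> (\<exists>F \<subseteq> homogeneous_polys n. Z = proj_zeros n F)"

definition proj_irreducible :: "nat \<Rightarrow> 'a::field mat set set \<Rightarrow> bool" where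
  "proj_irreducible n Z \<longleftrightarrow> proj_closed n Z \<and> Z \<noteq> {} \<and>
     (\<forall>Z1 Z2. proj_closed n Z1 \<longrightarrow> proj_closed n Z2 \<longrightarrow> Z \<subseteq> Z1 \<union> Z2 \<longrightarrow> Z \<subseteq> Z1 \<or> Z \<subseteq> Z2)"

text \<open>
  The local dimension of a closed set \<open>X\<close> at a point \<open>p\<close>: the supremum of the lengths of chains
  of irreducible closed subsets of \<open>X\<close> containing \<open>p\<close>. These correspond to the chains of prime
  ideals of the local ring of \<open>X\<close> at \<open>p\<close>, so this is the Krull dimension of that ring.
\<close>

definition local_dim :: "nat \<Rightarrow> 'a::field mat set set \<Rightarrow> 'a mat set \<Rightarrow> enat" where
  "local_dim n X p = Sup {enat k | k. \<exists>Z :: nat \<Rightarrow> 'a mat set set.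
     (\<forall>i\<le>k. proj_irreducible n (Z i) \<and> p \<in> Z i \<and> Z i \<subseteq> X) \<and> (\<forall>i<k. Z i \<subset> Z (Suc i))}"

text \<open>The homogeneous polynomials vanishing on \<open>X\<close>; they generate the (radical) ideal of the
  reduced variety \<open>X\<close>.\<close>

definition vanishing_polys :: "nat \<Rightarrow> 'a::field mat set set \<Rightarrow> 'a entry_poly set" where
  "vanishing_polys n X =
     {f \<in> homogeneous_polys n. \<forall>A\<in>nonzero_mats n. proj_point A \<in> X \<longrightarrow> peval f A = 0}"

text \<open>
  The Zariski tangent space at \<open>A\<close> of the affine cone over \<open>X\<close>. By Euler's relation it contains
  the line through \<open>A\<close>; the quotient by this line is the tangent space of \<open>X\<close> at the
  projective point of \<open>A\<close>, which thus has one dimension less.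
\<close>

definition cone_tangent_space :: "nat \<Rightarrow> 'a::field mat set set \<Rightarrow> 'a mat \<Rightarrow> 'a mat set" where
  "cone_tangent_space n X A = {V \<in> carrier_mat n n. \<forall>f\<in>vanishing_polys n X.
     (\<Sum>x\<in>{..<n} \<times> {..<n}. peval (partial x f) A * V $$ x) = 0}"

definition cone_tangent_dim :: "nat \<Rightarrow> 'a::field mat set set \<Rightarrow> 'a mat \<Rightarrow> nat" where
  "cone_tangent_dim n X A =
     vectorspace.dim class_ring
       ((module_mat TYPE('a) n n)\<lparr>carrier := cone_tangent_space n X A\<rparr>)"

text \<open>A point is singular if the dimensions of the tangent space and of the local ring differ.\<close>

definition singular_locus :: "nat \<Rightarrow> 'a::field mat set set \<Rightarrow> 'a mat set set" where
  "singular_locus n X = {proj_point A | A. A \<in> nonzero_mats n \<and> proj_point A \<in> X \<and>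
     enat (cone_tangent_dim n X A) \<noteq> local_dim n X (proj_point A) + 1}"


section \<open>Kalman varieties and Kalman matrices\<close>

definition subspace_dim :: "nat \<Rightarrow> 'a::field vec set \<Rightarrow> nat" where
  "subspace_dim n W = vectorspace.dim class_ring ((module_vec TYPE('a) n)\<lparr>carrier := W\<rparr>)"

definition kalman_variety :: "nat \<Rightarrow> nat \<Rightarrow> 'a::field vec set \<Rightarrow> 'a mat set set" where
  "kalman_variety s n L = {proj_point A | A. A \<in> nonzero_mats n \<and>
     (\<exists>W. VectorSpace.subspace class_ring W (module_vec TYPE('a) n) \<and> W \<subseteq> L \<and>
          (\<forall>v\<in>W. A *\<^sub>v v \<in> W) \<and> s \<le> subspace_dim n W)}"

definition kalman_matrix :: "nat \<Rightarrow> 'a::field mat \<Rightarrow> 'a mat \<Rightarrow> 'a mat" where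
  "kalman_matrix d C A = mat_of_rows (dim_col C) (concat (map (\<lambda>k. rows (C * A ^\<^sub>m k)) [0..<d + 1]))"

definition reduced_kalman_matrix :: "nat \<Rightarrow> 'a::field mat \<Rightarrow> 'a mat" where
  "reduced_kalman_matrix d A = (case split_block A d d of (A11, A12, A21, A22) \<Rightarrow>
     mat_of_rows d (concat (map (\<lambda>k. rows (A21 * A11 ^\<^sub>m k)) [0..<d])))"

definition minors :: "nat \<Rightarrow> 'a::comm_ring_1 mat \<Rightarrow> 'a set" where
  "minors k M = {det (submatrix M I J) | I J.
     I \<subseteq> {..<dim_row M} \<and> J \<subseteq> {..<dim_col M} \<and> card I = k \<and> card J = k}"

definition mat_rank :: "'a::field mat \<Rightarrow> nat" where
  "mat_rank M = vec_space.rank (dim_row M) M"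

text \<open>
  \<open>P\<close> is the matrix of a change of coordinates with inverse \<open>Q\<close> such that in the new coordinates
  \<open>L\<close> is spanned by the first \<open>d\<close> standard basis vectors. In the new coordinates the endomorphism
  \<open>A\<close> has the matrix \<open>Q * A * P\<close>.
\<close>

definition adapted_coords :: "nat \<Rightarrow> nat \<Rightarrow> 'a::field vec set \<Rightarrow> 'a mat \<Rightarrow> 'a mat \<Rightarrow> bool" where
  "adapted_coords d n L P Q \<longleftrightarrow> P \<in> carrier_mat n n \<and> Q \<in> carrier_mat n n \<and>
     inverts_mat P Q \<and> inverts_mat Q P \<and>
     L = (\<lambda>v. P *\<^sub>v v) ` LinearCombinations.module.span class_ring (module_vec TYPE('a) n)
           (unit_vec n ` {..<d})"

end

theory Submission
  imports Defs
begin

text \<open>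
  The kernel of the Kalman matrix of \<open>A\<close> is the largest \<open>A\<close>-invariant subspace of \<open>L\<close>; hence \<open>L\<close> contains an invariant
  subspace of dimension at least \<open>s\<close> iff the Kalman matrix has rank at most \<open>n - s\<close>. In adapted coordinates the reduced
  Kalman matrix has the same kernel as a matrix on \<open>L = K\<^sup>d\<close>.

  For \<open>s = 1\<close> let \<open>\<delta>\<close> be the dimension of this kernel. If \<open>\<delta> \<ge> 2\<close>, then \<open>A\<close> has two independent eigenvectors or a Jordan
  block of size two in \<open>L\<close>. Curves in the cone that keep one of the two eigenvectors, or move the eigenvector within the
  block, have velocities at \<open>A\<close> that span all matrices. If \<open>\<delta> = 1\<close> with eigenvector \<open>v\<close> and eigenvalue \<open>\<mu>\<close>, then \<open>V\<close> is
  tangent iff \<open>V v + A w = \<mu> w + c v\<close> for some \<open>w \<in> L\<close> and scalar \<open>c\<close>, so the tangent space of the cone has dimension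
  \<open>n\<^sup>2 - n + d\<close>.

  The local dimension is \<open>n (n - 1) + d - 1\<close> everywhere. A chain of irreducible closed sets of length \<open>k\<close> makes the
  Hilbert function grow at least like \<open>m\<^sup>k\<close>, while the variety has a dense parametrisation with \<open>n (n - 1) + d - 1\<close>
  parameters, of bounded degree in each of them. Conversely the varieties of a complete flag
  \<open>\<langle>v\<rangle> \<subset> \<dots> \<subset> L\<close>, where \<open>v\<close> is an eigenvector of \<open>A\<close>, prolong a chain of linear spaces through \<open>A\<close>.
\<close>

section \<open>Dimensions of subspaces\<close>

text \<open>Tangent spaces are defined by all forms vanishing on the variety, and it is not shown
  that the minors generate that ideal. Tangency of a vector is therefore proved by Taylor expansion
  along curves in the cone, which tests all vanishing forms at once, while the opposite bound only
  needs a few explicit vanishing forms. Curves also carry the irreducibility and density arguments: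
  a nonzero univariate polynomial cannot vanish at all but finitely many points of an infinite
  field. The local dimension is a length of chains of closed sets. Instead of transcendence degrees,
  forms of degree \<open>m\<close> that are independent on the top of a chain are counted; only the
  exponent of growth matters, so the degrees of the forms separating consecutive members are
  harmless. Bounding the degree in each of \<open>D\<close> parameters separately gives the simple
  count \<open>(m + 1)\<^sup>D\<close>. The cone has dimension \<open>n (n - 1) + d\<close>, which
  is the tangent dimension where \<delta> is 1. Since \<open>d < n\<close>, it differs from the
  tangent dimension \<open>n\<^sup>2\<close> found where \<delta> is at least 2.\<close>

lemma subspace_vec_iff:
  "VectorSpace.subspace class_ring W (module_vec TYPE('a::field) n) \<longleftrightarrow>
    W \<subseteq> carrier_vec n \<and> 0\<^sub>v n \<in> W \<and> (\<forall>v\<in>W. \<forall>w\<in>W. v + w \<in> W) \<and> (\<forall>c. \<forall>v\<in>W. c \<cdot>\<^sub>v v \<in> W)"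
proof -
  interpret vec_space "TYPE('a)" n .
  have "subspace class_ring W V \<longleftrightarrow> submodule class_ring W V"
    using vectorspace_axioms by (auto simp: subspace_def)
  also have "\<dots> \<longleftrightarrow> W \<subseteq> carrier_vec n \<and> 0\<^sub>v n \<in> W \<and> (\<forall>v\<in>W. \<forall>w\<in>W. v + w \<in> W) \<and> (\<forall>c. \<forall>v\<in>W. c \<cdot>\<^sub>v v \<in> W)"
    using module_axioms by (auto simp: submodule_def module_vec_simps class_ring_simps)
  finally show ?thesis .
qed

lemma subspace_mat_iff:
  "VectorSpace.subspace class_ring W (module_mat TYPE('a::field) n m) \<longleftrightarrow>
    W \<subseteq> carrier_mat n m \<and> 0\<^sub>m n m \<in> W \<and> (\<forall>v\<in>W. \<forall>w\<in>W. v + w \<in> W) \<and> (\<forall>c. \<forall>v\<in>W. c \<cdot>\<^sub>m v \<in> W)"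
proof -
  interpret vectorspace class_ring "module_mat TYPE('a) n m" by (rule matrix_vs)
  have "subspace class_ring W (module_mat TYPE('a) n m) \<longleftrightarrow> submodule class_ring W (module_mat TYPE('a) n m)"
    using vectorspace_axioms by (auto simp: subspace_def)
  also have "\<dots> \<longleftrightarrow> W \<subseteq> carrier_mat n m \<and> 0\<^sub>m n m \<in> W \<and> (\<forall>v\<in>W. \<forall>w\<in>W. v + w \<in> W) \<and> (\<forall>c. \<forall>v\<in>W. c \<cdot>\<^sub>m v \<in> W)"
    using module_axioms by (auto simp: submodule_def module_mat_simps class_ring_simps)
  finally show ?thesis .
qed

text \<open>Independent subsets of \<open>W\<close> have at most \<open>dim V\<close> elements, so
  one of maximal size exists; it spans \<open>W\<close>, since any vector of \<open>W\<close>
  outside its span would enlarge it.\<close>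

lemma subspace_fin_dim:
  assumes "vectorspace K V" "vectorspace.fin_dim K V" "VectorSpace.subspace K W V"
  shows "vectorspace.fin_dim K (V\<lparr>carrier := W\<rparr>)"
proof -
  interpret V: vectorspace K V by fact
  interpret W: vectorspace K "V\<lparr>carrier := W\<rparr>" using V.subspace_is_vs assms(3) by blast
  have sub: "submodule K W V" using assms(3) by (auto simp: subspace_def)
  have WV: "W \<subseteq> carrier V" using sub by (auto simp: submodule_def)
  obtain B where B: "finite B" "B \<subseteq> W" "V.module.lin_indpt B"
    and mx: "\<And>b. b \<in> W \<Longrightarrow> V.module.lin_indpt (insert b B) \<Longrightarrow> b \<in> B"
  proof -
    have bd: "\<forall>B. B \<subseteq> W \<and> V.module.lin_indpt B \<longrightarrow> card B \<le> V.dim \<and> finite B"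
      using V.li_le_dim[OF assms(2)] WV by (metis assms(2) V.fin_dim_li_fin subset_trans)
    obtain B where B: "B \<subseteq> W \<and> V.module.lin_indpt B"
      and Bm: "\<And>B'. B' \<subseteq> W \<and> V.module.lin_indpt B' \<Longrightarrow> card B' \<le> card B"
    proof -
      have "{} \<subseteq> W \<and> V.module.lin_indpt {}" by (simp add: V.module.lin_dep_def)
      then show ?thesis
        using that ex_has_greatest_nat[of "\<lambda>B. B \<subseteq> W \<and> V.module.lin_indpt B" "{}" card "Suc V.dim"] bd
        by (auto simp: less_Suc_eq_le)
    qed
    show ?thesis
    proof (rule that)
      show "finite B" using bd B by blast
      show "B \<subseteq> W" "V.module.lin_indpt B" using B by auto
      fix b assume "b \<in> W" "V.module.lin_indpt (insert b B)"
      then have "card (insert b B) \<le> card B" using B by (intro Bm) auto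
      then show "b \<in> B" using bd B by (metis card_insert_disjoint not_less_eq_eq order_refl)
    qed
  qed
  have "W \<subseteq> V.module.span B"
  proof
    fix b assume b: "b \<in> W"
    show "b \<in> V.module.span B"
    proof (cases "b \<in> B")
      case True
      then show ?thesis using V.span_mem B WV by auto
    next
      case False
      then have "V.module.lin_dep (insert b B)" using mx b by blast
      then show ?thesis using V.lin_dep_iff_in_span[of B b] B WV b False by auto
    qed
  qed
  then have "W.module.gen_set B"
    using V.module.span_li_not_depend(1)[OF B(2) sub] V.module.span_is_subset[OF B(2) sub] \<open>W \<subseteq> V.module.span B\<close> by auto
  then show ?thesis unfolding W.fin_dim_def using B by auto
qed

lemma subspace_dim_mono_gen:
  assumes "vectorspace K V" "vectorspace.fin_dim K V" "VectorSpace.subspace K W V" "VectorSpace.subspace K X V" "X \<subseteq> W"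
  shows "vectorspace.dim K (V\<lparr>carrier := X\<rparr>) \<le> vectorspace.dim K (V\<lparr>carrier := W\<rparr>)"
proof -
  interpret V: vectorspace K V by fact
  interpret W: vectorspace K "V\<lparr>carrier := W\<rparr>" using V.subspace_is_vs assms(3) by blast
  have "subspace K X (V\<lparr>carrier := W\<rparr>)" using V.nested_subspaces assms(3,4,5) by blast
  from W.subspace_dim[OF this] show ?thesis
    using subspace_fin_dim[OF assms(1,2,3)] subspace_fin_dim[OF assms(1,2,4)] by simp
qed

text \<open>Linearity of \<open>T\<close> is asked on \<open>X\<close> only, so the statement serves
  both for a matrix acting on vectors and for matrices evaluated at a fixed vector.\<close>

lemma rank_nullity_sub:
  fixes T :: "'c \<Rightarrow> 'e"
  assumes "vectorspace K V" "vectorspace.fin_dim K V" "VectorSpace.subspace K X V"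
    and "vectorspace K U"
    and "\<And>x. x \<in> X \<Longrightarrow> T x \<in> carrier U"
    and "\<And>x y. x \<in> X \<Longrightarrow> y \<in> X \<Longrightarrow> T (x \<oplus>\<^bsub>V\<^esub> y) = T x \<oplus>\<^bsub>U\<^esub> T y"
    and "\<And>c x. c \<in> carrier K \<Longrightarrow> x \<in> X \<Longrightarrow> T (c \<odot>\<^bsub>V\<^esub> x) = c \<odot>\<^bsub>U\<^esub> T x"
  shows "vectorspace.dim K (U\<lparr>carrier := T ` X\<rparr>) + vectorspace.dim K (V\<lparr>carrier := {x\<in>X. T x = \<zero>\<^bsub>U\<^esub>}\<rparr>)
     = vectorspace.dim K (V\<lparr>carrier := X\<rparr>)"
proof -
  interpret V: vectorspace K V by fact
  interpret U: vectorspace K U by fact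
  interpret X: vectorspace K "V\<lparr>carrier := X\<rparr>" using V.subspace_is_vs assms(3) by blast
  interpret lm: linear_map K "V\<lparr>carrier := X\<rparr>" U T
    by unfold_locales (use assms(5-7) in \<open>auto simp: mod_hom_axioms_def module_hom_def\<close>)
  show ?thesis
    using lm.rank_nullity[OF subspace_fin_dim[OF assms(1-3)]]
    by (simp add: lm.im_def lm.ker_def)
qed


section \<open>Subspaces of coordinate space and ranks of matrices\<close>

lemma vec_fin_dim: "vectorspace.fin_dim class_ring (module_vec TYPE('a::field) n)"
proof -
  interpret vec_space "TYPE('a)" n .
  show ?thesis by simp
qed

lemma subspace_dim_mono:
  assumes "VectorSpace.subspace class_ring W (module_vec TYPE('a::field) n)"
    "VectorSpace.subspace class_ring X (module_vec TYPE('a) n)" "X \<subseteq> W"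
  shows "subspace_dim n X \<le> subspace_dim n W"
  unfolding subspace_dim_def by (rule subspace_dim_mono_gen[OF vec_vs vec_fin_dim assms])

lemma subspace_dim_carrier [simp]: "subspace_dim n (carrier_vec n :: 'a::field vec set) = n"
proof -
  interpret vec_space "TYPE('a)" n .
  have eq: "(module_vec TYPE('a) n)\<lparr>carrier := carrier_vec n\<rparr> = module_vec TYPE('a) n"
    by (simp add: module_vec_def)
  show ?thesis unfolding subspace_dim_def eq by (rule dim_is_n)
qed

lemma subspace_carrier_vec: "VectorSpace.subspace class_ring (carrier_vec n) (module_vec TYPE('a::field) n)"
  by (auto simp: subspace_vec_iff)

lemma subspace_mat_kernel:
  assumes "M \<in> carrier_mat m n"
  shows "VectorSpace.subspace class_ring (mat_kernel M) (module_vec TYPE('a::field) n)"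
  using assms by (auto simp: subspace_vec_iff mat_kernel[OF assms] mult_add_distrib_mat_vec[OF assms] mult_mat_vec[OF assms])

lemma mult_mat_vec_rank_nullity:
  fixes T :: "'a::field mat"
  assumes T: "T \<in> carrier_mat m n" and X: "VectorSpace.subspace class_ring X (module_vec TYPE('a) n)"
  shows "subspace_dim m ((\<lambda>x. T *\<^sub>v x) ` X) + subspace_dim n {x\<in>X. T *\<^sub>v x = 0\<^sub>v m} = subspace_dim n X"
proof -
  have Xc: "X \<subseteq> carrier_vec n" using X by (auto simp: subspace_vec_iff)
  have "\<And>x y. x \<in> X \<Longrightarrow> y \<in> X \<Longrightarrow> T *\<^sub>v (x + y) = T *\<^sub>v x + T *\<^sub>v y"
    using mult_add_distrib_mat_vec[OF T] Xc by blast
  moreover have "\<And>x. x \<in> X \<Longrightarrow> T *\<^sub>v x \<in> carrier_vec m"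
    using T Xc by auto
  moreover have "\<And>c x. x \<in> X \<Longrightarrow> T *\<^sub>v (c \<cdot>\<^sub>v x) = c \<cdot>\<^sub>v (T *\<^sub>v x)"
    using mult_mat_vec[OF T] Xc by blast
  ultimately show ?thesis
    using rank_nullity_sub[OF vec_vs vec_fin_dim X vec_vs, of "\<lambda>x. T *\<^sub>v x" m]
    by (simp add: subspace_dim_def module_vec_simps class_ring_simps)
qed

text \<open>Rank-nullity for the identity: its image already has dimension \<open>n\<close>, which
  leaves 0 for its kernel.\<close>

lemma subspace_dim_zero: "subspace_dim n {0\<^sub>v n :: 'a::field vec} = 0"
proof -
  have "subspace_dim n ((\<lambda>x. 1\<^sub>m n *\<^sub>v x) ` (carrier_vec n :: 'a vec set)) + subspace_dim n {x\<in>carrier_vec n. 1\<^sub>m n *\<^sub>v x = (0\<^sub>v n :: 'a vec)}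
      = subspace_dim n (carrier_vec n :: 'a vec set)"
    by (rule mult_mat_vec_rank_nullity[OF one_carrier_mat subspace_carrier_vec])
  moreover have "(\<lambda>x. 1\<^sub>m n *\<^sub>v x) ` (carrier_vec n :: 'a vec set) = carrier_vec n" by force
  moreover have "{x\<in>carrier_vec n. 1\<^sub>m n *\<^sub>v x = (0\<^sub>v n :: 'a vec)} = {0\<^sub>v n}" by auto
  ultimately show ?thesis by simp
qed

lemma subspace_dim_inj_image:
  fixes T :: "'a::field mat"
  assumes T: "T \<in> carrier_mat m n" and X: "VectorSpace.subspace class_ring X (module_vec TYPE('a) n)"
    and "\<And>x. x \<in> X \<Longrightarrow> T *\<^sub>v x = 0\<^sub>v m \<Longrightarrow> x = 0\<^sub>v n"
  shows "subspace_dim m ((\<lambda>x. T *\<^sub>v x) ` X) = subspace_dim n X"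
proof -
  have "0\<^sub>v n \<in> X" using X by (auto simp: subspace_vec_iff)
  moreover have "T *\<^sub>v 0\<^sub>v n = 0\<^sub>v m" using T by (intro eq_vecI) auto
  ultimately have "{x\<in>X. T *\<^sub>v x = 0\<^sub>v m} = {0\<^sub>v n}" using assms(3) by blast
  then show ?thesis using mult_mat_vec_rank_nullity[OF T X] by (simp add: subspace_dim_zero)
qed

lemma subspace_image:
  fixes T :: "'a::field mat"
  assumes T: "T \<in> carrier_mat m n" and X: "VectorSpace.subspace class_ring X (module_vec TYPE('a) n)"
  shows "VectorSpace.subspace class_ring ((\<lambda>x. T *\<^sub>v x) ` X) (module_vec TYPE('a) m)"
  unfolding subspace_vec_iff
proof (intro conjI ballI allI)
  have Xc: "X \<subseteq> carrier_vec n" and X0: "0\<^sub>v n \<in> X" using X by (auto simp: subspace_vec_iff)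
  show "(\<lambda>x. T *\<^sub>v x) ` X \<subseteq> carrier_vec m" using T Xc by auto
  have "T *\<^sub>v 0\<^sub>v n = 0\<^sub>v m" using T by (intro eq_vecI) auto
  then show "0\<^sub>v m \<in> (\<lambda>x. T *\<^sub>v x) ` X" using X0 by (metis imageI)
  fix v assume "v \<in> (\<lambda>x. T *\<^sub>v x) ` X"
  then obtain x where x: "x \<in> X" "v = T *\<^sub>v x" by auto
  show "c \<cdot>\<^sub>v v \<in> (\<lambda>x. T *\<^sub>v x) ` X" for c
    using x Xc X mult_mat_vec[OF T, of x c] by (intro image_eqI[of _ _ "c \<cdot>\<^sub>v x"]) (auto simp: subspace_vec_iff)
  fix w assume "w \<in> (\<lambda>x. T *\<^sub>v x) ` X"
  then obtain y where y: "y \<in> X" "w = T *\<^sub>v y" by auto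
  show "v + w \<in> (\<lambda>x. T *\<^sub>v x) ` X"
  proof (rule image_eqI[of _ _ "x + y"])
    show "v + w = T *\<^sub>v (x + y)" using x y mult_add_distrib_mat_vec[OF T subsetD[OF Xc x(1)] subsetD[OF Xc y(1)]] by simp
    show "x + y \<in> X" using x y X by (auto simp: subspace_vec_iff)
  qed
qed

lemma span_cols_image:
  fixes M :: "'a::field mat"
  assumes M: "M \<in> carrier_mat nr nc"
  shows "LinearCombinations.module.span class_ring (module_vec TYPE('a) nr) (set (cols M))
    = (\<lambda>x. M *\<^sub>v x) ` carrier_vec nc"
proof -
  interpret vec_space "TYPE('a)" nr .
  have c: "set (cols M) \<subseteq> carrier_vec nr" using M cols_dim by blast
  have l: "length (cols M) = nc" using M by simp
  have "lincomb_list f (cols M) = M *\<^sub>v vec nc f" for f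
    using lincomb_list_as_mat_mult[of "cols M" f] c l M
    by (metis carrier_matD(1) carrier_vecD mat_of_cols_cols subsetD)
  moreover have "\<exists>f. M *\<^sub>v v = M *\<^sub>v vec nc f" if "v \<in> carrier_vec nc" for v
    using that by (intro exI[of _ "\<lambda>i. v $ i"] arg_cong[of _ _ "\<lambda>v. M *\<^sub>v v"]) auto
  ultimately have "span_list (cols M) = (\<lambda>x. M *\<^sub>v x) ` carrier_vec nc"
    unfolding span_list_def by (auto simp: class_ring_simps)
  then show ?thesis using span_list_as_span[OF c] by simp
qed

lemma mat_rank_image:
  assumes M: "M \<in> carrier_mat nr nc"
  shows "mat_rank M = subspace_dim nr ((\<lambda>x. M *\<^sub>v x) ` carrier_vec nc)"
proof -
  interpret vec_space "TYPE('a)" nr .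
  show ?thesis using M span_cols_image[OF M] by (simp add: mat_rank_def rank_def subspace_dim_def)
qed

lemma rank_plus_nullity:
  fixes M :: "'a::field mat"
  assumes M: "M \<in> carrier_mat nr nc"
  shows "mat_rank M + subspace_dim nc (mat_kernel M) = nc"
  using mult_mat_vec_rank_nullity[OF M subspace_carrier_vec] M
  by (simp add: mat_rank_image[OF M] mat_kernel[OF M])

text \<open>The pigeonhole principle behind the counting arguments below: dual families,
  annihilating polynomials, common zeros of linear forms and the bound for Hilbert functions all
  take their nontrivial relation from here.\<close>

lemma nontrivial_kernel:
  fixes M :: "'a::field mat"
  assumes M: "M \<in> carrier_mat nr nc" and "nr < nc"
  obtains v where "v \<in> carrier_vec nc" "v \<noteq> 0\<^sub>v nc" "M *\<^sub>v v = 0\<^sub>v nr"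
proof -
  have "subspace_dim nr ((\<lambda>x. M *\<^sub>v x) ` carrier_vec nc) \<le> subspace_dim nr (carrier_vec nr :: 'a vec set)"
    using M by (intro subspace_dim_mono subspace_carrier_vec subspace_image[OF M]) auto
  then have "subspace_dim nc (mat_kernel M) \<noteq> 0"
    using rank_plus_nullity[OF M] mat_rank_image[OF M] assms(2) by simp
  then have "mat_kernel M \<noteq> {0\<^sub>v nc}" using subspace_dim_zero by metis
  moreover have "0\<^sub>v nc \<in> mat_kernel M" using subspace_mat_kernel[OF M] by (auto simp: subspace_vec_iff)
  ultimately obtain v where "v \<in> mat_kernel M" "v \<noteq> 0\<^sub>v nc" by blast
  then show ?thesis using that mat_kernelD[OF M] by blast
qed

lemma subspace_dim_le_1:
  fixes v :: "'a::field vec"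
  assumes v: "v \<in> carrier_vec n" and W: "VectorSpace.subspace class_ring W (module_vec TYPE('a) n)"
    and "\<And>w. w \<in> W \<Longrightarrow> \<exists>c. w = c \<cdot>\<^sub>v v"
  shows "subspace_dim n W \<le> 1"
proof -
  let ?T = "mat n (Suc 0) (\<lambda>(i,j). v $ i)"
  have T: "?T \<in> carrier_mat n (Suc 0)" by simp
  have Tv: "?T *\<^sub>v x = x $ 0 \<cdot>\<^sub>v v" if "x \<in> carrier_vec (Suc 0)" for x
    using v that by (intro eq_vecI) (auto simp: scalar_prod_def)
  have "W \<subseteq> (\<lambda>x. ?T *\<^sub>v x) ` carrier_vec (Suc 0)"
  proof
    fix w assume "w \<in> W"
    then obtain c where "w = c \<cdot>\<^sub>v v" using assms by blast
    then show "w \<in> (\<lambda>x. ?T *\<^sub>v x) ` carrier_vec (Suc 0)" 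
      by (intro image_eqI[of _ _ "vec (Suc 0) (\<lambda>_. c)"]) (auto simp: Tv)
  qed
  then have "subspace_dim n W \<le> subspace_dim n ((\<lambda>x. ?T *\<^sub>v x) ` carrier_vec (Suc 0))"
    by (rule subspace_dim_mono[OF subspace_image[OF T subspace_carrier_vec] W])
  also have "\<dots> \<le> 1"
    using mult_mat_vec_rank_nullity[OF T subspace_carrier_vec] by simp
  finally show ?thesis .
qed

text \<open>The columns of \<open>T\<close> play the role of \<open>k\<close> vectors in
  \<open>W\<close>, and injectivity of \<open>T\<close> expresses their independence.\<close>

lemma subspace_dim_ge:
  fixes T :: "'a::field mat"
  assumes T: "T \<in> carrier_mat n k" and W: "VectorSpace.subspace class_ring W (module_vec TYPE('a) n)"
    and "\<And>x. x \<in> carrier_vec k \<Longrightarrow> T *\<^sub>v x \<in> W"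
    and "\<And>x. x \<in> carrier_vec k \<Longrightarrow> T *\<^sub>v x = 0\<^sub>v n \<Longrightarrow> x = 0\<^sub>v k"
  shows "k \<le> subspace_dim n W"
proof -
  have "(\<lambda>x. T *\<^sub>v x) ` carrier_vec k \<subseteq> W" using assms(3) by blast
  from subspace_dim_mono[OF W subspace_image[OF T subspace_carrier_vec] this]
  show ?thesis using subspace_dim_inj_image[OF T subspace_carrier_vec assms(4)] by simp
qed

lemma subspace_dim_ge_1:
  fixes v :: "'a::field vec"
  assumes "VectorSpace.subspace class_ring W (module_vec TYPE('a) n)" "v \<in> W" "v \<noteq> 0\<^sub>v n"
  shows "Suc 0 \<le> subspace_dim n W"
proof (rule subspace_dim_ge[of "mat n (Suc 0) (\<lambda>(i,j). v $ i)"])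
  have v: "v \<in> carrier_vec n" using assms by (auto simp: subspace_vec_iff)
  have Tv: "mat n (Suc 0) (\<lambda>(i,j). v $ i) *\<^sub>v x = x $ 0 \<cdot>\<^sub>v v" if "x \<in> carrier_vec (Suc 0)" for x
    using v that by (intro eq_vecI) (auto simp: scalar_prod_def)
  show "mat n (Suc 0) (\<lambda>(i,j). v $ i) *\<^sub>v x \<in> W" if "x \<in> carrier_vec (Suc 0)" for x
    using assms Tv[OF that] by (auto simp: subspace_vec_iff)
  obtain i where i: "i < n" "v $ i \<noteq> 0" using v assms(3) by (metis carrier_vecD eq_vecI index_zero_vec(1,2))
  show "x = 0\<^sub>v (Suc 0)" if "x \<in> carrier_vec (Suc 0)" "mat n (Suc 0) (\<lambda>(i,j). v $ i) *\<^sub>v x = 0\<^sub>v n" for x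
  proof -
    have "(x $ 0 \<cdot>\<^sub>v v) $ i = 0" using that(2) i unfolding Tv[OF that(1)] by simp
    then have "x $ 0 = 0" using i v by simp
    then show ?thesis using that by (intro eq_vecI) auto
  qed
qed (use assms in auto)

section \<open>Minors and eigenvectors\<close>

lemma bij_betw_pick:
  assumes "finite I"
  shows "bij_betw (pick I) {..<card I} I"
proof (rule bij_betwI[where g = "\<lambda>i. card {a\<in>I. a < i}"])
  show "pick I \<in> {..<card I} \<rightarrow> I" by (simp add: pick_in_set_le)
  show "(\<lambda>i. card {a\<in>I. a < i}) \<in> I \<rightarrow> {..<card I}"
    using assms by (auto intro!: psubset_card_mono)
qed (auto simp: card_pick_le pick_card_in_set)

text \<open>Pairing a linear relation among the \<open>f j\<close> with \<open>r i\<close> isolates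
  its \<open>i\<close>-th coefficient, so the \<open>f j\<close> are independent vectors of length
  \<open>m\<close>.\<close>

lemma dual_family_card_le:
  fixes r f :: "nat \<Rightarrow> 'a::field vec"
  assumes I: "finite I" and r: "\<And>i. i \<in> I \<Longrightarrow> r i \<in> carrier_vec m"
    and f: "\<And>i. i \<in> I \<Longrightarrow> f i \<in> carrier_vec m"
    and dual: "\<And>i j. i \<in> I \<Longrightarrow> j \<in> I \<Longrightarrow> r i \<bullet> f j = (if i = j then 1 else 0)"
  shows "card I \<le> m"
proof (rule ccontr)
  let ?k = "card I"
  define F where "F = mat m ?k (\<lambda>(b,a). f (pick I a) $ b)"
  have F: "F \<in> carrier_mat m ?k" by (simp add: F_def)
  assume "\<not> ?k \<le> m"
  then have "m < ?k" by simp
  with nontrivial_kernel[OF F] obtain x where x: "x \<in> carrier_vec ?k" "x \<noteq> 0\<^sub>v ?k" "F *\<^sub>v x = 0\<^sub>v m"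
    by blast
  have "x $ a = 0" if a: "a < ?k" for a
  proof -
    have pI: "pick I b \<in> I" if "b < ?k" for b using that pick_in_set_le by blast
    have inj: "pick I a = pick I b \<longleftrightarrow> b = a" if "b < ?k" for b
      using bij_betw_pick[OF I] a that by (auto simp: bij_betw_def inj_on_def)
    have "0 = r (pick I a) \<bullet> (F *\<^sub>v x)" using r pI[OF a] x(3) by simp
    also have "\<dots> = (\<Sum>b<m. \<Sum>c<?k. r (pick I a) $ b * (f (pick I c) $ b * x $ c))"
      using x(1) r pI[OF a] by (simp add: scalar_prod_def F_def sum_distrib_left lessThan_atLeast0)
    also have "\<dots> = (\<Sum>c<?k. (r (pick I a) \<bullet> f (pick I c)) * x $ c)"
      using carrier_vecD[OF f[OF pI]]
      by (subst sum.swap) (simp add: scalar_prod_def sum_distrib_right mult.assoc lessThan_atLeast0)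
    also have "\<dots> = (\<Sum>c<?k. if c = a then x $ a else 0)"
      using pI a by (intro sum.cong refl) (auto simp: dual inj)
    finally show ?thesis using a by simp
  qed
  then have "x = 0\<^sub>v ?k" using x(1) by (intro eq_vecI) auto
  with x(2) show False by simp
qed

text \<open>\<open>I\<close> is a set of rows of minimal size that still has the kernel of
  \<open>M\<close>. By minimality, dropping row \<open>i\<close> admits a vector killed by the other
  rows but not by row \<open>i\<close>; scaled suitably, it is \<open>f i\<close>. The dual family
  certifies the independence of the rows in \<open>I\<close>.\<close>

lemma independent_rows:
  fixes M :: "'a::field mat"
  assumes M: "M \<in> carrier_mat nr nc"
  obtains I f where "I \<subseteq> {..<nr}"
    and "\<And>x. x \<in> carrier_vec nc \<Longrightarrow> (\<And>i. i \<in> I \<Longrightarrow> row M i \<bullet> x = 0) \<Longrightarrow> M *\<^sub>v x = 0\<^sub>v nr"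
    and "\<And>i. i \<in> I \<Longrightarrow> f i \<in> carrier_vec nc"
    and "\<And>i j. i \<in> I \<Longrightarrow> j \<in> I \<Longrightarrow> row M i \<bullet> f j = (if i = j then 1 else 0)"
proof -
  define P where "P I \<longleftrightarrow> I \<subseteq> {..<nr} \<and> (\<forall>x\<in>carrier_vec nc. (\<forall>i\<in>I. row M i \<bullet> x = 0) \<longrightarrow> M *\<^sub>v x = 0\<^sub>v nr)" for I
  have "P {..<nr}" unfolding P_def using M by (auto intro!: eq_vecI)
  then obtain I where I: "P I" and Imin: "\<And>J. P J \<Longrightarrow> card I \<le> card J"
    using ex_has_least_nat[of P _ card] by blast
  have fin: "finite I" using I finite_subset unfolding P_def by blast
  have "\<exists>v. v \<in> carrier_vec nc \<and> (\<forall>i'\<in>I. row M i' \<bullet> v = (if i' = i then 1 else 0))" if i: "i \<in> I" for i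
  proof -
    have "card (I - {i}) < card I" using fin i by (rule card_Diff1_less)
    then have "\<not> P (I - {i})" using Imin by (meson not_le)
    then obtain x where x: "x \<in> carrier_vec nc" "\<forall>i'\<in>I-{i}. row M i' \<bullet> x = 0" "M *\<^sub>v x \<noteq> 0\<^sub>v nr"
      using I unfolding P_def by blast
    have ne: "row M i \<bullet> x \<noteq> 0"
    proof
      assume "row M i \<bullet> x = 0"
      then have "\<forall>i'\<in>I. row M i' \<bullet> x = 0" using x(2) by auto
      then show False using I x unfolding P_def by blast
    qed
    have "row M i' \<bullet> (inverse (row M i \<bullet> x) \<cdot>\<^sub>v x) = (if i' = i then 1 else 0)" if "i' \<in> I" for i'
      using x that ne M I by (subst scalar_prod_smult_right) (auto simp: P_def)
    then show ?thesis using x(1) by (intro exI[of _ "inverse (row M i \<bullet> x) \<cdot>\<^sub>v x"]) auto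
  qed
  then obtain f where f: "\<And>i. i \<in> I \<Longrightarrow> f i \<in> carrier_vec nc \<and> (\<forall>i'\<in>I. row M i' \<bullet> f i = (if i' = i then 1 else 0))"
    by metis
  show ?thesis
    by (rule that[of I f]) (use I f in \<open>auto simp: P_def\<close>)
qed

text \<open>\<open>independent_rows\<close> is applied twice: to \<open>M\<close>, which yields
  \<open>k\<close> independent rows, and to the transpose of these rows, which selects the columns.
  The resulting square matrix has a transpose with trivial kernel.\<close>

lemma minor_exists:
  fixes M :: "'a::field mat"
  assumes M: "M \<in> carrier_mat nr nc" and k: "k \<le> mat_rank M"
  obtains I J where "I \<subseteq> {..<nr}" "J \<subseteq> {..<nc}" "card I = k" "card J = k" "det (submatrix M I J) \<noteq> 0"
proof -
  obtain I0 f where I0: "I0 \<subseteq> {..<nr}"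
    and ker: "\<And>x. x \<in> carrier_vec nc \<Longrightarrow> (\<And>i. i \<in> I0 \<Longrightarrow> row M i \<bullet> x = 0) \<Longrightarrow> M *\<^sub>v x = 0\<^sub>v nr"
    and f: "\<And>i. i \<in> I0 \<Longrightarrow> f i \<in> carrier_vec nc"
    and dual: "\<And>i j. i \<in> I0 \<Longrightarrow> j \<in> I0 \<Longrightarrow> row M i \<bullet> f j = (if i = j then 1 else 0)"
    using independent_rows[OF M] by blast
  have fin0: "finite I0" using I0 finite_subset by blast
  \<comment> \<open>The rows in \<open>I0\<close> alone have the same kernel as \<open>M\<close>,
    hence by rank-nullity at least its rank, and a matrix with \<open>card I0\<close> rows has rank
    at most \<open>card I0\<close>.\<close>
  have "mat_rank M \<le> card I0"
  proof -
    let ?S = "mat (card I0) nc (\<lambda>(a,j). M $$ (pick I0 a, j))"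
    have S: "?S \<in> carrier_mat (card I0) nc" by simp
    have rowS: "row ?S a = row M (pick I0 a)" if "a < card I0" for a
      using that pick_in_set_le[OF that] I0 M by (intro eq_vecI) auto
    have sub: "mat_kernel ?S \<subseteq> mat_kernel M"
    proof
      fix x assume "x \<in> mat_kernel ?S"
      then have x: "x \<in> carrier_vec nc" "?S *\<^sub>v x = 0\<^sub>v (card I0)" using mat_kernelD[OF S] by auto
      have "row M i \<bullet> x = 0" if "i \<in> I0" for i
      proof -
        obtain a where a: "a < card I0" "i = pick I0 a"
          using bij_betw_pick[OF fin0] \<open>i \<in> I0\<close> by (auto simp: bij_betw_def)
        have "(?S *\<^sub>v x) $ a = 0" using x a by simp
        then show ?thesis using a rowS[of a] by simp
      qed
      then show "x \<in> mat_kernel M" using ker x mat_kernelI[OF M] by blast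
    qed
    have "mat_rank ?S \<le> card I0"
      using subspace_dim_mono[OF subspace_carrier_vec subspace_image[OF S subspace_carrier_vec]] S
      unfolding mat_rank_image[OF S] by (auto simp: image_subset_iff)
    then show ?thesis
      using subspace_dim_mono[OF subspace_mat_kernel[OF M] subspace_mat_kernel[OF S] sub]
        rank_plus_nullity[OF M] rank_plus_nullity[OF S] by simp
  qed
  then obtain I where I: "I \<subseteq> I0" "card I = k" using k by (meson obtain_subset_with_card_n order_trans)
  have fin: "finite I" using I fin0 finite_subset by blast
  have pI: "pick I a \<in> I" "pick I a \<in> I0" "pick I a < nr" if "a < k" for a
    using pick_in_set_le[of a I] that I I0 by auto
  have injI: "pick I a = pick I b \<longleftrightarrow> a = b" if "a < k" "b < k" for a b
    using bij_betw_pick[OF fin] that I by (auto simp: bij_betw_def inj_on_def)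
  define T where "T = mat nc k (\<lambda>(j,a). M $$ (pick I a, j))"
  have T: "T \<in> carrier_mat nc k" by (simp add: T_def)
  \<comment> \<open>The columns of \<open>T\<close> are the chosen rows of \<open>M\<close>; pairing
    with the dual vectors \<open>f\<close> shows that they are independent.\<close>
  have Tker: "x = 0\<^sub>v k" if x: "x \<in> carrier_vec k" "T *\<^sub>v x = 0\<^sub>v nc" for x
  proof (rule eq_vecI)
    fix a assume "a < dim_vec (0\<^sub>v k)"
    then have a: "a < k" by simp
    let ?v = "f (pick I a)"
    have v: "?v \<in> carrier_vec nc" using f pI a by blast
    have "0 = ?v \<bullet> (T *\<^sub>v x)" using v x(2) by simp
    also have "\<dots> = (\<Sum>j<nc. \<Sum>b<k. ?v $ j * (M $$ (pick I b, j) * x $ b))"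
      using x(1) by (simp add: scalar_prod_def T_def sum_distrib_left lessThan_atLeast0)
    also have "\<dots> = (\<Sum>b<k. (row M (pick I b) \<bullet> ?v) * x $ b)"
      using v pI M by (subst sum.swap) (auto simp: scalar_prod_def sum_distrib_left mult_ac lessThan_atLeast0 intro!: sum.cong)
    also have "\<dots> = (\<Sum>b<k. if b = a then x $ a else 0)"
      using pI a by (intro sum.cong refl) (auto simp: dual injI)
    finally show "x $ a = 0\<^sub>v k $ a" using a by simp
  qed (use x in auto)
  obtain J g where J: "J \<subseteq> {..<nc}"
    and kerJ: "\<And>x. x \<in> carrier_vec k \<Longrightarrow> (\<And>j. j \<in> J \<Longrightarrow> row T j \<bullet> x = 0) \<Longrightarrow> T *\<^sub>v x = 0\<^sub>v nc"
    and g: "\<And>i. i \<in> J \<Longrightarrow> g i \<in> carrier_vec k"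
    and dualJ: "\<And>i j. i \<in> J \<Longrightarrow> j \<in> J \<Longrightarrow> row T i \<bullet> g j = (if i = j then 1 else 0)"
    using independent_rows[OF T] by blast
  have finJ: "finite J" using J finite_subset by blast
  have le: "card J \<le> k"
    by (rule dual_family_card_le[OF finJ _ g dualJ]) (use T J in auto)
  define B where "B = submatrix M I J"
  have Iset: "{i. i < dim_row M \<and> i \<in> I} = I" "{j. j < dim_col M \<and> j \<in> J} = J"
    using I I0 J M by auto
  have B: "B \<in> carrier_mat k (card J)" unfolding B_def submatrix_def Iset using I by simp
  have Bidx: "B $$ (a, b) = M $$ (pick I a, pick J b)" if "a < k" "b < card J" for a b
    unfolding B_def by (rule submatrix_index) (use that I Iset in auto)
  have BT: "transpose_mat B \<in> carrier_mat (card J) k" using B by simp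
  have BTker: "x = 0\<^sub>v k" if x: "x \<in> carrier_vec k" "transpose_mat B *\<^sub>v x = 0\<^sub>v (card J)" for x
  proof (rule Tker[OF x(1) kerJ[OF x(1)]])
    fix j assume "j \<in> J"
    then obtain b where b: "b < card J" "j = pick J b"
      using bij_betw_pick[OF finJ] by (auto simp: bij_betw_def)
    have "row T j = row (transpose_mat B) b"
      using B b J \<open>j \<in> J\<close> by (intro eq_vecI) (auto simp: T_def Bidx)
    moreover have "(transpose_mat B *\<^sub>v x) $ b = 0" using x b by simp
    ultimately show "row T j \<bullet> x = 0" using b B by simp
  qed
  \<comment> \<open>The dual family bounds \<open>card J\<close> above by \<open>k\<close>; a
    smaller \<open>J\<close> would give the transpose of \<open>B\<close> more columns than rows and
    so a nontrivial kernel.\<close>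
  have "\<not> card J < k" using nontrivial_kernel[OF BT] BTker by blast
  then have cJ: "card J = k" using le by simp
  have "det (transpose_mat B) \<noteq> 0"
    using det_0_iff_vec_prod_zero_field[of "transpose_mat B" k] BT BTker cJ by auto
  then have "det B \<noteq> 0" using B cJ det_transpose[of B k] by simp
  show ?thesis
    by (rule that[of I J]) (use I I0 J cJ \<open>det B \<noteq> 0\<close> B_def in auto)
qed

lemma minors_vanish_iff_rank:
  fixes M :: "'a::field mat"
  assumes M: "M \<in> carrier_mat nr nc"
  shows "(\<forall>\<mu>\<in>minors k M. \<mu> = 0) \<longleftrightarrow> mat_rank M < k"
proof
  assume "\<forall>\<mu>\<in>minors k M. \<mu> = 0"
  then show "mat_rank M < k"
    using minor_exists[OF M, of k] M unfolding minors_def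
    by (smt (verit, best) carrier_matD mem_Collect_eq not_le)
next
  assume lt: "mat_rank M < k"
  show "\<forall>\<mu>\<in>minors k M. \<mu> = 0"
  proof
    fix \<mu> assume "\<mu> \<in> minors k M"
    then obtain I J where IJ: "\<mu> = det (submatrix M I J)" "J \<subseteq> {..<dim_col M}" "card J = k"
      unfolding minors_def by blast
    have "{j. j < nc \<and> j \<in> J} = J" using IJ M by auto
    then show "\<mu> = 0" using vec_space.rank_gt_minor[OF M, of I J] IJ lt M
      unfolding mat_rank_def by (metis carrier_matD(1) not_le)
  qed
qed

text \<open>This is the vector \<open>p(A) u\<close>, evaluated by Horner's scheme.\<close>

definition poly_act :: "'a::field mat \<Rightarrow> 'a vec \<Rightarrow> 'a poly \<Rightarrow> 'a vec" where
  "poly_act A u p = fold_coeffs (\<lambda>a v. a \<cdot>\<^sub>v u + A *\<^sub>v v) p (0\<^sub>v (dim_row A))"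

lemma mult_mat_zero_vec:
  assumes "A \<in> carrier_mat m n"
  shows "A *\<^sub>v 0\<^sub>v n = 0\<^sub>v m"
  using assms by (intro eq_vecI) auto

context
  fixes A :: "'a::field mat" and u :: "'a vec" and n
  assumes A: "A \<in> carrier_mat n n" and u: "u \<in> carrier_vec n"
begin

lemma poly_act_0 [simp]: "poly_act A u 0 = 0\<^sub>v n"
  using A by (simp add: poly_act_def)

lemma poly_act_pCons [simp]: "poly_act A u (pCons a p) = a \<cdot>\<^sub>v u + A *\<^sub>v poly_act A u p"
proof (cases "a = 0 \<and> p = 0")
  case True
  then show ?thesis using A u mult_mat_zero_vec[OF A] by (auto simp: poly_act_def)
next
  case False
  then show ?thesis by (auto simp: poly_act_def fold_coeffs_pCons_coeff_not_0_eq fold_coeffs_pCons_not_0_0_eq)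
qed

lemma poly_act_carrier [simp]: "poly_act A u p \<in> carrier_vec n"
  by (induction p) (use A u in auto)

lemma poly_act_dim [simp]: "dim_vec (poly_act A u p) = n"
  using poly_act_carrier by (rule carrier_vecD)

lemma poly_act_add: "poly_act A u (p + q) = poly_act A u p + poly_act A u q"
proof (induction p q rule: poly_induct2)
  case (pCons a p b q)
  have "(a + b) \<cdot>\<^sub>v u + (A *\<^sub>v poly_act A u p + A *\<^sub>v poly_act A u q)
      = a \<cdot>\<^sub>v u + A *\<^sub>v poly_act A u p + (b \<cdot>\<^sub>v u + A *\<^sub>v poly_act A u q)"
    using A u by (intro eq_vecI) (auto simp: algebra_simps)
  then show ?case using pCons A by (simp add: mult_add_distrib_mat_vec[OF A])
qed auto

lemma poly_act_smult: "poly_act A u (Polynomial.smult c p) = c \<cdot>\<^sub>v poly_act A u p"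
proof (induction p)
  case (pCons a p)
  have "(c * a) \<cdot>\<^sub>v u + c \<cdot>\<^sub>v (A *\<^sub>v poly_act A u p) = c \<cdot>\<^sub>v (a \<cdot>\<^sub>v u + A *\<^sub>v poly_act A u p)"
    using A u by (intro eq_vecI) (auto simp: algebra_simps)
  then show ?case using pCons A by (simp add: mult_mat_vec[OF A])
qed auto

lemma poly_act_linear_factor:
  "poly_act A u ([:- \<mu>, 1:] * q) = A *\<^sub>v poly_act A u q + (- \<mu>) \<cdot>\<^sub>v poly_act A u q"
proof -
  have "[:- \<mu>, 1:] * q = Polynomial.smult (- \<mu>) q + pCons 0 q" by simp
  then have "poly_act A u ([:- \<mu>, 1:] * q) = (- \<mu>) \<cdot>\<^sub>v poly_act A u q + (0 \<cdot>\<^sub>v u + A *\<^sub>v poly_act A u q)"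
    by (simp only: poly_act_add poly_act_smult poly_act_pCons)
  also have "\<dots> = A *\<^sub>v poly_act A u q + (- \<mu>) \<cdot>\<^sub>v poly_act A u q"
    using A u by (intro eq_vecI) auto
  finally show ?thesis .
qed

lemma poly_act_in:
  assumes W: "VectorSpace.subspace class_ring W (module_vec TYPE('a) n)" and inv: "\<forall>v\<in>W. A *\<^sub>v v \<in> W" and "u \<in> W"
  shows "poly_act A u p \<in> W"
  by (induction p) (use assms in \<open>auto simp: subspace_vec_iff\<close>)

text \<open>The \<open>n + 1\<close> vectors \<open>u, A u, ..., A\<^sup>n u\<close> are linearly
  dependent, and the coefficients of a relation form the polynomial.\<close>

lemma poly_act_annihilator: "\<exists>p. p \<noteq> 0 \<and> poly_act A u p = 0\<^sub>v n"
proof -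
  define E where "E = mat n (Suc n) (\<lambda>(i,j). poly_act A u (monom 1 j) $ i)"
  have E: "E \<in> carrier_mat n (Suc n)" by (simp add: E_def)
  obtain c where c: "c \<in> carrier_vec (Suc n)" "c \<noteq> 0\<^sub>v (Suc n)" "E *\<^sub>v c = 0\<^sub>v n"
    using nontrivial_kernel[OF E] by blast
  define p where "p = (\<Sum>j<Suc n. monom (c $ j) j)"
  have sum: "poly_act A u (\<Sum>j<m. monom (c $ j) j) $ i = (\<Sum>j<m. c $ j * poly_act A u (monom 1 j) $ i)" if "i < n" for i m
  proof (induction m)
    case (Suc m)
    have "poly_act A u (monom (c $ m) m) = c $ m \<cdot>\<^sub>v poly_act A u (monom 1 m)"
      using poly_act_smult[of "c $ m" "monom 1 m"] by (simp add: smult_monom)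
    then show ?case using Suc that by (simp add: poly_act_add)
  qed (use that in simp)
  have "poly_act A u p = 0\<^sub>v n"
  proof (rule eq_vecI)
    fix i assume "i < dim_vec (0\<^sub>v n)"
    then have i: "i < n" by simp
    have "poly_act A u p $ i = (E *\<^sub>v c) $ i"
      unfolding p_def sum[OF i] using i c(1) E 
      by (simp add: scalar_prod_def E_def lessThan_atLeast0 mult.commute del: sum.lessThan_Suc)
    then show "poly_act A u p $ i = 0\<^sub>v n $ i" using c by simp
  qed auto
  moreover have "p \<noteq> 0"
  proof
    assume "p = 0"
    have "coeff p j = c $ j" if "j < Suc n" for j
      unfolding p_def coeff_sum using that by (simp add: coeff_monom del: sum.lessThan_Suc)
    then have "c = 0\<^sub>v (Suc n)" using \<open>p = 0\<close> c(1) by (intro eq_vecI) auto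
    then show False using c by simp
  qed
  ultimately show ?thesis by blast
qed

end

text \<open>For \<open>W' = 0\<close> this is the existence of an eigenvector in \<open>W\<close>; for \<open>W'\<close> spanned by an eigenvector
  it provides a second vector spanning together with it an invariant plane.\<close>

lemma exists_eigenvector_modulo:
  fixes A :: "'a::alg_closed_field mat"
  assumes A: "A \<in> carrier_mat n n"
    and W: "VectorSpace.subspace class_ring W (module_vec TYPE('a) n)" "\<forall>v\<in>W. A *\<^sub>v v \<in> W"
    and W': "VectorSpace.subspace class_ring W' (module_vec TYPE('a) n)"
    and u: "u \<in> W" "u \<notin> W'"
  obtains w \<mu> where "w \<in> W" "w \<notin> W'" "A *\<^sub>v w + (- \<mu>) \<cdot>\<^sub>v w \<in> W'"
proof -
  have uc: "u \<in> carrier_vec n" using u W by (auto simp: subspace_vec_iff)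
  \<comment> \<open>Among the nonzero \<open>p\<close> with \<open>p(A) u\<close> in
    \<open>W'\<close> take one of least degree. It is not constant because \<open>u\<close> is
    outside \<open>W'\<close>, so it has a root \<mu>. Removing the factor of this root leaves a
    \<open>q\<close> of smaller degree: \<open>q(A) u\<close> is outside \<open>W'\<close>, but
    \<open>A - \<mu>\<close> carries it into \<open>W'\<close>.\<close>
  define Q where "Q p \<longleftrightarrow> p \<noteq> 0 \<and> poly_act A u p \<in> W'" for p
  have "0\<^sub>v n \<in> W'" using W' by (auto simp: subspace_vec_iff)
  then obtain p0 where "Q p0" using poly_act_annihilator[OF A uc] unfolding Q_def by metis
  then obtain p where p: "Q p" and pmin: "\<And>q. Q q \<Longrightarrow> degree p \<le> degree q"
    using ex_has_least_nat[of Q _ degree] by blast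
  have "degree p > 0"
  proof (rule ccontr)
    assume "\<not> degree p > 0"
    then obtain c where c: "p = [:c:]" by (auto dest: degree_eq_zeroE)
    then have "c \<noteq> 0" "c \<cdot>\<^sub>v u + A *\<^sub>v 0\<^sub>v n \<in> W'" using p A uc by (auto simp: Q_def)
    moreover have "c \<cdot>\<^sub>v u + A *\<^sub>v 0\<^sub>v n = c \<cdot>\<^sub>v u" using mult_mat_zero_vec[OF A] uc by auto
    ultimately have "inverse c \<cdot>\<^sub>v (c \<cdot>\<^sub>v u) \<in> W'" using W' by (auto simp: subspace_vec_iff)
    then show False using \<open>c \<noteq> 0\<close> u by (simp add: smult_smult_assoc)
  qed
  then obtain \<mu> where "poly p \<mu> = 0" using alg_closed_imp_poly_has_root by blast
  then obtain q where q: "p = [:- \<mu>, 1:] * q" using poly_eq_0_iff_dvd by (metis dvdE)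
  have "q \<noteq> 0" using p q by (auto simp: Q_def)
  then have "degree p = degree [:- \<mu>, 1:] + degree q" unfolding q by (intro degree_mult_eq) auto
  then have "degree q < degree p" by simp
  then have "\<not> Q q" using pmin by (meson not_le)
  then have "poly_act A u q \<notin> W'" using \<open>q \<noteq> 0\<close> by (simp add: Q_def)
  moreover have "poly_act A u q \<in> W" by (rule poly_act_in[OF A uc W u(1)])
  moreover have "A *\<^sub>v poly_act A u q + (- \<mu>) \<cdot>\<^sub>v poly_act A u q \<in> W'"
    using p unfolding Q_def q poly_act_linear_factor[OF A uc] by blast
  ultimately show ?thesis using that by blast
qed

section \<open>Kernels of Kalman matrices\<close>

lemma pow_mat_vec_Suc:
  assumes "A \<in> carrier_mat n n" "v \<in> carrier_vec n"
  shows "A ^\<^sub>m Suc k *\<^sub>v v = A ^\<^sub>m k *\<^sub>v (A *\<^sub>v v)"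
  unfolding pow_mat.simps by (rule assoc_mult_mat_vec[OF pow_carrier_mat[OF assms(1)] assms])

lemma pow_mat_vec_carrier:
  assumes "A \<in> carrier_mat n n" "v \<in> carrier_vec n"
  shows "A ^\<^sub>m k *\<^sub>v v \<in> carrier_vec n"
  using pow_carrier_mat[OF assms(1)] assms(2) by (rule mult_mat_vec_carrier)

lemma pow_mat_vec_add:
  assumes "A \<in> carrier_mat n n" "v \<in> carrier_vec n"
  shows "A ^\<^sub>m (k + m) *\<^sub>v v = A ^\<^sub>m k *\<^sub>v (A ^\<^sub>m m *\<^sub>v v)"
  using assms(2)
proof (induction m arbitrary: v)
  case (Suc m)
  have "A *\<^sub>v v \<in> carrier_vec n" using assms(1) Suc by auto
  then show ?case using Suc pow_mat_vec_Suc[OF assms(1) Suc.prems] by (simp del: pow_mat.simps)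
qed (use assms in auto)

lemma mat_kernel_mat_of_rows:
  fixes rs :: "'a::comm_ring_1 vec list"
  assumes "set rs \<subseteq> carrier_vec m"
  shows "mat_kernel (mat_of_rows m rs) = {v \<in> carrier_vec m. \<forall>r\<in>set rs. r \<bullet> v = 0}"
proof -
  have "mat_of_rows m rs *\<^sub>v v = 0\<^sub>v (length rs) \<longleftrightarrow> (\<forall>r\<in>set rs. r \<bullet> v = 0)" if v: "v \<in> carrier_vec m" for v
  proof
    assume eq: "mat_of_rows m rs *\<^sub>v v = 0\<^sub>v (length rs)"
    show "\<forall>r\<in>set rs. r \<bullet> v = 0"
    proof
      fix r assume "r \<in> set rs"
      then obtain i where i: "i < length rs" "r = rs ! i" by (metis in_set_conv_nth)
      have "(mat_of_rows m rs *\<^sub>v v) $ i = 0" using eq i by simp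
      moreover have "rs ! i \<in> carrier_vec m" using assms i by auto
      ultimately show "r \<bullet> v = 0" using i by simp
    qed
  next
    assume "\<forall>r\<in>set rs. r \<bullet> v = 0"
    then show "mat_of_rows m rs *\<^sub>v v = 0\<^sub>v (length rs)"
      using assms by (intro eq_vecI) (auto simp: subset_iff)
  qed
  then show ?thesis by (auto simp: mat_kernel_def)
qed

lemma rows_subset: "M \<in> carrier_mat nr nc \<Longrightarrow> set (rows M) \<subseteq> carrier_vec nc"
  by (auto simp: rows_def)

lemma kernel_iff_rows:
  fixes M :: "'a::comm_ring_1 mat"
  assumes "M \<in> carrier_mat nr nc" "v \<in> carrier_vec nc"
  shows "M *\<^sub>v v = 0\<^sub>v nr \<longleftrightarrow> (\<forall>r\<in>set (rows M). r \<bullet> v = 0)"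
proof -
  have M: "mat_of_rows nc (rows M) = M" using assms by auto
  have "mat_kernel (mat_of_rows nc (rows M)) = {v \<in> carrier_vec nc. \<forall>r\<in>set (rows M). r \<bullet> v = 0}"
    by (rule mat_kernel_mat_of_rows[OF rows_subset[OF assms(1)]])
  then show ?thesis unfolding M using assms mat_kernel[OF assms(1)] by auto
qed

text \<open>A Kalman matrix is a stack of blocks of equal height; this locates a row by its block
  and its position in the block.\<close>

lemma concat_const_length:
  assumes "\<And>xs. xs \<in> set xss \<Longrightarrow> length xs = l"
  shows "length (concat xss) = length xss * l"
    and "i < length xss * l \<Longrightarrow> concat xss ! i = xss ! (i div l) ! (i mod l)"
proof -
  show len: "length (concat xss) = length xss * l" using assms by (induction xss) auto
  show "i < length xss * l \<Longrightarrow> concat xss ! i = xss ! (i div l) ! (i mod l)" using assms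
  proof (induction xss arbitrary: i)
    case (Cons xs xss)
    show ?case
    proof (cases "i < l")
      case True
      then show ?thesis using Cons by (simp add: nth_append)
    next
      case False
      then have l: "l > 0" using Cons.prems(1) by (cases l) auto
      have "concat xss ! (i - l) = xss ! ((i - l) div l) ! ((i - l) mod l)"
        using Cons False by (intro Cons.IH) auto
      then show ?thesis using Cons False l
        by (simp add: nth_append le_div_geq le_mod_geq)
    qed
  qed simp
qed

context
  fixes C A :: "'a::field mat" and m n d :: nat
  assumes C: "C \<in> carrier_mat m n" and A: "A \<in> carrier_mat n n"
begin

lemma kalman_matrix_carrier: "kalman_matrix d C A \<in> carrier_mat ((d + 1) * m) n"
proof -
  have "length (concat (map (\<lambda>k. rows (C * A ^\<^sub>m k)) [0..<d + 1])) = length (map (\<lambda>k. rows (C * A ^\<^sub>m k)) [0..<d + 1]) * m"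
    by (rule concat_const_length) (use C A in auto)
  then show ?thesis using C by (auto simp: kalman_matrix_def)
qed

lemma kalman_matrix_index:
  assumes "i < (d + 1) * m" "j < n"
  shows "kalman_matrix d C A $$ (i, j) = (C * A ^\<^sub>m (i div m)) $$ (i mod m, j)"
proof -
  let ?xss = "map (\<lambda>k. rows (C * A ^\<^sub>m k)) [0..<d + 1]"
  have m: "m > 0" using assms by (cases m) auto
  have l: "length xs = m" if "xs \<in> set ?xss" for xs using that C A by auto
  have "length (concat ?xss) = (d + 1) * m" using concat_const_length(1)[of ?xss m] l by simp
  moreover have "concat ?xss ! i = ?xss ! (i div m) ! (i mod m)"
    using concat_const_length(2)[of ?xss m i] l assms by simp
  moreover have "i div m < d + 1" using assms(1) m by (simp add: less_mult_imp_div_less)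
  then have "?xss ! (i div m) = rows (C * A ^\<^sub>m (i div m))"
    by (metis (no_types, lifting) add_0 diff_zero length_upt nth_map nth_upt)
  ultimately show ?thesis
    using assms C A m by (simp add: kalman_matrix_def mat_of_rows_def del: upt_Suc)
qed

lemma kernel_kalman_matrix:
  "mat_kernel (kalman_matrix d C A) = {v \<in> carrier_vec n. \<forall>k\<le>d. A ^\<^sub>m k *\<^sub>v v \<in> mat_kernel C}"
proof -
  let ?rs = "concat (map (\<lambda>k. rows (C * A ^\<^sub>m k)) [0..<d + 1])"
  have CA: "C * A ^\<^sub>m k \<in> carrier_mat m n" for k using C A by auto
  have rs: "set ?rs = (\<Union>k\<in>{..d}. set (rows (C * A ^\<^sub>m k)))" by (auto simp del: upt_Suc simp: less_Suc_eq_le)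
  have sub: "set ?rs \<subseteq> carrier_vec n" unfolding rs using rows_subset[OF CA] by blast
  have "mat_kernel (kalman_matrix d C A) = {v \<in> carrier_vec n. \<forall>r\<in>set ?rs. r \<bullet> v = 0}"
    unfolding kalman_matrix_def using mat_kernel_mat_of_rows[OF sub] C by auto
  also have "\<dots> = {v \<in> carrier_vec n. \<forall>k\<le>d. (C * A ^\<^sub>m k) *\<^sub>v v = 0\<^sub>v m}"
    unfolding rs using kernel_iff_rows[OF CA] by auto
  also have "\<dots> = {v \<in> carrier_vec n. \<forall>k\<le>d. A ^\<^sub>m k *\<^sub>v v \<in> mat_kernel C}"
    using assoc_mult_mat_vec[OF C pow_carrier_mat[OF A]] pow_mat_vec_carrier[OF A]
    by (auto simp: mat_kernel[OF C] simp del: assoc_mult_mat_vec)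
  finally show ?thesis .
qed

text \<open>The vectors \<open>v, Av, \<dots>, A\<^sup>dv\<close> of a \<open>d\<close>-dimensional space are dependent; the resulting linear recurrence
  keeps all further \<open>A\<^sup>kv\<close> in the space.\<close>

lemma kernel_kalman_matrix_invariant:
  assumes dim: "subspace_dim n (mat_kernel C) \<le> d" and v: "v \<in> mat_kernel (kalman_matrix d C A)"
  shows "A *\<^sub>v v \<in> mat_kernel (kalman_matrix d C A)"
proof -
  have vc: "v \<in> carrier_vec n" and vL: "\<And>k. k \<le> d \<Longrightarrow> A ^\<^sub>m k *\<^sub>v v \<in> mat_kernel C"
    using v by (auto simp: kernel_kalman_matrix)
  have pc: "A ^\<^sub>m k *\<^sub>v v \<in> carrier_vec n" for k
    using pow_carrier_mat[OF A] vc by (rule mult_mat_vec_carrier)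
  define T where "T = mat n (Suc d) (\<lambda>(i,k). (A ^\<^sub>m k *\<^sub>v v) $ i)"
  have T: "T \<in> carrier_mat n (Suc d)" by (simp add: T_def)
  have colT: "col T k = A ^\<^sub>m k *\<^sub>v v" if "k < Suc d" for k
    using that carrier_vecD[OF pc] by (intro eq_vecI) (auto simp: T_def)
  have BT: "(B * T) *\<^sub>v x = B *\<^sub>v (T *\<^sub>v x)" if "B \<in> carrier_mat m n" "x \<in> carrier_vec (Suc d)" for B x
    using that T by auto
  have BTi: "(B *\<^sub>v (T *\<^sub>v x)) $ i = (\<Sum>k\<le>d. (B *\<^sub>v (A ^\<^sub>m k *\<^sub>v v)) $ i * x $ k)"
    if "B \<in> carrier_mat m n" "x \<in> carrier_vec (Suc d)" "i < m" for B x i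
  proof -
    have "(B *\<^sub>v (T *\<^sub>v x)) $ i = ((B * T) *\<^sub>v x) $ i" using BT that by simp
    also have "\<dots> = (\<Sum>k\<le>d. (B * T) $$ (i, k) * x $ k)"
      proof -
      have "B * T \<in> carrier_mat m (Suc d)" using that T by auto
      then show ?thesis using that T
        by (simp add: scalar_prod_def row_def atLeast0LessThan lessThan_Suc_atMost del: assoc_mult_mat_vec index_mult_mat(1))
    qed
    also have "\<dots> = (\<Sum>k\<le>d. (B *\<^sub>v (A ^\<^sub>m k *\<^sub>v v)) $ i * x $ k)"
    proof (rule sum.cong[OF refl])
      fix k assume "k \<in> {..d}"
      then have "k < Suc d" by simp
      then have "(B * T) $$ (i, k) = row B i \<bullet> (A ^\<^sub>m k *\<^sub>v v)"
        using index_mult_mat(1)[of i B k T] colT[of k] that T by simp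
      moreover have "(B *\<^sub>v (A ^\<^sub>m k *\<^sub>v v)) $ i = row B i \<bullet> (A ^\<^sub>m k *\<^sub>v v)"
        by (rule index_mult_mat_vec) (use that in auto)
      ultimately show "(B * T) $$ (i, k) * x $ k = (B *\<^sub>v (A ^\<^sub>m k *\<^sub>v v)) $ i * x $ k"
        by (simp only:)
    qed
    finally show ?thesis .
  qed
  have "T *\<^sub>v x \<in> mat_kernel C" if x: "x \<in> carrier_vec (Suc d)" for x
  proof (rule mat_kernelI[OF C])
    show "C *\<^sub>v (T *\<^sub>v x) = 0\<^sub>v m"
    proof (rule eq_vecI)
      fix i assume "i < dim_vec (0\<^sub>v m)"
      then have i: "i < m" by simp
      have "(C *\<^sub>v (T *\<^sub>v x)) $ i = (\<Sum>k\<le>d. (C *\<^sub>v (A ^\<^sub>m k *\<^sub>v v)) $ i * x $ k)" by (rule BTi[OF C x i])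
      also have "\<dots> = 0" using vL i by (intro sum.neutral) (auto simp: mat_kernel[OF C])
      finally show "(C *\<^sub>v (T *\<^sub>v x)) $ i = 0\<^sub>v m $ i" using i by simp
    qed (use C in simp)
  qed (use T x in auto)
  then have "\<not> (\<forall>x\<in>carrier_vec (Suc d). T *\<^sub>v x = 0\<^sub>v n \<longrightarrow> x = 0\<^sub>v (Suc d))"
    using subspace_dim_ge[OF T subspace_mat_kernel[OF C]] dim by fastforce
  then obtain x where x: "x \<in> carrier_vec (Suc d)" "T *\<^sub>v x = 0\<^sub>v n" "x \<noteq> 0\<^sub>v (Suc d)" by blast
  have ex: "\<exists>k\<le>d. x $ k \<noteq> 0"
  proof (rule ccontr)
    assume "\<not> ?thesis"
    then have "x = 0\<^sub>v (Suc d)" using x(1) by (intro eq_vecI) (auto simp: less_Suc_eq_le)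
    then show False using x by simp
  qed
  \<comment> \<open>With \<open>j\<close> the last index of a nonzero coefficient, the relation
    expresses \<open>A\<^sup>j v\<close> by lower powers of \<open>A\<close> applied to
    \<open>v\<close>.\<close>
  define j where "j = (GREATEST k. k \<le> d \<and> x $ k \<noteq> 0)"
  have j: "j \<le> d" "x $ j \<noteq> 0" using ex GreatestI_ex_nat[of "\<lambda>k. k \<le> d \<and> x $ k \<noteq> 0" d] unfolding j_def by blast+
  have jmax: "x $ k = 0" if "j < k" "k \<le> d" for k
    using that Greatest_le_nat[of "\<lambda>k. k \<le> d \<and> x $ k \<noteq> 0" k d] unfolding j_def by fastforce
  have rec: "(\<Sum>k\<le>d. (C *\<^sub>v (A ^\<^sub>m (t + k) *\<^sub>v v)) $ i * x $ k) = 0" if i: "i < m" for t i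
  proof -
    have B: "C * A ^\<^sub>m t \<in> carrier_mat m n" using C A by auto
    have "(C * A ^\<^sub>m t) *\<^sub>v (A ^\<^sub>m k *\<^sub>v v) = C *\<^sub>v (A ^\<^sub>m (t + k) *\<^sub>v v)" for k
      using C A pc pow_mat_vec_add[OF A vc, of t k] assoc_mult_mat_vec[OF C pow_carrier_mat[OF A] pc] by simp
    then have "(\<Sum>k\<le>d. (C *\<^sub>v (A ^\<^sub>m (t + k) *\<^sub>v v)) $ i * x $ k) = ((C * A ^\<^sub>m t) *\<^sub>v (T *\<^sub>v x)) $ i"
      using BTi[OF B x(1) i] by simp
    also have "\<dots> = 0" unfolding x(2) mult_mat_zero_vec[OF B] using i by simp
    finally show ?thesis .
  qed
  have all: "A ^\<^sub>m k *\<^sub>v v \<in> mat_kernel C" for k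
  proof (induction k rule: less_induct)
    case (less k)
    show ?case
    proof (cases "k \<le> d")
      case False
      define t where "t = k - j"
      have t: "k = t + j" using False j t_def by simp
      show ?thesis
      proof (rule mat_kernelI[OF C pc], rule eq_vecI)
        fix i assume "i < dim_vec (0\<^sub>v m)"
        then have i: "i < m" by simp
        have "0 = (\<Sum>l\<le>d. (C *\<^sub>v (A ^\<^sub>m (t + l) *\<^sub>v v)) $ i * x $ l)" using rec[OF i] by simp
        \<comment> \<open>Terms with \<open>l < j\<close> involve powers below \<open>k\<close> and
          vanish under \<open>C\<close> by induction, terms with \<open>l > j\<close> have
          coefficient 0; what remains is a nonzero multiple of \<open>C A\<^sup>k v\<close>.\<close>
        also have "\<dots> = (\<Sum>l\<in>{j}. (C *\<^sub>v (A ^\<^sub>m (t + l) *\<^sub>v v)) $ i * x $ l)"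
        proof (rule sum.mono_neutral_right)
          show "\<forall>l\<in>{..d} - {j}. (C *\<^sub>v (A ^\<^sub>m (t + l) *\<^sub>v v)) $ i * x $ l = 0"
          proof
            fix l assume l: "l \<in> {..d} - {j}"
            show "(C *\<^sub>v (A ^\<^sub>m (t + l) *\<^sub>v v)) $ i * x $ l = 0"
            proof (cases "l < j")
              case True
              then have "A ^\<^sub>m (t + l) *\<^sub>v v \<in> mat_kernel C" using t by (intro less) auto
              then show ?thesis using i by (simp add: mat_kernel[OF C])
            qed (use l jmax in auto)
          qed
        qed (use j in auto)
        finally show "(C *\<^sub>v (A ^\<^sub>m k *\<^sub>v v)) $ i = 0\<^sub>v m $ i" using j i t by simp
      qed (use C in simp)
    qed (rule vL)
  qed
  show ?thesis
    unfolding kernel_kalman_matrix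
    using A vc all pow_mat_vec_Suc[OF A vc, symmetric] by (auto simp del: pow_mat.simps)
qed

lemma invariant_subset_kernel_kalman_matrix:
  assumes "W \<subseteq> mat_kernel C" "\<forall>v\<in>W. A *\<^sub>v v \<in> W"
  shows "W \<subseteq> mat_kernel (kalman_matrix d C A)"
proof -
  have "A ^\<^sub>m k *\<^sub>v v \<in> W" if "v \<in> W" for v k
    using that
  proof (induction k arbitrary: v)
    case 0
    then show ?case using A assms mat_kernel_carrier[OF C] by auto
  next
    case (Suc k)
    then show ?case using pow_mat_vec_Suc[OF A, of v k] assms mat_kernel_carrier[OF C] by auto
  qed
  then show ?thesis unfolding kernel_kalman_matrix using assms mat_kernel_carrier[OF C] by blast
qed

lemma exists_invariant_subspace_iff:
  assumes "subspace_dim n (mat_kernel C) \<le> d"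
  shows "(\<exists>W. VectorSpace.subspace class_ring W (module_vec TYPE('a) n) \<and> W \<subseteq> mat_kernel C \<and>
          (\<forall>v\<in>W. A *\<^sub>v v \<in> W) \<and> s \<le> subspace_dim n W) \<longleftrightarrow> s \<le> subspace_dim n (mat_kernel (kalman_matrix d C A))"
    (is "?l \<longleftrightarrow> ?r")
proof
  let ?K = "mat_kernel (kalman_matrix d C A)"
  have K: "VectorSpace.subspace class_ring ?K (module_vec TYPE('a) n)"
    by (rule subspace_mat_kernel[OF kalman_matrix_carrier])
  show "?r" if ?l
    using that invariant_subset_kernel_kalman_matrix subspace_dim_mono[OF K] by (meson order_trans)
  have "?K \<subseteq> mat_kernel C" unfolding kernel_kalman_matrix using A by force
  then show ?l if ?r
    using that K kernel_kalman_matrix_invariant[OF assms] by blast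
qed

end

lemma kalman_variety_eq:
  fixes C :: "'a::field mat"
  assumes C: "C \<in> carrier_mat m n" and dim: "subspace_dim n (mat_kernel C) \<le> d"
  shows "kalman_variety s n (mat_kernel C) =
    {proj_point A | A. A \<in> nonzero_mats n \<and> s \<le> subspace_dim n (mat_kernel (kalman_matrix d C A))}"
proof -
  have "A \<in> nonzero_mats n \<Longrightarrow> A \<in> carrier_mat n n" for A :: "'a mat" by (simp add: nonzero_mats_def)
  then show ?thesis
    unfolding kalman_variety_def
    by (intro Collect_cong iff_exI conj_cong refl) (rule exists_invariant_subspace_iff[OF C _ dim])
qed

lemma kalman_minors_iff:
  fixes C :: "'a::field mat"
  assumes C: "C \<in> carrier_mat m n" and A: "A \<in> carrier_mat n n" and "s \<le> n"
  shows "(\<forall>\<mu>\<in>minors (n - s + 1) (kalman_matrix d C A). \<mu> = 0)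
    \<longleftrightarrow> s \<le> subspace_dim n (mat_kernel (kalman_matrix d C A))"
  using minors_vanish_iff_rank[OF kalman_matrix_carrier[OF C A]]
    rank_plus_nullity[OF kalman_matrix_carrier[OF C A], of d] assms(3) by auto

section \<open>Coordinates adapted to \<open>L\<close> and the reduced Kalman matrix\<close>

definition incl_mat :: "nat \<Rightarrow> nat \<Rightarrow> 'a::zero_neq_one mat" where
  "incl_mat n d = mat n d (\<lambda>(i,j). if i = j then 1 else 0)"

lemma incl_mat_carrier [simp]: "incl_mat n d \<in> carrier_mat n d"
  by (simp add: incl_mat_def)

lemma incl_mat_mult_vec:
  fixes x :: "'a::comm_ring_1 vec"
  assumes "x \<in> carrier_vec d"
  shows "incl_mat n d *\<^sub>v x = vec n (\<lambda>i. if i < d then x $ i else 0)"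
proof (rule eq_vecI)
  fix i assume "i < dim_vec (vec n (\<lambda>i. if i < d then x $ i else 0))"
  then have i: "i < n" by simp
  have "(incl_mat n d *\<^sub>v x) $ i = (\<Sum>j\<in>{0..<d}. (if i = j then 1 else 0) * x $ j)"
    using i assms by (simp add: incl_mat_def scalar_prod_def)
  also have "\<dots> = (\<Sum>j\<in>{0..<d}. if i = j then x $ i else 0)" by (intro sum.cong) auto
  also have "\<dots> = (if i < d then x $ i else 0)" by (simp add: sum.delta')
  finally show "(incl_mat n d *\<^sub>v x) $ i = vec n (\<lambda>i. if i < d then x $ i else 0) $ i" using i by simp
qed (simp add: incl_mat_def)

lemma adapted_coordsD:
  fixes P Q :: "'a::field mat"
  assumes "adapted_coords d n L P Q" "d \<le> n"
  shows "P \<in> carrier_mat n n" "Q \<in> carrier_mat n n" "P * Q = 1\<^sub>m n" "Q * P = 1\<^sub>m n"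
    and "L = (\<lambda>x. (P * incl_mat n d) *\<^sub>v x) ` carrier_vec d"
proof -
  show P: "P \<in> carrier_mat n n" and "Q \<in> carrier_mat n n" "P * Q = 1\<^sub>m n" "Q * P = 1\<^sub>m n"
    using assms by (auto simp: adapted_coords_def inverts_mat_def)
  have "col (incl_mat n d) j = (unit_vec n j :: 'a vec)" if "j < d" for j
    using that assms(2) by (intro eq_vecI) (auto simp: incl_mat_def)
  then have "unit_vec n ` {..<d} = set (cols (incl_mat n d :: 'a mat))"
    unfolding cols_def by (force simp: incl_mat_def)
  then have "L = (\<lambda>v. P *\<^sub>v v) ` (\<lambda>x. incl_mat n d *\<^sub>v x) ` carrier_vec d"
    using assms(1) span_cols_image[of "incl_mat n d :: 'a mat" n d] by (simp add: adapted_coords_def)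
  also have "\<dots> = (\<lambda>x. (P * incl_mat n d) *\<^sub>v x) ` carrier_vec d"
    using assoc_mult_mat_vec[OF P incl_mat_carrier, of _ d] by (auto simp: image_image intro!: image_cong)
  finally show "L = (\<lambda>x. (P * incl_mat n d) *\<^sub>v x) ` carrier_vec d" .
qed

lemma mult_inverse_vec:
  fixes P Q :: "'a::field mat"
  assumes "P \<in> carrier_mat n n" "Q \<in> carrier_mat n n" "Q * P = 1\<^sub>m n" "v \<in> carrier_vec n"
  shows "Q *\<^sub>v (P *\<^sub>v v) = v"
  unfolding assoc_mult_mat_vec[OF assms(2,1,4), symmetric] using assms(3,4) by simp

lemma adapted_coords_inj:
  fixes P Q :: "'a::field mat"
  assumes "adapted_coords d n L P Q" "d \<le> n" "x \<in> carrier_vec d" "(P * incl_mat n d) *\<^sub>v x = 0\<^sub>v n"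
  shows "x = 0\<^sub>v d"
proof -
  note ad = adapted_coordsD[OF assms(1,2)]
  have "P *\<^sub>v (incl_mat n d *\<^sub>v x) = 0\<^sub>v n" using assms ad by (simp add: assoc_mult_mat_vec[OF ad(1) incl_mat_carrier])
  moreover have ic: "incl_mat n d *\<^sub>v x \<in> carrier_vec n" using incl_mat_carrier assms(3) by (rule mult_mat_vec_carrier)
  ultimately have "incl_mat n d *\<^sub>v x = Q *\<^sub>v 0\<^sub>v n" using mult_inverse_vec[OF ad(1,2,4) ic] by simp
  also have "\<dots> = 0\<^sub>v n" using ad(2) by (rule mult_mat_zero_vec)
  finally have "vec n (\<lambda>i. if i < d then x $ i else 0) = 0\<^sub>v n" by (simp add: incl_mat_mult_vec[OF assms(3)])
  then have eq: "vec n (\<lambda>i. if i < d then x $ i else 0) $ i = 0" if "i < n" for i using that by simp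
  show ?thesis
  proof (rule eq_vecI)
    fix i assume "i < dim_vec (0\<^sub>v d)"
    then show "x $ i = 0\<^sub>v d $ i" using eq[of i] assms(2) by simp
  qed (use assms(3) in simp)
qed

text \<open>The reduced Kalman matrix has the same kernel as the Kalman matrix, in the coordinates \<open>P\<close> of \<open>L\<close>.\<close>

lemma reduced_kalman_matrix_facts:
  fixes P Q A :: "'a::field mat"
  assumes C: "C \<in> carrier_mat m n" and ad: "adapted_coords d n (mat_kernel C) P Q" and d: "d \<le> n"
    and A: "A \<in> carrier_mat n n"
  shows "reduced_kalman_matrix d (Q * A * P) \<in> carrier_mat (d * (n - d)) d"
    and "mat_rank (reduced_kalman_matrix d (Q * A * P)) + subspace_dim n (mat_kernel (kalman_matrix d C A)) = d"
proof -
  note adD = adapted_coordsD[OF ad d]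
  define B where "B = Q * A * P"
  define A11 where "A11 = mat d d (\<lambda>ij. B $$ ij)"
  define A21 where "A21 = mat (n - d) d (\<lambda>(i,j). B $$ (i + d, j))"
  have B: "B \<in> carrier_mat n n" using adD A by (simp add: B_def)
  have A11: "A11 \<in> carrier_mat d d" and A21: "A21 \<in> carrier_mat (n - d) d" by (auto simp: A11_def A21_def)
  let ?rs = "concat (map (\<lambda>k. rows (A21 * A11 ^\<^sub>m k)) [0..<d])"
  have R: "reduced_kalman_matrix d B = mat_of_rows d ?rs"
    using B by (simp add: reduced_kalman_matrix_def split_block_def Let_def A11_def A21_def)
  have AA: "A21 * A11 ^\<^sub>m k \<in> carrier_mat (n - d) d" for k using A11 A21 by auto
  have l: "length xs = n - d" if "xs \<in> set (map (\<lambda>k. rows (A21 * A11 ^\<^sub>m k)) [0..<d])" for xs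
    using that A21 by auto
  have "length ?rs = d * (n - d)"
    using concat_const_length(1)[of "map (\<lambda>k. rows (A21 * A11 ^\<^sub>m k)) [0..<d]", OF l] by simp
  then have Rc: "reduced_kalman_matrix d B \<in> carrier_mat (d * (n - d)) d" unfolding R by (auto simp: carrier_matI)
  then show "reduced_kalman_matrix d (Q * A * P) \<in> carrier_mat (d * (n - d)) d" by (simp add: B_def)
  have sub: "set ?rs \<subseteq> carrier_vec d" using rows_subset[OF AA] by auto
  have kerR: "mat_kernel (reduced_kalman_matrix d B) = {w \<in> carrier_vec d. \<forall>k<d. A21 *\<^sub>v (A11 ^\<^sub>m k *\<^sub>v w) = 0\<^sub>v (n - d)}"
  proof -
    have "mat_kernel (reduced_kalman_matrix d B) = {w \<in> carrier_vec d. \<forall>k<d. (A21 * A11 ^\<^sub>m k) *\<^sub>v w = 0\<^sub>v (n - d)}"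
      unfolding R mat_kernel_mat_of_rows[OF sub] using kernel_iff_rows[OF AA] by auto
    then show ?thesis using assoc_mult_mat_vec[OF A21 pow_carrier_mat[OF A11]] by auto
  qed
  define T where "T = P * incl_mat n d"
  have T: "T \<in> carrier_mat n d" using adD by (auto simp: T_def)
  have L: "mat_kernel C = (\<lambda>x. T *\<^sub>v x) ` carrier_vec d" using adD by (simp add: T_def)
  have Tinj: "x = 0\<^sub>v d" if "x \<in> carrier_vec d" "T *\<^sub>v x = 0\<^sub>v n" for x
    using adapted_coords_inj[OF ad d] that by (simp add: T_def)
  \<comment> \<open>The first \<open>d\<close> columns of \<open>B\<close>, that is the restriction
    of the endomorphism to \<open>L\<close>; its upper part is \<open>A11\<close> and its lower part
    \<open>A21\<close>.\<close>
  define D where "D = B * incl_mat n d"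
  have D: "D \<in> carrier_mat n d" using B by (simp add: D_def)
  have AT: "A *\<^sub>v (T *\<^sub>v w) = P *\<^sub>v (D *\<^sub>v w)" if w: "w \<in> carrier_vec d" for w
  proof -
    have "P * D = P * (Q * A * P) * incl_mat n d" unfolding D_def B_def
      using adD(1,2) A by (intro assoc_mult_mat[symmetric, of _ n n _ n _ d]) auto
    also have "P * (Q * A * P) = A * P"
    proof -
      have "P * (Q * A * P) = P * (Q * (A * P))" using adD A by (simp add: assoc_mult_mat[of _ n n _ n _ n])
      also have "\<dots> = (P * Q) * (A * P)" using adD A by (intro assoc_mult_mat[symmetric, of _ n n _ n _ n]) auto
      finally show ?thesis using adD A by simp
    qed
    also have "A * P * incl_mat n d = A * T" unfolding T_def using A adD(1) by (intro assoc_mult_mat[of _ n n _ n _ d]) auto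
    finally have "A * T = P * D" by simp
    then show ?thesis using assoc_mult_mat_vec[OF A T w] assoc_mult_mat_vec[OF adD(1) D w] by simp
  qed
  have Dtop: "(D *\<^sub>v w) $ i = (A11 *\<^sub>v w) $ i" if "i < d" "w \<in> carrier_vec d" for i w
  proof -
    have "(B *\<^sub>v (incl_mat n d *\<^sub>v w)) $ i = (\<Sum>j\<in>{0..<n}. B $$ (i,j) * (if j < d then w $ j else 0))"
      using that d B by (simp add: incl_mat_mult_vec scalar_prod_def)
    also have "\<dots> = (\<Sum>j\<in>{0..<d}. B $$ (i,j) * w $ j)"
      using d by (intro sum.mono_neutral_cong_right) auto
    finally show ?thesis using that A11 B by (simp add: D_def assoc_mult_mat_vec[OF B incl_mat_carrier] A11_def scalar_prod_def)
  qed
  have Dbot: "(D *\<^sub>v w) $ (d + i) = (A21 *\<^sub>v w) $ i" if "i < n - d" "w \<in> carrier_vec d" for i w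
  proof -
    have "(B *\<^sub>v (incl_mat n d *\<^sub>v w)) $ (d + i) = (\<Sum>j\<in>{0..<n}. B $$ (d + i,j) * (if j < d then w $ j else 0))"
      using that d B by (simp add: incl_mat_mult_vec scalar_prod_def)
    also have "\<dots> = (\<Sum>j\<in>{0..<d}. B $$ (d + i,j) * w $ j)"
      using d by (intro sum.mono_neutral_cong_right) auto
    finally show ?thesis using that A21 B by (simp add: D_def assoc_mult_mat_vec[OF B incl_mat_carrier] A21_def scalar_prod_def add.commute)
  qed
  \<comment> \<open>Together with \<open>step2\<close>: \<open>A\<close> keeps the vector with
    coordinates \<open>w\<close> inside \<open>L\<close> exactly if \<open>A21 w = 0\<close>, and
    then acts on the coordinates by \<open>A11\<close>.\<close>
  have step1: "A *\<^sub>v (T *\<^sub>v w) = T *\<^sub>v (A11 *\<^sub>v w)" if w: "w \<in> carrier_vec d" and z: "A21 *\<^sub>v w = 0\<^sub>v (n - d)" for w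
  proof -
    have aw: "A11 *\<^sub>v w \<in> carrier_vec d" using A11 w by auto
    have "D *\<^sub>v w = incl_mat n d *\<^sub>v (A11 *\<^sub>v w)"
      unfolding incl_mat_mult_vec[OF aw]
    proof (rule eq_vecI)
      fix i assume "i < dim_vec (vec n (\<lambda>i. if i < d then (A11 *\<^sub>v w) $ i else 0))"
      then have i: "i < n" by simp
      show "(D *\<^sub>v w) $ i = vec n (\<lambda>i. if i < d then (A11 *\<^sub>v w) $ i else 0) $ i"
      proof (cases "i < d")
        case False
        then show ?thesis using Dbot[of "i - d" w] w z i by simp
      qed (use Dtop w i in auto)
    qed (use D in simp)
    then show ?thesis using AT[OF w] assoc_mult_mat_vec[OF adD(1) incl_mat_carrier aw] by (simp add: T_def)
  qed
  have step2: "A21 *\<^sub>v w = 0\<^sub>v (n - d)" if w: "w \<in> carrier_vec d" and AL: "A *\<^sub>v (T *\<^sub>v w) \<in> mat_kernel C" for w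
  proof -
    obtain x where x: "x \<in> carrier_vec d" "P *\<^sub>v (D *\<^sub>v w) = T *\<^sub>v x" using AL L AT[OF w] by auto
    have ix: "incl_mat n d *\<^sub>v x \<in> carrier_vec n" using incl_mat_carrier x(1) by (rule mult_mat_vec_carrier)
    have "P *\<^sub>v (D *\<^sub>v w) = P *\<^sub>v (incl_mat n d *\<^sub>v x)"
      using x assoc_mult_mat_vec[OF adD(1) incl_mat_carrier x(1)] by (simp add: T_def)
    then have "D *\<^sub>v w = incl_mat n d *\<^sub>v x"
      using mult_inverse_vec[OF adD(1,2,4) ix] mult_inverse_vec[OF adD(1,2,4) mult_mat_vec_carrier[OF D w]] by metis
    then show ?thesis using Dbot[OF _ w] A21 w by (intro eq_vecI) (auto simp: incl_mat_mult_vec[OF x(1)])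
  qed
  \<comment> \<open>The shift from \<open>j \<le> k\<close> to \<open>j < k\<close> is the reason
    why the Kalman matrix has \<open>d + 1\<close> blocks and the reduced one only \<open>d\<close>:
    the condition for \<open>j = 0\<close> on the left holds for every vector of
    \<open>L\<close>.\<close>
  have main: "(\<forall>j\<le>k. A ^\<^sub>m j *\<^sub>v (T *\<^sub>v w) \<in> mat_kernel C) \<longleftrightarrow> (\<forall>j<k. A21 *\<^sub>v (A11 ^\<^sub>m j *\<^sub>v w) = 0\<^sub>v (n - d))"
    if "w \<in> carrier_vec d" for k w
    using that
  proof (induction k arbitrary: w)
    case 0
    have "T *\<^sub>v w \<in> carrier_vec n" using T 0 by (rule mult_mat_vec_carrier)
    then show ?case using A 0 L by auto
  next
    case (Suc k)
    have Tw: "T *\<^sub>v w \<in> carrier_vec n" using T Suc by auto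
    have aw: "A11 *\<^sub>v w \<in> carrier_vec d" using A11 Suc.prems by auto
    have L0: "T *\<^sub>v w \<in> mat_kernel C" using L Suc.prems by blast
    have "(\<forall>j\<le>Suc k. A ^\<^sub>m j *\<^sub>v (T *\<^sub>v w) \<in> mat_kernel C) \<longleftrightarrow>
        (\<forall>j\<le>k. A ^\<^sub>m j *\<^sub>v (A *\<^sub>v (T *\<^sub>v w)) \<in> mat_kernel C)"
      using pow_mat_vec_Suc[OF A Tw] L0 A Tw
      by (metis (no_types, lifting) Suc_le_mono not0_implies_Suc one_mult_mat_vec carrier_matD(1) pow_mat.simps(1))
    also have "\<dots> \<longleftrightarrow> A21 *\<^sub>v w = 0\<^sub>v (n - d) \<and> (\<forall>j\<le>k. A ^\<^sub>m j *\<^sub>v (T *\<^sub>v (A11 *\<^sub>v w)) \<in> mat_kernel C)"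
    proof -
      have "A ^\<^sub>m 0 *\<^sub>v (A *\<^sub>v (T *\<^sub>v w)) = A *\<^sub>v (T *\<^sub>v w)" using A Tw by auto
      then show ?thesis using step1[OF Suc.prems] step2[OF Suc.prems] by (metis le0)
    qed
    also have "\<dots> \<longleftrightarrow> A21 *\<^sub>v w = 0\<^sub>v (n - d) \<and> (\<forall>j<k. A21 *\<^sub>v (A11 ^\<^sub>m j *\<^sub>v (A11 *\<^sub>v w)) = 0\<^sub>v (n - d))"
      using Suc.IH[OF aw] by simp
    also have "\<dots> \<longleftrightarrow> (\<forall>j<Suc k. A21 *\<^sub>v (A11 ^\<^sub>m j *\<^sub>v w) = 0\<^sub>v (n - d))"
      unfolding All_less_Suc2 pow_mat_vec_Suc[OF A11 Suc.prems] using A11 Suc.prems by auto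
    finally show ?case .
  qed
  have "mat_kernel (kalman_matrix d C A) = (\<lambda>x. T *\<^sub>v x) ` mat_kernel (reduced_kalman_matrix d B)"
  proof -
    have "mat_kernel (kalman_matrix d C A) = {v \<in> carrier_vec n. \<forall>k\<le>d. A ^\<^sub>m k *\<^sub>v v \<in> mat_kernel C}"
      by (rule kernel_kalman_matrix[OF C A])
    also have "\<dots> = (\<lambda>x. T *\<^sub>v x) ` {w \<in> carrier_vec d. \<forall>k\<le>d. A ^\<^sub>m k *\<^sub>v (T *\<^sub>v w) \<in> mat_kernel C}"
    proof -
      have "v \<in> mat_kernel C" if "v \<in> carrier_vec n" "\<forall>k\<le>d. A ^\<^sub>m k *\<^sub>v v \<in> mat_kernel C" for v
      proof -
        have "A ^\<^sub>m 0 *\<^sub>v v \<in> mat_kernel C" using that(2) by blast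
        then show ?thesis using that(1) A by simp
      qed
      then show ?thesis using L T by (auto simp: image_iff)
    qed
    also have "\<dots> = (\<lambda>x. T *\<^sub>v x) ` mat_kernel (reduced_kalman_matrix d B)"
      using main kerR by auto
    finally show ?thesis .
  qed
  then have "subspace_dim n (mat_kernel (kalman_matrix d C A)) = subspace_dim d (mat_kernel (reduced_kalman_matrix d B))"
    using subspace_dim_inj_image[OF T subspace_mat_kernel[OF Rc]] Tinj mat_kernel_carrier[OF Rc] by auto
  then show "mat_rank (reduced_kalman_matrix d (Q * A * P)) + subspace_dim n (mat_kernel (kalman_matrix d C A)) = d"
    using rank_plus_nullity[OF Rc] by (simp add: B_def)
qed

section \<open>Polynomials in matrix entries\<close>

definition monomial_value :: "(nat \<times> nat \<Rightarrow>\<^sub>0 nat) \<Rightarrow> (nat \<times> nat \<Rightarrow> 'b::comm_ring_1) \<Rightarrow> 'b" where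
  "monomial_value m X = (\<Prod>x\<in>Poly_Mapping.keys m. X x ^ Poly_Mapping.lookup m x)"

lemma monomial_value_superset:
  assumes "finite S" "Poly_Mapping.keys m \<subseteq> S"
  shows "monomial_value m X = (\<Prod>x\<in>S. X x ^ Poly_Mapping.lookup m x)"
  unfolding monomial_value_def using assms by (intro prod.mono_neutral_left) (auto simp: in_keys_iff)

lemma monomial_value_add: "monomial_value (m + m') X = monomial_value m X * monomial_value m' X"
proof -
  let ?S = "Poly_Mapping.keys m \<union> Poly_Mapping.keys m'"
  have "monomial_value (m + m') X = (\<Prod>x\<in>?S. X x ^ Poly_Mapping.lookup (m + m') x)"
    by (rule monomial_value_superset) (auto simp: keys_add)
  also have "\<dots> = monomial_value m X * monomial_value m' X"
    by (simp add: monomial_value_superset[of ?S m] monomial_value_superset[of ?S m'] lookup_add power_add prod.distrib)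
  finally show ?thesis .
qed

lemma monomial_value_single: "monomial_value (Poly_Mapping.single x k) X = X x ^ k"
  by (cases "k = 0") (simp_all add: monomial_value_def)

lemma monomial_value_0 [simp]: "monomial_value 0 X = 1"
  by (simp add: monomial_value_def)

text \<open>Evaluation along a homomorphism of coefficient rings. The identity gives values at a
  matrix, the embedding of constants into univariate polynomials gives substitution of a polynomial
  curve; both share the Taylor formula.\<close>

locale coeff_hom =
  fixes h :: "'a::comm_ring_1 \<Rightarrow> 'b::comm_ring_1"
  assumes h0: "h 0 = 0" and h1: "h 1 = 1"
    and h_add: "h (a + b) = h a + h b" and h_mult: "h (a * b) = h a * h b"
begin

definition eval :: "'a entry_poly \<Rightarrow> (nat \<times> nat \<Rightarrow> 'b) \<Rightarrow> 'b" where
  "eval f X = (\<Sum>m\<in>Poly_Mapping.keys f. h (Poly_Mapping.lookup f m) * monomial_value m X)"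

lemma h_of_nat: "h (of_nat k) = of_nat k"
  by (induction k) (auto simp: h_add h0 h1)

lemma eval_superset:
  assumes "finite S" "Poly_Mapping.keys f \<subseteq> S"
  shows "eval f X = (\<Sum>m\<in>S. h (Poly_Mapping.lookup f m) * monomial_value m X)"
  unfolding eval_def using assms by (intro sum.mono_neutral_left) (auto simp: in_keys_iff h0)

lemma eval_add: "eval (f + g) X = eval f X + eval g X"
proof -
  let ?S = "Poly_Mapping.keys f \<union> Poly_Mapping.keys g"
  have "eval (f + g) X = (\<Sum>m\<in>?S. h (Poly_Mapping.lookup (f + g) m) * monomial_value m X)"
    by (rule eval_superset) (auto simp: keys_add)
  also have "\<dots> = eval f X + eval g X"
    by (simp add: eval_superset[of ?S f] eval_superset[of ?S g] lookup_add h_add algebra_simps sum.distrib)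
  finally show ?thesis .
qed

lemma eval_0 [simp]: "eval 0 X = 0"
  by (simp add: eval_def)

lemma eval_sum: "eval (sum f S) X = (\<Sum>i\<in>S. eval (f i) X)"
  by (induction S rule: infinite_finite_induct) (auto simp: eval_add)

lemma eval_single: "eval (Poly_Mapping.single m c) X = h c * monomial_value m X"
  by (cases "c = 0") (simp_all add: eval_def h0)

end

interpretation scalar: coeff_hom "\<lambda>a::'a::comm_ring_1. a"
  by unfold_locales auto

interpretation curve: coeff_hom "\<lambda>a::'a::comm_ring_1. [:a:]"
  by unfold_locales (auto simp: one_pCons)

lemma peval_eval: "peval f A = scalar.eval f (\<lambda>x. A $$ x)"
  by (simp add: peval_def scalar.eval_def monomial_value_def)

lemma poly_monomial_value: "poly (monomial_value m X) t = monomial_value m (\<lambda>x. poly (X x) t)"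
  by (simp add: monomial_value_def poly_prod)

lemma poly_curve_eval: "poly (curve.eval f X) t = scalar.eval f (\<lambda>x. poly (X x) t)"
  by (simp add: curve.eval_def scalar.eval_def poly_sum poly_monomial_value)

text \<open>The binomial formula modulo \<open>c * c\<close>. For \<open>k = 0\<close> the truncated
  exponent \<open>k - 1\<close> does no harm because of the factor \<open>of_nat k\<close>.\<close>

lemma power_first_order:
  fixes x c v :: "'b::comm_ring_1"
  shows "\<exists>r. (x + c * v) ^ k = x ^ k + c * (of_nat k * x ^ (k - 1) * v) + c * c * r"
proof (induction k)
  case (Suc k)
  then obtain r where r: "(x + c * v) ^ k = x ^ k + c * (of_nat k * x ^ (k - 1) * v) + c * c * r" by blast
  have e: "of_nat k * x ^ (k - 1) * x = of_nat k * x ^ k" by (cases k) auto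
  have "(x + c * v) ^ Suc k = (x + c * v) * (x ^ k + c * (of_nat k * x ^ (k - 1) * v) + c * c * r)"
    by (simp add: r)
  also have "\<dots> = x * x ^ k + c * (of_nat k * x ^ (k - 1) * x * v + x ^ k * v)
      + c * c * (x * r + of_nat k * x ^ (k - 1) * v * v + c * v * r)"
    by (simp add: algebra_simps)
  also have "\<dots> = x ^ Suc k + c * (of_nat (Suc k) * x ^ (Suc k - 1) * v)
      + c * c * (x * r + of_nat k * x ^ (k - 1) * v * v + c * v * r)"
    unfolding e by (simp add: algebra_simps)
  finally show ?case by blast
qed (auto intro: exI[of _ 0])

text \<open>Leibniz rule modulo \<open>c * c\<close>. The exponents are written with the same
  truncated subtraction as in \<open>partial\<close>, so that the linear term is recognised as the
  derivative of a monomial.\<close>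

lemma prod_first_order:
  fixes X V :: "'i \<Rightarrow> 'b::comm_ring_1"
  assumes "finite S"
  shows "\<exists>r. (\<Prod>y\<in>S. (X y + c * V y) ^ a y) = (\<Prod>y\<in>S. X y ^ a y)
    + c * (\<Sum>x\<in>S. of_nat (a x) * (\<Prod>y\<in>S. X y ^ (a y - (if y = x then 1 else 0))) * V x) + c * c * r"
  using assms
proof (induction S)
  case (insert z S)
  let ?D = "\<Sum>x\<in>S. of_nat (a x) * (\<Prod>y\<in>S. X y ^ (a y - (if y = x then 1 else 0))) * V x"
  obtain r where r: "(\<Prod>y\<in>S. (X y + c * V y) ^ a y) = (\<Prod>y\<in>S. X y ^ a y) + c * ?D + c * c * r"
    using insert by blast
  obtain q where q: "(X z + c * V z) ^ a z = X z ^ a z + c * (of_nat (a z) * X z ^ (a z - 1) * V z) + c * c * q"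
    using power_first_order by blast
  have S1: "(\<Prod>y\<in>S. X y ^ (a y - (if y = z then 1 else 0))) = (\<Prod>y\<in>S. X y ^ a y)"
    using insert by (intro prod.cong) auto
  have "(\<Sum>x\<in>S. of_nat (a x) * (\<Prod>y\<in>insert z S. X y ^ (a y - (if y = x then 1 else 0))) * V x) = X z ^ a z * ?D"
    unfolding sum_distrib_left
  proof (rule sum.cong)
    fix x assume "x \<in> S"
    then have "z \<noteq> x" using insert by auto
    then show "of_nat (a x) * (\<Prod>y\<in>insert z S. X y ^ (a y - (if y = x then 1 else 0))) * V x =
        X z ^ a z * (of_nat (a x) * (\<Prod>y\<in>S. X y ^ (a y - (if y = x then 1 else 0))) * V x)"
      using insert by (simp add: algebra_simps)
  qed simp
  then have D: "(\<Sum>x\<in>insert z S. of_nat (a x) * (\<Prod>y\<in>insert z S. X y ^ (a y - (if y = x then 1 else 0))) * V x)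
      = of_nat (a z) * X z ^ (a z - 1) * V z * (\<Prod>y\<in>S. X y ^ a y) + X z ^ a z * ?D"
    using insert S1 by (simp add: algebra_simps)
  let ?Q = "of_nat (a z) * X z ^ (a z - 1) * V z" and ?P = "\<Prod>y\<in>S. X y ^ a y"
  have "(\<Prod>y\<in>insert z S. (X y + c * V y) ^ a y) = (X z ^ a z + c * ?Q + c * c * q) * (?P + c * ?D + c * c * r)"
    using insert by (simp add: q r)
  also have "\<dots> = X z ^ a z * ?P + c * (?Q * ?P + X z ^ a z * ?D)
      + c * c * (X z ^ a z * r + ?Q * ?D + q * ?P + c * (?Q * r + q * ?D + c * q * r))"
    by (simp add: algebra_simps)
  finally show ?case unfolding D using insert by auto
qed (auto intro: exI[of _ 0])

lemma (in coeff_hom) eval_partial: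
  assumes S: "finite S" "\<And>m. m \<in> Poly_Mapping.keys f \<Longrightarrow> Poly_Mapping.keys m \<subseteq> S" "x \<in> S"
  shows "eval (partial x f) X = (\<Sum>m\<in>Poly_Mapping.keys f. h (Poly_Mapping.lookup f m) *
    (of_nat (Poly_Mapping.lookup m x) * (\<Prod>y\<in>S. X y ^ (Poly_Mapping.lookup m y - (if y = x then 1 else 0)))))"
  unfolding partial_def eval_sum
proof (rule sum.cong[OF refl])
  fix m assume m: "m \<in> Poly_Mapping.keys f"
  have lk: "Poly_Mapping.lookup (m - Poly_Mapping.single x 1) y = Poly_Mapping.lookup m y - (if y = x then 1 else 0)" for y
    by (simp add: lookup_minus lookup_single when_def)
  have "Poly_Mapping.keys (m - Poly_Mapping.single x 1) \<subseteq> S"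
  proof
    fix y assume "y \<in> Poly_Mapping.keys (m - Poly_Mapping.single x 1)"
    then have "Poly_Mapping.lookup m y - (if y = x then 1 else 0) \<noteq> 0" unfolding in_keys_iff lk .
    then have "Poly_Mapping.lookup m y \<noteq> 0" by auto
    then show "y \<in> S" using S(2)[OF m] by (auto simp: in_keys_iff)
  qed
  then show "eval (Poly_Mapping.single (m - Poly_Mapping.single x 1) (of_nat (Poly_Mapping.lookup m x) * Poly_Mapping.lookup f m)) X
    = h (Poly_Mapping.lookup f m) * (of_nat (Poly_Mapping.lookup m x) * (\<Prod>y\<in>S. X y ^ (Poly_Mapping.lookup m y - (if y = x then 1 else 0))))"
    by (simp add: eval_single monomial_value_superset[OF S(1)] lk h_mult h_of_nat algebra_simps del: One_nat_def)
qed

text \<open>Sum of the first order expansions of the monomials. For curves, \<open>c\<close> is a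
  power of the curve parameter.\<close>

lemma (in coeff_hom) taylor:
  assumes S: "finite S" "\<And>m. m \<in> Poly_Mapping.keys f \<Longrightarrow> Poly_Mapping.keys m \<subseteq> S"
  shows "\<exists>r. eval f (\<lambda>x. X x + c * V x) = eval f X + c * (\<Sum>x\<in>S. eval (partial x f) X * V x) + c * c * r"
proof -
  let ?D = "\<lambda>m. \<Sum>x\<in>S. of_nat (Poly_Mapping.lookup m x) *
      (\<Prod>y\<in>S. X y ^ (Poly_Mapping.lookup m y - (if y = x then 1 else 0))) * V x"
  have "\<forall>m\<in>Poly_Mapping.keys f. \<exists>r.
     monomial_value m (\<lambda>x. X x + c * V x) = monomial_value m X + c * ?D m + c * c * r"
    using prod_first_order[OF S(1), of X c V] by (simp add: monomial_value_superset[OF S])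
  then obtain r where r: "\<And>m. m \<in> Poly_Mapping.keys f \<Longrightarrow>
     monomial_value m (\<lambda>x. X x + c * V x) = monomial_value m X + c * ?D m + c * c * r m" by (auto dest!: bchoice)
  have "(\<Sum>x\<in>S. eval (partial x f) X * V x) = (\<Sum>x\<in>S. \<Sum>m\<in>Poly_Mapping.keys f. h (Poly_Mapping.lookup f m) *
    (of_nat (Poly_Mapping.lookup m x) * (\<Prod>y\<in>S. X y ^ (Poly_Mapping.lookup m y - (if y = x then 1 else 0))) * V x))"
    by (intro sum.cong refl) (simp add: eval_partial[OF S] sum_distrib_right mult.assoc)
  also have "\<dots> = (\<Sum>m\<in>Poly_Mapping.keys f. h (Poly_Mapping.lookup f m) * ?D m)"
    by (subst sum.swap) (simp add: sum_distrib_left)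
  finally have D: "(\<Sum>x\<in>S. eval (partial x f) X * V x) = (\<Sum>m\<in>Poly_Mapping.keys f. h (Poly_Mapping.lookup f m) * ?D m)" .
  have "eval f (\<lambda>x. X x + c * V x) = (\<Sum>m\<in>Poly_Mapping.keys f. h (Poly_Mapping.lookup f m) * monomial_value m X
      + c * (h (Poly_Mapping.lookup f m) * ?D m) + c * c * (h (Poly_Mapping.lookup f m) * r m))"
    unfolding eval_def by (intro sum.cong refl) (simp add: r algebra_simps)
  also have "\<dots> = eval f X + c * (\<Sum>x\<in>S. eval (partial x f) X * V x)
      + c * c * (\<Sum>m\<in>Poly_Mapping.keys f. h (Poly_Mapping.lookup f m) * r m)"
    unfolding D eval_def[of f X] by (simp add: sum.distrib sum_distrib_left)
  finally show ?thesis by blast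
qed

text \<open>Closure properties are stated for functions of a matrix, so that no representing
  polynomial has to be written down. The set \<open>M\<close> of admissible monomials is a
  parameter: it is used both for forms of a given degree and for polynomials with bounded
  exponents.\<close>

definition poly_fun :: "nat \<Rightarrow> (nat \<times> nat \<Rightarrow>\<^sub>0 nat) set \<Rightarrow> ('a::comm_ring_1 mat \<Rightarrow> 'a) \<Rightarrow> bool" where
  "poly_fun n M G \<longleftrightarrow> (\<exists>f. Poly_Mapping.keys f \<subseteq> M \<and> (\<forall>A\<in>carrier_mat n n. peval f A = G A))"

lemma poly_fun_cong:
  assumes "poly_fun n M G" "\<And>A. A \<in> carrier_mat n n \<Longrightarrow> G A = H A"
  shows "poly_fun n M H"
  using assms unfolding poly_fun_def by auto

lemma poly_fun_0: "poly_fun n M (\<lambda>_. 0)"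
  unfolding poly_fun_def by (intro exI[of _ 0]) (auto simp: peval_eval)

lemma poly_fun_add:
  assumes "poly_fun n M G" "poly_fun n M H"
  shows "poly_fun n M (\<lambda>A. G A + H A)"
proof -
  obtain f g where "Poly_Mapping.keys f \<subseteq> M" "\<forall>A\<in>carrier_mat n n. peval f A = G A"
     "Poly_Mapping.keys g \<subseteq> M" "\<forall>A\<in>carrier_mat n n. peval g A = H A"
    using assms unfolding poly_fun_def by blast
  then show ?thesis
    unfolding poly_fun_def using keys_add[of f g]
    by (intro exI[of _ "f + g"]) (auto simp: peval_eval scalar.eval_add)
qed

lemma poly_fun_sum:
  assumes "\<And>i. i \<in> S \<Longrightarrow> poly_fun n M (G i)"
  shows "poly_fun n M (\<lambda>A. \<Sum>i\<in>S. G i A)"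
  using assms by (induction S rule: infinite_finite_induct) (auto simp: poly_fun_0 intro: poly_fun_add)

lemma poly_fun_monomial:
  assumes "m \<in> M"
  shows "poly_fun n M (\<lambda>A. c * monomial_value m (\<lambda>x. A $$ x))"
  unfolding poly_fun_def using assms
  by (intro exI[of _ "Poly_Mapping.single m c"]) (auto simp: peval_eval scalar.eval_single)

lemma poly_fun_const:
  assumes "0 \<in> M"
  shows "poly_fun n M (\<lambda>_. c)"
  using poly_fun_monomial[OF assms, of n c] by simp

lemma poly_fun_var:
  assumes "Poly_Mapping.single x 1 \<in> M"
  shows "poly_fun n M (\<lambda>A. A $$ x)"
  using poly_fun_monomial[OF assms, of n 1] by (simp add: monomial_value_single)

lemma poly_fun_mult:
  assumes "poly_fun n M G" "poly_fun n M' H" and M: "\<And>m m'. m \<in> M \<Longrightarrow> m' \<in> M' \<Longrightarrow> m + m' \<in> M''"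
  shows "poly_fun n M'' (\<lambda>A. G A * H A)"
proof -
  obtain f g where f: "Poly_Mapping.keys f \<subseteq> M" "\<forall>A\<in>carrier_mat n n. peval f A = G A"
    and g: "Poly_Mapping.keys g \<subseteq> M'" "\<forall>A\<in>carrier_mat n n. peval g A = H A"
    using assms unfolding poly_fun_def by blast
  have "poly_fun n M'' (\<lambda>A. \<Sum>m\<in>Poly_Mapping.keys f. \<Sum>m'\<in>Poly_Mapping.keys g.
      (Poly_Mapping.lookup f m * Poly_Mapping.lookup g m') * monomial_value (m + m') (\<lambda>x. A $$ x))"
    using f(1) g(1) M by (intro poly_fun_sum poly_fun_monomial) blast
  moreover have "(\<Sum>m\<in>Poly_Mapping.keys f. \<Sum>m'\<in>Poly_Mapping.keys g.
      (Poly_Mapping.lookup f m * Poly_Mapping.lookup g m') * monomial_value (m + m') (\<lambda>x. A $$ x)) = peval f A * peval g A" for A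
    unfolding peval_eval scalar.eval_def sum_product
    by (intro sum.cong refl) (simp add: monomial_value_add algebra_simps)
  ultimately show ?thesis using f(2) g(2) by (auto elim!: poly_fun_cong)
qed

definition hom_monomials :: "nat \<Rightarrow> nat \<Rightarrow> (nat \<times> nat \<Rightarrow>\<^sub>0 nat) set" where
  "hom_monomials n e = {m. Poly_Mapping.keys m \<subseteq> {..<n} \<times> {..<n} \<and>
     (\<Sum>x\<in>Poly_Mapping.keys m. Poly_Mapping.lookup m x) = e}"

lemma homogeneous_polys_iff: "f \<in> homogeneous_polys n \<longleftrightarrow> (\<exists>e. Poly_Mapping.keys f \<subseteq> hom_monomials n e)"
  unfolding homogeneous_polys_def hom_monomials_def by blast

lemma degree_superset:
  assumes "finite S" "Poly_Mapping.keys m \<subseteq> S"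
  shows "(\<Sum>x\<in>Poly_Mapping.keys m. Poly_Mapping.lookup m x) = (\<Sum>x\<in>S. Poly_Mapping.lookup m x)"
  using assms by (intro sum.mono_neutral_left) (auto simp: in_keys_iff)

lemma hom_monomials_add:
  assumes "m \<in> hom_monomials n e" "m' \<in> hom_monomials n e'"
  shows "m + m' \<in> hom_monomials n (e + e')"
proof -
  let ?S = "{..<n} \<times> {..<n}"
  have k: "Poly_Mapping.keys m \<subseteq> ?S" "Poly_Mapping.keys m' \<subseteq> ?S" "Poly_Mapping.keys (m + m') \<subseteq> ?S"
    using assms keys_add[of m m'] by (auto simp: hom_monomials_def)
  have "(\<Sum>x\<in>Poly_Mapping.keys (m + m'). Poly_Mapping.lookup (m + m') x) = (\<Sum>x\<in>?S. Poly_Mapping.lookup (m + m') x)"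
    by (rule degree_superset[OF _ k(3)]) simp
  also have "\<dots> = (\<Sum>x\<in>?S. Poly_Mapping.lookup m x) + (\<Sum>x\<in>?S. Poly_Mapping.lookup m' x)"
    by (simp add: lookup_add sum.distrib)
  also have "\<dots> = e + e'"
    using assms degree_superset[OF _ k(1)] degree_superset[OF _ k(2)] by (simp add: hom_monomials_def)
  finally show ?thesis using k by (simp add: hom_monomials_def)
qed

lemma hom_poly_fun_mult:
  assumes "poly_fun n (hom_monomials n e) G" "poly_fun n (hom_monomials n e') H"
  shows "poly_fun n (hom_monomials n (e + e')) (\<lambda>A. G A * H A)"
  using assms by (rule poly_fun_mult) (rule hom_monomials_add)

lemma hom_poly_fun_const: "poly_fun n (hom_monomials n 0) (\<lambda>_. c)"
  by (rule poly_fun_const) (simp add: hom_monomials_def)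

lemma hom_poly_fun_cmult:
  assumes "poly_fun n (hom_monomials n e) G"
  shows "poly_fun n (hom_monomials n e) (\<lambda>A. c * G A)"
  using hom_poly_fun_mult[OF hom_poly_fun_const assms, of c] by simp

lemma hom_poly_fun_entry:
  assumes "i < n" "j < n"
  shows "poly_fun n (hom_monomials n 1) (\<lambda>A. A $$ (i,j))"
  by (rule poly_fun_var) (use assms in \<open>simp add: hom_monomials_def\<close>)

lemma hom_poly_fun_power:
  assumes "poly_fun n (hom_monomials n e) G"
  shows "poly_fun n (hom_monomials n (e * k)) (\<lambda>A. G A ^ k)"
proof (induction k)
  case (Suc k)
  then show ?case using hom_poly_fun_mult[OF assms Suc] by simp
qed (simp add: hom_poly_fun_const)

lemma hom_poly_fun_prod:
  assumes "finite S" "\<And>i. i \<in> S \<Longrightarrow> poly_fun n (hom_monomials n (e i)) (G i)"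
  shows "poly_fun n (hom_monomials n (sum e S)) (\<lambda>A. \<Prod>i\<in>S. G i A)"
  using assms by (induction S) (auto simp: hom_poly_fun_const intro: hom_poly_fun_mult)

text \<open>Each term of the Leibniz formula takes one entry from every row; hence degrees that
  depend on the row only give a homogeneous determinant.\<close>

lemma hom_poly_fun_det:
  assumes F: "\<And>A. A \<in> carrier_mat n n \<Longrightarrow> F A \<in> carrier_mat k k"
    and e: "\<And>i j. i < k \<Longrightarrow> j < k \<Longrightarrow> poly_fun n (hom_monomials n (e i)) (\<lambda>A. F A $$ (i,j))"
  shows "poly_fun n (hom_monomials n (\<Sum>i<k. e i)) (\<lambda>A. det (F A))"
proof (rule poly_fun_cong)
  show "poly_fun n (hom_monomials n (\<Sum>i<k. e i))
    (\<lambda>A. \<Sum>p\<in>{p. p permutes {0..<k}}. signof p * (\<Prod>i<k. F A $$ (i, p i)))"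
    using e by (intro poly_fun_sum hom_poly_fun_cmult hom_poly_fun_prod) (auto simp: permutes_in_image)
  show "A \<in> carrier_mat n n \<Longrightarrow> (\<Sum>p\<in>{p. p permutes {0..<k}}. signof p * (\<Prod>i<k. F A $$ (i, p i))) = det (F A)" for A
    using F[of A] by (simp add: det_def' lessThan_atLeast0)
qed

lemma homogeneous_poly_fun:
  assumes "f \<in> homogeneous_polys n"
  obtains e where "poly_fun n (hom_monomials n e) (peval f)"
  using assms that unfolding poly_fun_def homogeneous_polys_iff by blast

lemma poly_fun_smult:
  assumes "poly_fun n (hom_monomials n e) G" and A: "A \<in> carrier_mat n n"
  shows "G (c \<cdot>\<^sub>m A) = c ^ e * G A"
proof -
  obtain f where f: "Poly_Mapping.keys f \<subseteq> hom_monomials n e" "\<forall>A\<in>carrier_mat n n. peval f A = G A"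
    using assms unfolding poly_fun_def by blast
  have "monomial_value m (\<lambda>x. (c \<cdot>\<^sub>m A) $$ x) = c ^ e * monomial_value m (\<lambda>x. A $$ x)"
    if "m \<in> hom_monomials n e" for m
  proof -
    have "monomial_value m (\<lambda>x. (c \<cdot>\<^sub>m A) $$ x) = (\<Prod>x\<in>Poly_Mapping.keys m. c ^ Poly_Mapping.lookup m x * A $$ x ^ Poly_Mapping.lookup m x)"
      unfolding monomial_value_def
      using that A by (intro prod.cong refl) (auto simp: hom_monomials_def power_mult_distrib subset_iff)
    then show ?thesis using that by (simp add: prod.distrib monomial_value_def hom_monomials_def flip: power_sum)
  qed
  then have "peval f (c \<cdot>\<^sub>m A) = c ^ e * peval f A"
    unfolding peval_eval scalar.eval_def sum_distrib_left using f(1)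
    by (intro sum.cong refl) (auto simp: subset_iff algebra_simps)
  then show ?thesis using f(2) A by simp
qed

lemma monomial_value_cong:
  assumes "m \<in> hom_monomials n e" "\<And>i j. i < n \<Longrightarrow> j < n \<Longrightarrow> X (i,j) = Y (i,j)"
  shows "monomial_value m X = monomial_value m Y"
  unfolding monomial_value_def using assms
  by (intro prod.cong refl) (auto simp: hom_monomials_def subset_iff)

lemma (in coeff_hom) eval_hom_cong:
  assumes "f \<in> homogeneous_polys n" "\<And>i j. i < n \<Longrightarrow> j < n \<Longrightarrow> X (i,j) = Y (i,j)"
  shows "eval f X = eval f Y"
proof -
  obtain e where "Poly_Mapping.keys f \<subseteq> hom_monomials n e" using assms(1) homogeneous_polys_iff by blast
  then have "monomial_value m X = monomial_value m Y" if "m \<in> Poly_Mapping.keys f" for m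
    using that assms(2) by (intro monomial_value_cong[of m n e]) auto
  then show ?thesis unfolding eval_def by (intro sum.cong refl) simp
qed

text \<open>As in Euclid's argument: if the field were finite, the product of all
  \<open>t - a\<close>, plus 1, would take the value 1 everywhere and have no root.\<close>

lemma infinite_alg_closed: "infinite (UNIV :: 'a::alg_closed_field set)"
proof
  assume fin: "finite (UNIV :: 'a set)"
  define p where "p = (\<Prod>a\<in>(UNIV :: 'a set). [:- a, 1:]) + 1"
  have "degree (\<Prod>a\<in>(UNIV :: 'a set). [:- a, 1:]) = card (UNIV :: 'a set)"
    by (subst degree_prod_eq_sum_degree) (use fin in auto)
  moreover have "card (UNIV :: 'a set) > 0" using fin by (simp add: card_gt_0_iff)
  ultimately have "degree p > 0" unfolding p_def by (subst degree_add_eq_left) auto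
  then obtain x where "poly p x = 0" using alg_closed_imp_poly_has_root by blast
  moreover have "poly p x = 1" unfolding p_def poly_add poly_prod using fin by (simp add: prod_zero_iff)
  ultimately show False by simp
qed

lemma poly_eq_0_if_cofinite:
  fixes p :: "'a::alg_closed_field poly"
  assumes "finite F" "\<And>t. t \<notin> F \<Longrightarrow> poly p t = 0"
  shows "p = 0"
proof (rule ccontr)
  assume "p \<noteq> 0"
  then have "finite {t. poly p t = 0}" by (rule poly_roots_finite)
  then have "finite (F \<union> {t. poly p t = 0})" using assms(1) by blast
  moreover have "UNIV = F \<union> {t. poly p t = 0}" using assms(2) by auto
  ultimately show False using infinite_alg_closed[where 'a='a] by simp
qed

section \<open>Cones over projective sets\<close>

text \<open>The affine cone without its origin. Curves may pass through the origin, which explains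
  the recurring \<open>insert (0\<^sub>m n n)\<close>.\<close>

definition cone :: "nat \<Rightarrow> 'a::field mat set set \<Rightarrow> 'a mat set" where
  "cone n Z = {A \<in> nonzero_mats n. proj_point A \<in> Z}"

lemma smult_smult_mat: "a \<cdot>\<^sub>m (b \<cdot>\<^sub>m A) = (a * b :: 'a::semigroup_mult) \<cdot>\<^sub>m A"
  by (intro eq_matI) (auto simp: mult.assoc)

lemma one_smult_mat [simp]: "(1::'a::monoid_mult) \<cdot>\<^sub>m A = A"
  by (intro eq_matI) auto

lemma proj_point_eqD:
  assumes "proj_point A = proj_point B"
  shows "\<exists>c. c \<noteq> 0 \<and> B = c \<cdot>\<^sub>m A"
proof -
  have "B = 1 \<cdot>\<^sub>m B" by simp
  then have "B \<in> proj_point B" unfolding proj_point_def using zero_neq_one by fastforce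
  then show ?thesis using assms unfolding proj_point_def by auto
qed

lemma cone_Collect:
  assumes "\<And>A c. A \<in> nonzero_mats n \<Longrightarrow> c \<noteq> 0 \<Longrightarrow> R A \<Longrightarrow> R (c \<cdot>\<^sub>m A)"
  shows "cone n {proj_point A | A. A \<in> nonzero_mats n \<and> R A} = {A \<in> nonzero_mats n. R A}"
  unfolding cone_def using assms proj_point_eqD by blast

lemma peval_smult_zero:
  assumes "f \<in> homogeneous_polys n" "A \<in> carrier_mat n n" "peval f A = 0"
  shows "peval f (c \<cdot>\<^sub>m A) = 0"
  using homogeneous_poly_fun[OF assms(1)] poly_fun_smult[OF _ assms(2)] assms(3) by (metis mult_zero_right)

lemma cone_proj_zeros:
  assumes "F \<subseteq> homogeneous_polys n"
  shows "cone n (proj_zeros n F) = {A \<in> nonzero_mats n. \<forall>f\<in>F. peval f A = 0}"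
  unfolding proj_zeros_def
proof (rule cone_Collect)
  fix A and c :: 'a assume "A \<in> nonzero_mats n" "\<forall>f\<in>F. peval f A = 0"
  then show "\<forall>f\<in>F. peval f (c \<cdot>\<^sub>m A) = 0"
    using assms peval_smult_zero unfolding nonzero_mats_def by blast
qed

lemma proj_closed_image_cone:
  assumes "proj_closed n Z"
  shows "Z = proj_point ` cone n Z"
  using assms unfolding proj_closed_def proj_zeros_def cone_def by auto

lemma subset_if_cone_subset:
  assumes "proj_closed n Z" "cone n Z \<subseteq> cone n Z'"
  shows "Z \<subseteq> Z'"
proof
  fix x assume "x \<in> Z"
  then obtain A where "A \<in> cone n Z" "x = proj_point A" using proj_closed_image_cone[OF assms(1)] by blast
  then show "x \<in> Z'" using assms(2) by (auto simp: cone_def)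
qed

lemma cone_mono: "Z \<subseteq> Z' \<Longrightarrow> cone n Z \<subseteq> cone n Z'"
  by (auto simp: cone_def)

lemma cone_carrier: "A \<in> cone n Z \<Longrightarrow> A \<in> carrier_mat n n"
  by (auto simp: cone_def nonzero_mats_def)

definition curve_mat :: "nat \<Rightarrow> (nat \<times> nat \<Rightarrow> 'a::comm_ring_1 poly) \<Rightarrow> 'a \<Rightarrow> 'a mat" where
  "curve_mat n X t = mat n n (\<lambda>x. poly (X x) t)"

lemma curve_mat_carrier [simp]: "curve_mat n X t \<in> carrier_mat n n"
  by (simp add: curve_mat_def)

lemma peval_curve_mat:
  assumes "f \<in> homogeneous_polys n"
  shows "peval f (curve_mat n X t) = poly (curve.eval f X) t"
  unfolding peval_eval poly_curve_eval
  by (rule scalar.eval_hom_cong[OF assms]) (simp add: curve_mat_def)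

text \<open>Any two points of the cone are joined by a polynomial curve, along which the product of two
  homogeneous polynomials cannot vanish identically unless one of the factors does.\<close>

lemma proj_irreducibleI:
  fixes Z :: "'a::alg_closed_field mat set set"
  assumes closed: "proj_closed n Z" and ne: "cone n Z \<noteq> {}"
    and path: "\<And>A B. A \<in> cone n Z \<Longrightarrow> B \<in> cone n Z \<Longrightarrow>
      \<exists>X. curve_mat n X 0 = A \<and> curve_mat n X 1 = B \<and> (\<forall>t. curve_mat n X t \<in> insert (0\<^sub>m n n) (cone n Z))"
  shows "proj_irreducible n Z"
  unfolding proj_irreducible_def
proof (intro conjI allI impI)
  show "Z \<noteq> {}" using ne by (auto simp: cone_def)
  fix Z1 Z2 :: "'a mat set set"
  assume Z: "proj_closed n Z1" "proj_closed n Z2" "Z \<subseteq> Z1 \<union> Z2"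
  obtain F1 F2 where F: "F1 \<subseteq> homogeneous_polys n" "Z1 = proj_zeros n F1" "F2 \<subseteq> homogeneous_polys n" "Z2 = proj_zeros n F2"
    using Z unfolding proj_closed_def by blast
  show "Z \<subseteq> Z1 \<or> Z \<subseteq> Z2"
  proof (rule ccontr)
    assume "\<not> ?thesis"
    then have "\<not> cone n Z \<subseteq> cone n Z1" "\<not> cone n Z \<subseteq> cone n Z2"
      using subset_if_cone_subset[OF closed] by blast+
    then obtain A f B g where A: "A \<in> cone n Z" "f \<in> F1" "peval f A \<noteq> 0" and B: "B \<in> cone n Z" "g \<in> F2" "peval g B \<noteq> 0"
      unfolding F(2,4) cone_proj_zeros[OF F(1)] cone_proj_zeros[OF F(3)] by (auto simp: cone_def)
    have fg: "f \<in> homogeneous_polys n" "g \<in> homogeneous_polys n" using A B F by auto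
    obtain X where X: "curve_mat n X 0 = A" "curve_mat n X 1 = B" "\<And>t. curve_mat n X t \<in> insert (0\<^sub>m n n) (cone n Z)"
      using path[OF A(1) B(1)] by blast
    have pf: "curve.eval f X \<noteq> 0" using A X(1) peval_curve_mat[OF fg(1), of X 0] by auto
    have pg: "curve.eval g X \<noteq> 0" using B X(2) peval_curve_mat[OF fg(2), of X 1] by auto
    \<comment> \<open>The third factor covers the parameters at which the curve meets the origin. As
      the other two factors are nonzero polynomials, \<open>f\<close> must be constant along the
      curve; being nonzero at \<open>A\<close> it vanishes nowhere on it, so \<open>g\<close>
      vanishes at all nonzero points of the curve, in particular at \<open>B\<close>.\<close>
    have "poly (curve.eval f X * curve.eval g X * (curve.eval f X - [:peval f (0\<^sub>m n n):])) t = 0" for t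
    proof (cases "curve_mat n X t = 0\<^sub>m n n")
      case True
      then show ?thesis using peval_curve_mat[OF fg(1), of X t] by simp
    next
      case False
      then have "curve_mat n X t \<in> cone n Z" using X(3)[of t] by auto
      then have "curve_mat n X t \<in> cone n Z1 \<union> cone n Z2" using Z(3) by (auto simp: cone_def)
      then have "peval f (curve_mat n X t) = 0 \<or> peval g (curve_mat n X t) = 0"
        unfolding F(2,4) cone_proj_zeros[OF F(1)] cone_proj_zeros[OF F(3)] using A(2) B(2) by blast
      then show ?thesis using peval_curve_mat[OF fg(1), of X t] peval_curve_mat[OF fg(2), of X t] by auto
    qed
    then have "curve.eval f X * curve.eval g X * (curve.eval f X - [:peval f (0\<^sub>m n n):]) = 0"
      using poly_eq_0_if_cofinite[of "{}"] by blast
    then have "curve.eval f X = [:peval f (0\<^sub>m n n):]" using pf pg by simp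
    then have const: "peval f (curve_mat n X t) = peval f (0\<^sub>m n n)" for t
      using peval_curve_mat[OF fg(1), of X t] by simp
    have nz: "peval f (0\<^sub>m n n) \<noteq> 0" using const[of 0] X(1) A(3) by simp
    then have "peval g (curve_mat n X t) = 0" if "curve_mat n X t \<noteq> 0\<^sub>m n n" for t
    proof -
      have "curve_mat n X t \<in> cone n Z" using X(3)[of t] that by auto
      then have "curve_mat n X t \<in> cone n Z1 \<union> cone n Z2" using Z(3) by (auto simp: cone_def)
      then show ?thesis
        unfolding F(2,4) cone_proj_zeros[OF F(1)] cone_proj_zeros[OF F(3)] using A(2) B(2) const[of t] nz by auto
    qed
    moreover have "curve_mat n X 1 \<noteq> 0\<^sub>m n n" using B(1) X(2) by (auto simp: cone_def nonzero_mats_def)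
    ultimately show False using B X(2) by auto
  qed
qed (rule closed)

text \<open>Primality of the homogeneous vanishing ideal: otherwise the zero sets of
  \<open>f\<close> and \<open>g\<close> would cover \<open>Z\<close>, and one of them would contain
  it.\<close>

lemma proj_irreducible_mult:
  assumes irr: "proj_irreducible n Z" and f: "f \<in> homogeneous_polys n" "g \<in> homogeneous_polys n"
    and A: "A \<in> cone n Z" "peval f A \<noteq> 0" and B: "B \<in> cone n Z" "peval g B \<noteq> 0"
  shows "\<exists>X\<in>cone n Z. peval f X \<noteq> 0 \<and> peval g X \<noteq> 0"
proof (rule ccontr)
  assume neg: "\<not> ?thesis"
  let ?Z1 = "proj_zeros n {f}" and ?Z2 = "proj_zeros n {g}"
  have cl: "proj_closed n ?Z1" "proj_closed n ?Z2" "proj_closed n Z"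
    using f irr unfolding proj_closed_def proj_irreducible_def by auto
  have c: "cone n ?Z1 = {A \<in> nonzero_mats n. peval f A = 0}" "cone n ?Z2 = {A \<in> nonzero_mats n. peval g A = 0}"
    using cone_proj_zeros[of "{f}"] cone_proj_zeros[of "{g}"] f by auto
  have "cone n Z \<subseteq> cone n ?Z1 \<union> cone n ?Z2" unfolding c using neg by (auto simp: cone_def)
  then have "cone n Z \<subseteq> cone n (?Z1 \<union> ?Z2)" by (auto simp: cone_def)
  then have "Z \<subseteq> ?Z1 \<union> ?Z2" by (rule subset_if_cone_subset[OF cl(3)])
  then have "Z \<subseteq> ?Z1 \<or> Z \<subseteq> ?Z2" using irr cl unfolding proj_irreducible_def by blast
  then have "cone n Z \<subseteq> cone n ?Z1 \<or> cone n Z \<subseteq> cone n ?Z2" using cone_mono by blast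
  then show False unfolding c using A B by auto
qed

lemma vanishing_polys_iff:
  "f \<in> vanishing_polys n Z \<longleftrightarrow> f \<in> homogeneous_polys n \<and> (\<forall>A\<in>cone n Z. peval f A = 0)"
  by (auto simp: vanishing_polys_def cone_def)

text \<open>The origin is reached by scaling a point of the cone by 0; for forms of degree 0 it
  matters that the cone has a point.\<close>

lemma vanishing_polys_zero:
  assumes "f \<in> vanishing_polys n Z" "A \<in> insert (0\<^sub>m n n) (cone n Z)" "cone n Z \<noteq> {}"
  shows "peval f A = 0"
proof (cases "A = 0\<^sub>m n n")
  case True
  obtain B where B: "B \<in> cone n Z" using assms(3) by blast
  have "peval f (0 \<cdot>\<^sub>m B) = 0"
    using assms(1) B cone_carrier[OF B] by (intro peval_smult_zero) (auto simp: vanishing_polys_iff)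
  moreover have "0 \<cdot>\<^sub>m B = 0\<^sub>m n n" using cone_carrier[OF B] by (intro eq_matI) auto
  ultimately show ?thesis using True by simp
qed (use assms in \<open>auto simp: vanishing_polys_iff\<close>)

lemma vanishing_polys_curve:
  fixes Z :: "'a::alg_closed_field mat set set"
  assumes "f \<in> vanishing_polys n Z" "cone n Z \<noteq> {}" "\<And>t. curve_mat n X t \<in> insert (0\<^sub>m n n) (cone n Z)"
  shows "curve.eval f X = 0"
proof (rule poly_eq_0_if_cofinite[of "{}"])
  fix t
  have "peval f (curve_mat n X t) = 0" using vanishing_polys_zero assms by blast
  then show "poly (curve.eval f X) t = 0"
    using assms(1) peval_curve_mat[of f n X t] by (simp add: vanishing_polys_iff)
qed simp

text \<open>A vanishing form is identically zero along both curves, and by Taylor's formula the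
  difference is \<open>\<tau>\<^sup>k (df(V) + \<tau>\<^sup>k r)\<close>. Cancel
  \<open>\<tau>\<^sup>k\<close> and put \<open>\<tau> = 0\<close>. Comparing two curves, instead of
  taking the velocity of one, allows \<open>k > 1\<close>: the base curve may already leave
  \<open>A\<close> at lower order.\<close>

lemma tangent_vector_of_curves:
  fixes Z :: "'a::alg_closed_field mat set set"
  assumes ne: "cone n Z \<noteq> {}" and k: "k \<ge> 1"
    and X: "\<And>t. curve_mat n X t \<in> insert (0\<^sub>m n n) (cone n Z)"
    and XV: "\<And>t. curve_mat n (\<lambda>x. X x + monom 1 k * V x) t \<in> insert (0\<^sub>m n n) (cone n Z)"
    and A: "curve_mat n X 0 = A" and W: "curve_mat n V 0 = W"
  shows "W \<in> cone_tangent_space n Z A"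
  unfolding cone_tangent_space_def
proof (intro CollectI conjI ballI)
  show "W \<in> carrier_mat n n" using W curve_mat_carrier by metis
  fix f assume f: "f \<in> vanishing_polys n Z"
  then have fh: "f \<in> homogeneous_polys n" by (simp add: vanishing_polys_iff)
  let ?S = "{..<n} \<times> {..<n}"
  have keys: "\<And>m. m \<in> Poly_Mapping.keys f \<Longrightarrow> Poly_Mapping.keys m \<subseteq> ?S"
    using fh by (auto simp: homogeneous_polys_def)
  obtain r where r: "curve.eval f (\<lambda>x. X x + monom 1 k * V x) = curve.eval f X
      + monom 1 k * (\<Sum>x\<in>?S. curve.eval (partial x f) X * V x) + monom 1 k * monom 1 k * r"
    using curve.taylor[of ?S f X "monom 1 k" V] keys by auto
  have "monom 1 k * ((\<Sum>x\<in>?S. curve.eval (partial x f) X * V x) + monom 1 k * r) = 0"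
    using r vanishing_polys_curve[OF f ne X] vanishing_polys_curve[OF f ne XV] by (simp add: algebra_simps)
  then have "(\<Sum>x\<in>?S. curve.eval (partial x f) X * V x) + monom 1 k * r = 0"
    by (simp add: monom_eq_0_iff)
  then have "poly ((\<Sum>x\<in>?S. curve.eval (partial x f) X * V x) + monom 1 k * r) 0 = 0" by simp
  then have "(\<Sum>x\<in>?S. poly (curve.eval (partial x f) X) 0 * poly (V x) 0) = 0"
    using k by (simp add: poly_sum poly_monom power_0_left)
  moreover have "poly (curve.eval (partial x f) X) 0 = peval (partial x f) A" if "x \<in> ?S" for x
  proof -
    have fin: "finite ?S" by simp
    have "scalar.eval (partial x f) (\<lambda>y. poly (X y) 0) = scalar.eval (partial x f) (\<lambda>y. A $$ y)"
      unfolding scalar.eval_partial[of ?S f x "\<lambda>y. poly (X y) 0", OF fin keys that, simplified]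
        scalar.eval_partial[of ?S f x "\<lambda>y. A $$ y", OF fin keys that, simplified]
      by (intro sum.cong refl arg_cong2[of _ _ _ _ "(*)"] prod.cong) (auto simp: A[symmetric] curve_mat_def)
    then show ?thesis by (simp add: poly_curve_eval peval_eval)
  qed
  moreover have "poly (V x) 0 = W $$ x" if "x \<in> ?S" for x
    using that W by (auto simp: curve_mat_def)
  ultimately show "(\<Sum>x\<in>?S. peval (partial x f) A * W $$ x) = 0" by simp
qed

text \<open>Turns the tangency condition into the linear coefficient of a univariate polynomial,
  which depends only on the values of \<open>f\<close> on the line \<open>A + t V\<close>.\<close>

lemma coeff_1_line:
  assumes f: "f \<in> homogeneous_polys n"
  shows "coeff (curve.eval f (\<lambda>x. [:A $$ x, V $$ x:])) 1 = (\<Sum>x\<in>{..<n} \<times> {..<n}. peval (partial x f) A * V $$ x)"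
proof -
  let ?S = "{..<n} \<times> {..<n}" and ?X = "\<lambda>x. [:A $$ x:]"
  have keys: "\<And>m. m \<in> Poly_Mapping.keys f \<Longrightarrow> Poly_Mapping.keys m \<subseteq> ?S"
    using f by (auto simp: homogeneous_polys_def)
  obtain r where r: "curve.eval f (\<lambda>x. ?X x + [:0, 1:] * [:V $$ x:]) = curve.eval f ?X
      + [:0, 1:] * (\<Sum>x\<in>?S. curve.eval (partial x f) ?X * [:V $$ x:]) + [:0, 1:] * [:0, 1:] * r"
    using curve.taylor[of ?S f ?X "[:0, 1:]" "\<lambda>x. [:V $$ x:]"] keys by auto
  have c: "curve.eval g ?X = [:peval g A:]" for g :: "'a entry_poly"
  proof -
    have "monomial_value m ?X = [:monomial_value m (\<lambda>x. A $$ x):]" for m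
      by (simp add: monomial_value_def poly_const_pow prod_to_poly)
    then show ?thesis
      by (simp add: curve.eval_def peval_eval scalar.eval_def sum_to_poly mult.commute)
  qed
  have "(\<Sum>x\<in>?S. curve.eval (partial x f) ?X * [:V $$ x:]) = [:\<Sum>x\<in>?S. peval (partial x f) A * V $$ x:]"
    by (simp add: c sum_to_poly mult.commute)
  then have "curve.eval f (\<lambda>x. [:A $$ x, V $$ x:]) =
     [:peval f A:] + [:0, 1:] * [:\<Sum>x\<in>?S. peval (partial x f) A * V $$ x:] + [:0, 1:] * [:0, 1:] * r"
    using r unfolding c by simp
  then show ?thesis by (simp add: coeff_pCons)
qed

section \<open>Equations and irreducibility of Kalman varieties\<close>

lemma poly_fun_homogeneous:
  assumes "poly_fun n (hom_monomials n e) G"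
  shows "\<exists>f\<in>homogeneous_polys n. \<forall>A\<in>carrier_mat n n. peval f A = G A"
  using assms unfolding poly_fun_def homogeneous_polys_iff Bex_def by blast

lemma mult_mat_entry:
  assumes "A \<in> carrier_mat m n" "B \<in> carrier_mat n k" "i < m" "j < k"
  shows "(A * B) $$ (i,j) = (\<Sum>l<n. A $$ (i,l) * B $$ (l,j))"
  using assms by (simp add: scalar_prod_def lessThan_atLeast0)

lemma mult_mat_vec_entry:
  assumes "A \<in> carrier_mat m n" "v \<in> carrier_vec n" "i < m"
  shows "(A *\<^sub>v v) $ i = (\<Sum>l<n. A $$ (i,l) * v $ l)"
  using assms by (simp add: scalar_prod_def lessThan_atLeast0)

lemma smult_mat_mult_vec:
  assumes "A \<in> carrier_mat n m" "v \<in> carrier_vec m"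
  shows "(c \<cdot>\<^sub>m A) *\<^sub>v v = c \<cdot>\<^sub>v (A *\<^sub>v (v :: 'a::comm_ring_1 vec))"
  using assms by (intro eq_vecI) (auto simp: scalar_prod_def sum_distrib_left mult.assoc)

lemma cone_kalman_variety:
  "cone n (kalman_variety s n L) = {A \<in> nonzero_mats n.
     \<exists>W. VectorSpace.subspace class_ring W (module_vec TYPE('a::field) n) \<and> W \<subseteq> L \<and>
          (\<forall>v\<in>W. A *\<^sub>v v \<in> W) \<and> s \<le> subspace_dim n W}"
  unfolding kalman_variety_def
proof (rule cone_Collect)
  fix A :: "'a mat" and c :: 'a
  assume A: "A \<in> nonzero_mats n" and "c \<noteq> 0" and "\<exists>W. VectorSpace.subspace class_ring W (module_vec TYPE('a) n) \<and> W \<subseteq> L \<and>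
          (\<forall>v\<in>W. A *\<^sub>v v \<in> W) \<and> s \<le> subspace_dim n W"
  then obtain W where W: "VectorSpace.subspace class_ring W (module_vec TYPE('a) n)" "W \<subseteq> L"
    "\<forall>v\<in>W. A *\<^sub>v v \<in> W" "s \<le> subspace_dim n W" by blast
  have "(c \<cdot>\<^sub>m A) *\<^sub>v v \<in> W" if "v \<in> W" for v
  proof -
    have "v \<in> carrier_vec n" using that W(1) by (auto simp: subspace_vec_iff)
    then have "(c \<cdot>\<^sub>m A) *\<^sub>v v = c \<cdot>\<^sub>v (A *\<^sub>v v)" using A by (intro smult_mat_mult_vec[of A n n]) (auto simp: nonzero_mats_def)
    then show ?thesis using W that by (auto simp: subspace_vec_iff)
  qed
  then show "\<exists>W. VectorSpace.subspace class_ring W (module_vec TYPE('a) n) \<and> W \<subseteq> L \<and>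
          (\<forall>v\<in>W. (c \<cdot>\<^sub>m A) *\<^sub>v v \<in> W) \<and> s \<le> subspace_dim n W" using W by blast
qed

lemma subspace_line:
  assumes "v \<in> carrier_vec n"
  shows "VectorSpace.subspace class_ring (range (\<lambda>c. c \<cdot>\<^sub>v v)) (module_vec TYPE('a::field) n)"
  unfolding subspace_vec_iff
proof (intro conjI ballI allI)
  show "range (\<lambda>c. c \<cdot>\<^sub>v v) \<subseteq> carrier_vec n" using assms by auto
  have "0\<^sub>v n = 0 \<cdot>\<^sub>v v" using assms by (intro eq_vecI) auto
  then show "0\<^sub>v n \<in> range (\<lambda>c. c \<cdot>\<^sub>v v)" by blast
  fix x assume "x \<in> range (\<lambda>c. c \<cdot>\<^sub>v v)"
  then obtain a where a: "x = a \<cdot>\<^sub>v v" by blast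
  show "c \<cdot>\<^sub>v x \<in> range (\<lambda>c. c \<cdot>\<^sub>v v)" for c unfolding a smult_smult_assoc by blast
  fix y assume "y \<in> range (\<lambda>c. c \<cdot>\<^sub>v v)"
  then obtain b where b: "y = b \<cdot>\<^sub>v v" by blast
  show "x + y \<in> range (\<lambda>c. c \<cdot>\<^sub>v v)" unfolding a b add_smult_distrib_vec[symmetric] by blast
qed

lemma subspace_zero: "VectorSpace.subspace class_ring {0\<^sub>v n} (module_vec TYPE('a::field) n)"
  by (auto simp: subspace_vec_iff)

lemma add_smult_eq_zero_iff:
  fixes u w :: "'a::ring_1 vec"
  assumes "u \<in> carrier_vec n" "w \<in> carrier_vec n"
  shows "u + (- c) \<cdot>\<^sub>v w = 0\<^sub>v n \<longleftrightarrow> u = c \<cdot>\<^sub>v w"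
proof
  assume eq: "u + (- c) \<cdot>\<^sub>v w = 0\<^sub>v n"
  show "u = c \<cdot>\<^sub>v w"
  proof (rule eq_vecI)
    fix i assume "i < dim_vec (c \<cdot>\<^sub>v w)"
    then have i: "i < n" using assms by simp
    have "(u + (- c) \<cdot>\<^sub>v w) $ i = 0" using eq i by simp
    then show "u $ i = (c \<cdot>\<^sub>v w) $ i" using i assms by simp
  qed (use assms in auto)
qed (use assms in \<open>auto intro!: eq_vecI\<close>)

lemma exists_eigenvector:
  fixes A :: "'a::alg_closed_field mat"
  assumes A: "A \<in> carrier_mat n n"
    and W: "VectorSpace.subspace class_ring W (module_vec TYPE('a) n)" "\<forall>v\<in>W. A *\<^sub>v v \<in> W"
    and dim: "1 \<le> subspace_dim n W"
  obtains v \<mu> where "v \<in> W" "v \<noteq> 0\<^sub>v n" "A *\<^sub>v v = \<mu> \<cdot>\<^sub>v v"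
proof -
  have "W \<noteq> {0\<^sub>v n}" using dim by (auto simp: subspace_dim_zero)
  moreover have "0\<^sub>v n \<in> W" using W by (simp add: subspace_vec_iff)
  ultimately obtain u where u: "u \<in> W" "u \<notin> {0\<^sub>v n}" by auto
  obtain v \<mu> where v: "v \<in> W" "v \<notin> {0\<^sub>v n}" "A *\<^sub>v v + (- \<mu>) \<cdot>\<^sub>v v \<in> {0\<^sub>v n}"
    using exists_eigenvector_modulo[OF A W subspace_zero u] by blast
  have vc: "v \<in> carrier_vec n" using v W by (auto simp: subspace_vec_iff)
  then have "A *\<^sub>v v = \<mu> \<cdot>\<^sub>v v" using v(3) A add_smult_eq_zero_iff[of "A *\<^sub>v v" n v \<mu>] by simp
  then show ?thesis using that v by blast
qed

text \<open>An eigenvector spans an invariant line, and over an algebraically closed field every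
  nonzero invariant subspace contains an eigenvector.\<close>

lemma cone_kalman_variety_1:
  fixes L :: "'a::alg_closed_field vec set"
  assumes L: "VectorSpace.subspace class_ring L (module_vec TYPE('a) n)"
  shows "cone n (kalman_variety 1 n L) =
    {A \<in> nonzero_mats n. \<exists>v\<in>L. v \<noteq> 0\<^sub>v n \<and> (\<exists>\<mu>. A *\<^sub>v v = \<mu> \<cdot>\<^sub>v v)}"
proof (intro equalityI subsetI)
  fix A assume "A \<in> cone n (kalman_variety 1 n L)"
  then show "A \<in> {A \<in> nonzero_mats n. \<exists>v\<in>L. v \<noteq> 0\<^sub>v n \<and> (\<exists>\<mu>. A *\<^sub>v v = \<mu> \<cdot>\<^sub>v v)}"
    unfolding cone_kalman_variety using exists_eigenvector[of A n] by (auto simp: nonzero_mats_def) (metis subsetD)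
next
  fix A assume "A \<in> {A \<in> nonzero_mats n. \<exists>v\<in>L. v \<noteq> 0\<^sub>v n \<and> (\<exists>\<mu>. A *\<^sub>v v = \<mu> \<cdot>\<^sub>v v)}"
  then obtain v \<mu> where A: "A \<in> nonzero_mats n" and v: "v \<in> L" "v \<noteq> 0\<^sub>v n" "A *\<^sub>v v = \<mu> \<cdot>\<^sub>v v" by auto
  have Ac: "A \<in> carrier_mat n n" using A by (simp add: nonzero_mats_def)
  have vc: "v \<in> carrier_vec n" using v L by (auto simp: subspace_vec_iff)
  let ?W = "range (\<lambda>c. c \<cdot>\<^sub>v v)"
  have "?W \<subseteq> L" using v L by (auto simp: subspace_vec_iff)
  moreover have "A *\<^sub>v w \<in> ?W" if "w \<in> ?W" for w
    using that v vc mult_mat_vec[OF Ac vc] by (auto simp: smult_smult_assoc)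
  moreover have "v = 1 \<cdot>\<^sub>v v" using vc by simp
  then have "v \<in> ?W" by blast
  then have "1 \<le> subspace_dim n ?W" using subspace_dim_ge_1[OF subspace_line[OF vc] _ v(2)] by simp
  ultimately show "A \<in> cone n (kalman_variety 1 n L)"
    unfolding cone_kalman_variety using A subspace_line[OF vc] by blast
qed

lemma hom_poly_fun_kalman_entry:
  fixes C :: "'a::field mat"
  assumes C: "C \<in> carrier_mat m n" and ij: "i < m" "j < n"
  shows "poly_fun n (hom_monomials n k) (\<lambda>A. (C * A ^\<^sub>m k) $$ (i, j))"
  using ij
proof (induction k arbitrary: j)
  case 0
  have "poly_fun n (hom_monomials n 0) (\<lambda>A. C $$ (i, j))" by (rule hom_poly_fun_const)
  then show ?case using C by (auto elim!: poly_fun_cong)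
next
  case (Suc k)
  have "poly_fun n (hom_monomials n (k + 1)) (\<lambda>A. \<Sum>l<n. (C * A ^\<^sub>m k) $$ (i, l) * A $$ (l, j))"
    using Suc by (intro poly_fun_sum hom_poly_fun_mult hom_poly_fun_entry) auto
  moreover have "(\<Sum>l<n. (C * A ^\<^sub>m k) $$ (i, l) * A $$ (l, j)) = (C * A ^\<^sub>m Suc k) $$ (i, j)"
    if A: "A \<in> carrier_mat n n" for A
  proof -
    have "C * A ^\<^sub>m Suc k = C * A ^\<^sub>m k * A"
      using C A pow_carrier_mat[OF A] by (simp add: assoc_mult_mat[OF C pow_carrier_mat[OF A] A])
    moreover have "C * A ^\<^sub>m k \<in> carrier_mat m n" using C A by auto
    ultimately show ?thesis using mult_mat_entry[of "C * A ^\<^sub>m k" m n A n i j] A Suc.prems ij by (simp only:)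
  qed
  ultimately show ?case by (auto elim!: poly_fun_cong)
qed

lemma kalman_variety_minors:
  fixes C :: "'a::field mat"
  assumes C: "C \<in> carrier_mat m n" and dim: "subspace_dim n (mat_kernel C) \<le> d" and s: "s \<le> n"
  shows "kalman_variety s n (mat_kernel C) = {proj_point A | A. A \<in> nonzero_mats n \<and>
         (\<forall>\<mu>\<in>minors (n - s + 1) (kalman_matrix d C A). \<mu> = 0)}"
  unfolding kalman_variety_eq[OF C dim]
  by (intro Collect_cong iff_exI conj_cong refl) (use kalman_minors_iff[OF C _ s] in \<open>auto simp: nonzero_mats_def\<close>)

text \<open>The blocks \<open>C A\<^sup>k\<close> have different degrees, but the degree is constant
  along each row, so every minor is still a form.\<close>

lemma proj_closed_kalman_variety:
  fixes C :: "'a::field mat"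
  assumes C: "C \<in> carrier_mat m n" and dim: "subspace_dim n (mat_kernel C) \<le> d" and s: "s \<le> n"
  shows "proj_closed n (kalman_variety s n (mat_kernel C))"
proof -
  define r where "r = n - s + 1"
  define \<I> where "\<I> = {(I,J). I \<subseteq> {..<(d + 1) * m} \<and> J \<subseteq> {..<n} \<and> card I = r \<and> card J = r}"
  define F where "F = {f \<in> homogeneous_polys n. \<exists>(I,J)\<in>\<I>. \<forall>A\<in>carrier_mat n n.
    peval f A = det (submatrix (kalman_matrix d C A) I J)}"
  have ex: "\<exists>f\<in>homogeneous_polys n. \<forall>A\<in>carrier_mat n n. peval f A = det (submatrix (kalman_matrix d C A) I J)"
    if "(I, J) \<in> \<I>" for I J
  proof -
    have IJ: "I \<subseteq> {..<(d + 1) * m}" "J \<subseteq> {..<n}" "card I = r" "card J = r" using that by (auto simp: \<I>_def)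
    have pI: "pick I a < (d + 1) * m" if "a < r" for a using pick_in_set_le[of a I] that IJ by auto
    have pJ: "pick J a < n" if "a < r" for a using pick_in_set_le[of a J] that IJ by auto
    have sets: "{i. i < (d + 1) * m \<and> i \<in> I} = I" "{j. j < n \<and> j \<in> J} = J" using IJ by auto
    have car: "submatrix (kalman_matrix d C A) I J \<in> carrier_mat r r" if "A \<in> carrier_mat n n" for A
      unfolding submatrix_def carrier_matD[OF kalman_matrix_carrier[OF C that]] sets IJ by simp
    have idx: "submatrix (kalman_matrix d C A) I J $$ (a, b) = (C * A ^\<^sub>m (pick I a div m)) $$ (pick I a mod m, pick J b)"
      if "A \<in> carrier_mat n n" "a < r" "b < r" for A a b
    proof -
      have "card {i. i < dim_row (kalman_matrix d C A) \<and> i \<in> I} = r" "card {j. j < dim_col (kalman_matrix d C A) \<and> j \<in> J} = r"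
        by (simp_all only: carrier_matD[OF kalman_matrix_carrier[OF C that(1)]] sets IJ)
      then have "submatrix (kalman_matrix d C A) I J $$ (a, b) = kalman_matrix d C A $$ (pick I a, pick J b)"
        using that by (intro submatrix_index) auto
      then show ?thesis using kalman_matrix_index[OF C that(1) pI[OF that(2)] pJ[OF that(3)]] by simp
    qed
    have "poly_fun n (hom_monomials n (\<Sum>a<r. pick I a div m)) (\<lambda>A. det (submatrix (kalman_matrix d C A) I J))"
    proof (rule hom_poly_fun_det)
      fix a b assume ab: "a < r" "b < r"
      have "m > 0" using pI[OF ab(1)] by (cases m) auto
      then have "poly_fun n (hom_monomials n (pick I a div m)) (\<lambda>A. (C * A ^\<^sub>m (pick I a div m)) $$ (pick I a mod m, pick J b))"
        using pJ[OF ab(2)] by (intro hom_poly_fun_kalman_entry[OF C]) auto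
      then show "poly_fun n (hom_monomials n (pick I a div m)) (\<lambda>A. submatrix (kalman_matrix d C A) I J $$ (a, b))"
        by (rule poly_fun_cong) (simp add: idx ab)
    qed (rule car)
    then show ?thesis by (rule poly_fun_homogeneous)
  qed
  have minors: "minors r (kalman_matrix d C A) = (\<lambda>(I,J). det (submatrix (kalman_matrix d C A) I J)) ` \<I>"
    if "A \<in> carrier_mat n n" for A
    unfolding minors_def \<I>_def carrier_matD[OF kalman_matrix_carrier[OF C that]] by auto
  have "(\<forall>\<mu>\<in>minors r (kalman_matrix d C A). \<mu> = 0) \<longleftrightarrow> (\<forall>f\<in>F. peval f A = 0)" if A: "A \<in> carrier_mat n n" for A
  proof
    assume l: "\<forall>\<mu>\<in>minors r (kalman_matrix d C A). \<mu> = 0"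
    show "\<forall>f\<in>F. peval f A = 0"
    proof
      fix f assume "f \<in> F"
      then obtain I J where "(I,J) \<in> \<I>" "peval f A = det (submatrix (kalman_matrix d C A) I J)" using A by (auto simp: F_def)
      then show "peval f A = 0" using l unfolding minors[OF A] by force
    qed
  next
    assume l: "\<forall>f\<in>F. peval f A = 0"
    show "\<forall>\<mu>\<in>minors r (kalman_matrix d C A). \<mu> = 0"
    proof
      fix \<mu> assume "\<mu> \<in> minors r (kalman_matrix d C A)"
      then obtain I J where IJ: "(I,J) \<in> \<I>" "\<mu> = det (submatrix (kalman_matrix d C A) I J)" unfolding minors[OF A] by auto
      obtain f where f: "f \<in> homogeneous_polys n" "\<forall>A\<in>carrier_mat n n. peval f A = det (submatrix (kalman_matrix d C A) I J)"
        using ex[OF IJ(1)] by blast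
      then have "f \<in> F" using IJ(1) by (auto simp: F_def)
      then show "\<mu> = 0" using l f(2) IJ(2) A by auto
    qed
  qed
  then have "kalman_variety s n (mat_kernel C) = proj_zeros n F"
    unfolding kalman_variety_minors[OF C dim s] proj_zeros_def r_def[symmetric]
    by (intro Collect_cong iff_exI conj_cong refl) (auto simp: nonzero_mats_def)
  moreover have "F \<subseteq> homogeneous_polys n" by (auto simp: F_def)
  ultimately show ?thesis unfolding proj_closed_def by blast
qed

section \<open>Rank one matrices, separating functionals, and paths in the variety\<close>

definition rank_one :: "nat \<Rightarrow> 'a::comm_ring_1 vec \<Rightarrow> 'a vec \<Rightarrow> 'a mat" where
  "rank_one n r \<phi> = mat n n (\<lambda>(i,j). r $ i * \<phi> $ j)"

lemma rank_one_carrier [simp]: "rank_one n r \<phi> \<in> carrier_mat n n"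
  by (simp add: rank_one_def)

lemma rank_one_mult_vec:
  assumes "r \<in> carrier_vec n" "\<phi> \<in> carrier_vec n" "x \<in> carrier_vec n"
  shows "rank_one n r \<phi> *\<^sub>v x = (\<phi> \<bullet> x) \<cdot>\<^sub>v r"
  using assms by (intro eq_vecI) (auto simp: rank_one_def scalar_prod_def sum_distrib_left sum_distrib_right mult_ac)

lemma vec_nonzero_index:
  assumes "v \<in> carrier_vec n" "v \<noteq> 0\<^sub>v n"
  obtains i where "i < n" "v $ i \<noteq> 0"
proof -
  have "\<exists>i<n. v $ i \<noteq> 0"
  proof (rule ccontr)
    assume "\<not> ?thesis"
    then have "v = 0\<^sub>v n" using assms(1) by (intro eq_vecI) auto
    then show False using assms(2) by simp
  qed
  then show ?thesis using that by blast
qed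

text \<open>One of two coordinate functionals or their sum will do. Two eigenvectors scaled to the
  value 1 of such a functional are joined by a segment that misses the origin.\<close>

lemma common_functional:
  fixes v w :: "'a::field vec"
  assumes v: "v \<in> carrier_vec n" "v \<noteq> 0\<^sub>v n" and w: "w \<in> carrier_vec n" "w \<noteq> 0\<^sub>v n"
  obtains \<phi> where "\<phi> \<in> carrier_vec n" "\<phi> \<bullet> v \<noteq> 0" "\<phi> \<bullet> w \<noteq> 0"
proof -
  obtain i j where i: "i < n" "v $ i \<noteq> 0" and j: "j < n" "w $ j \<noteq> 0"
    using vec_nonzero_index[OF v] vec_nonzero_index[OF w] by metis
  have ui: "unit_vec n i \<bullet> x = x $ i" "unit_vec n j \<bullet> x = x $ j" if "x \<in> carrier_vec n" for x :: "'a vec"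
    using that i j by auto
  consider "w $ i \<noteq> 0" | "v $ j \<noteq> 0" | "w $ i = 0" "v $ j = 0" by blast
  then show ?thesis
  proof cases
    case 1
    then show ?thesis using that[of "unit_vec n i"] i ui v w by auto
  next
    case 2
    then show ?thesis using that[of "unit_vec n j"] j ui v w by auto
  next
    case 3
    have "(unit_vec n i + unit_vec n j) \<bullet> x = x $ i + x $ j" if "x \<in> carrier_vec n" for x :: "'a vec"
      using add_scalar_prod_distrib[of "unit_vec n i" n "unit_vec n j" x] ui[OF that] that by simp
    then show ?thesis using that[of "unit_vec n i + unit_vec n j"] 3 i j v w by auto
  qed
qed

text \<open>Cramer's rule for a nonzero 2 by 2 minor \<open>D\<close> of the matrix with columns
  \<open>v\<close> and \<open>u\<close>.\<close>

lemma dual_pair: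
  fixes v u :: "'a::field vec"
  assumes v: "v \<in> carrier_vec n" "v \<noteq> 0\<^sub>v n" and u: "u \<in> carrier_vec n" and ind: "\<And>c. u \<noteq> c \<cdot>\<^sub>v v"
  obtains \<phi> \<psi> where "\<phi> \<in> carrier_vec n" "\<psi> \<in> carrier_vec n" "\<phi> \<bullet> v = 1" "\<phi> \<bullet> u = 0" "\<psi> \<bullet> v = 0" "\<psi> \<bullet> u = 1"
proof -
  obtain i where i: "i < n" "v $ i \<noteq> 0" using vec_nonzero_index[OF v] .
  have "\<exists>j<n. v $ i * u $ j - v $ j * u $ i \<noteq> 0"
  proof (rule ccontr)
    assume "\<not> ?thesis"
    then have "u = (u $ i / v $ i) \<cdot>\<^sub>v v" using u v i by (intro eq_vecI) (auto simp: field_simps)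
    then show False using ind by blast
  qed
  then obtain j where j: "j < n" and D: "v $ i * u $ j - v $ j * u $ i \<noteq> 0" by blast
  define D where "D = v $ i * u $ j - v $ j * u $ i"
  define f where "f a b = a \<cdot>\<^sub>v unit_vec n i + b \<cdot>\<^sub>v unit_vec n j" for a b :: 'a
  have fc: "f a b \<in> carrier_vec n" for a b by (simp add: f_def)
  have f: "f a b \<bullet> x = a * x $ i + b * x $ j" if "x \<in> carrier_vec n" for a b x
    using that i j by (simp add: f_def add_scalar_prod_distrib[of _ n] smult_scalar_prod_distrib[of _ n])
  have D0: "D \<noteq> 0" using D by (simp add: D_def)
  have "f (u $ j / D) (- u $ i / D) \<bullet> v = D / D" "f (u $ j / D) (- u $ i / D) \<bullet> u = 0"
    "f (- v $ j / D) (v $ i / D) \<bullet> v = 0" "f (- v $ j / D) (v $ i / D) \<bullet> u = D / D"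
  proof -
    have "u $ j * v $ i - u $ i * v $ j = D" "v $ i * u $ j - v $ j * u $ i = D" by (simp_all add: D_def mult.commute)
    then show "f (u $ j / D) (- u $ i / D) \<bullet> v = D / D" "f (- v $ j / D) (v $ i / D) \<bullet> u = D / D"
      unfolding f[OF v(1)] f[OF u] by (simp_all add: diff_divide_distrib[symmetric])
  qed (simp_all add: f[OF v(1)] f[OF u])
  then show ?thesis using that[OF fc fc] D0 by simp
qed

lemma eigenvector_smult:
  fixes A :: "'a::field mat"
  assumes "A \<in> carrier_mat n n" "v \<in> carrier_vec n" "A *\<^sub>v v = \<mu> \<cdot>\<^sub>v v"
  shows "A *\<^sub>v (c \<cdot>\<^sub>v v) = \<mu> \<cdot>\<^sub>v (c \<cdot>\<^sub>v v)"
  using mult_mat_vec[OF assms(1,2), of c] assms(3) by (simp add: smult_smult_assoc mult.commute)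

context
  fixes L :: "'a::alg_closed_field vec set" and n :: nat
  assumes L: "VectorSpace.subspace class_ring L (module_vec TYPE('a) n)"
begin

lemma L_carrier: "v \<in> L \<Longrightarrow> v \<in> carrier_vec n"
  using L by (auto simp: subspace_vec_iff)

lemma kalman_coneI:
  assumes "A \<in> carrier_mat n n" "v \<in> L" "v \<noteq> 0\<^sub>v n" "A *\<^sub>v v = \<mu> \<cdot>\<^sub>v v"
  shows "A \<in> insert (0\<^sub>m n n) (cone n (kalman_variety 1 n L))"
  unfolding cone_kalman_variety_1[OF L] using assms by (auto simp: nonzero_mats_def)

text \<open>The curve moves the eigenvector along the segment from \<open>v\<close> to \<open>w\<close> and the eigenvalue along that from
  \<open>\<mu>\<close> to \<open>\<nu>\<close>; the segment from \<open>A\<close> to \<open>B\<close> is corrected by a rank one matrix to achieve this.\<close>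

lemma kalman_path:
  assumes A: "A \<in> carrier_mat n n" "A *\<^sub>v v = \<mu> \<cdot>\<^sub>v v" and v: "v \<in> L"
    and B: "B \<in> carrier_mat n n" "B *\<^sub>v w = \<nu> \<cdot>\<^sub>v w" and w: "w \<in> L"
    and \<phi>: "\<phi> \<in> carrier_vec n" "\<phi> \<bullet> v = 1" "\<phi> \<bullet> w = 1"
  obtains X where "curve_mat n X 0 = A" "curve_mat n X 1 = B"
    and "\<And>t. curve_mat n X t *\<^sub>v (v + t \<cdot>\<^sub>v (w - v)) = (\<mu> + t * (\<nu> - \<mu>)) \<cdot>\<^sub>v (v + t \<cdot>\<^sub>v (w - v))"
    and "\<And>t. v + t \<cdot>\<^sub>v (w - v) \<in> L" "\<And>t. \<phi> \<bullet> (v + t \<cdot>\<^sub>v (w - v)) = 1"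
    and "\<And>t. v + t \<cdot>\<^sub>v (w - v) \<noteq> 0\<^sub>v n"
proof -
  have vc: "v \<in> carrier_vec n" and wc: "w \<in> carrier_vec n" using v w L_carrier by auto
  \<comment> \<open>The defect of the eigenvector equation along the two segments, as a polynomial
    in the parameter. Since \<phi> is 1 on the moving vector, adding the defect times \<phi> to the
    matrix restores the equation.\<close>
  define R where "R i = [:\<mu>, \<nu> - \<mu>:] * [:v $ i, w $ i - v $ i:]
    - (\<Sum>k<n. [:A $$ (i,k), B $$ (i,k) - A $$ (i,k):] * [:v $ k, w $ k - v $ k:])" for i
  define X where "X = (\<lambda>(i,j). [:A $$ (i,j), B $$ (i,j) - A $$ (i,j):] + R i * [:\<phi> $ j:])"
  let ?x = "\<lambda>t. v + t \<cdot>\<^sub>v (w - v)" and ?l = "\<lambda>t. \<mu> + t * (\<nu> - \<mu>)"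
  define M where "M t = A + t \<cdot>\<^sub>m (B - A)" for t
  have M: "M t \<in> carrier_mat n n" for t
    unfolding M_def using A B by (intro add_carrier_mat smult_carrier_mat minus_carrier_mat)
  have Mi: "M t $$ (i,k) = A $$ (i,k) + t * (B $$ (i,k) - A $$ (i,k))" if "i < n" "k < n" for i k t
    using that A B by (simp add: M_def)
  have xc: "?x t \<in> carrier_vec n" for t using vc wc by simp
  have xi: "?x t $ i = v $ i + t * (w $ i - v $ i)" if "i < n" for i t using that vc wc by simp
  define r where "r t = ?l t \<cdot>\<^sub>v ?x t - M t *\<^sub>v ?x t" for t
  have r: "r t \<in> carrier_vec n" for t
    unfolding r_def by (intro minus_carrier_vec smult_carrier_vec[THEN iffD2] mult_mat_vec_carrier[OF M] xc)
  have ri: "r t $ i = ?l t * ?x t $ i - (\<Sum>k<n. M t $$ (i,k) * ?x t $ k)" if i: "i < n" for i t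
  proof -
    have "r t $ i = (?l t \<cdot>\<^sub>v ?x t) $ i - (M t *\<^sub>v ?x t) $ i"
      unfolding r_def using i carrier_matD[OF M[of t]] by (intro index_minus_vec) simp
    then show ?thesis using mult_mat_vec_entry[OF M xc i] index_smult_vec(1)[of i "?x t"] carrier_vecD[OF xc[of t]] i by simp
  qed
  have rR: "poly (R i) t = r t $ i" if i: "i < n" for i t
  proof -
    have "(\<Sum>k<n. M t $$ (i,k) * ?x t $ k) = (\<Sum>k<n. (A $$ (i,k) + t * (B $$ (i,k) - A $$ (i,k))) * (v $ k + t * (w $ k - v $ k)))"
      by (intro sum.cong refl) (simp only: Mi[OF i] xi lessThan_iff)
    then show ?thesis unfolding ri[OF i] xi[OF i]
      by (simp only: R_def poly_diff poly_mult poly_sum poly_pCons poly_0 mult_zero_right add_0_right)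
  qed
  have XM: "curve_mat n X t = M t + rank_one n (r t) \<phi>" for t
    using A B by (intro eq_matI) (auto simp: curve_mat_def X_def rank_one_def rR, auto simp: M_def)
  have \<phi>x: "\<phi> \<bullet> ?x t = 1" for t
    using \<phi> vc wc by (simp add: scalar_prod_add_distrib[of _ n] scalar_prod_minus_distrib[of _ n])
  have main: "curve_mat n X t *\<^sub>v ?x t = ?l t \<cdot>\<^sub>v ?x t" for t
  proof -
    have "curve_mat n X t *\<^sub>v ?x t = M t *\<^sub>v ?x t + r t"
      unfolding XM using xc[of t] \<phi>(1) r[of t] \<phi>x[of t]
      by (simp add: add_mult_distrib_mat_vec[OF M rank_one_carrier] rank_one_mult_vec)
    also have "\<dots> = ?l t \<cdot>\<^sub>v ?x t"
    proof (rule eq_vecI)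
      fix i assume "i < dim_vec (?l t \<cdot>\<^sub>v ?x t)"
      then have i: "i < n" using carrier_vecD[OF xc[of t]] by (simp only: index_smult_vec(2))
      have "(M t *\<^sub>v ?x t + r t) $ i = (M t *\<^sub>v ?x t) $ i + r t $ i" using carrier_vecD[OF r[of t]] i by (intro index_add_vec) simp
      also have "\<dots> = ?l t * ?x t $ i" unfolding ri[OF i] mult_mat_vec_entry[OF M xc i] by simp
      also have "\<dots> = (?l t \<cdot>\<^sub>v ?x t) $ i" using carrier_vecD[OF xc[of t]] i by (intro index_smult_vec(1)[symmetric]) simp
      finally show "(M t *\<^sub>v ?x t + r t) $ i = (?l t \<cdot>\<^sub>v ?x t) $ i" .
    qed (use carrier_vecD[OF r[of t]] carrier_vecD[OF xc[of t]] in \<open>simp only: index_add_vec(2) index_smult_vec(2)\<close>)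
    finally show ?thesis .
  qed
  \<comment> \<open>At both ends the equation already holds, so the correction leaves
    \<open>A\<close> and \<open>B\<close> in place.\<close>
  have r01: "r 0 = 0\<^sub>v n" "r 1 = 0\<^sub>v n"
  proof -
    have "?x 0 = v" "?x 1 = w" using vc wc by auto
    moreover have "M 0 = A" "M 1 = B" using A B by (auto simp: M_def)
    ultimately show "r 0 = 0\<^sub>v n" "r 1 = 0\<^sub>v n" using A B vc wc unfolding r_def by auto
  qed
  have rz: "rank_one n (0\<^sub>v n) \<phi> = 0\<^sub>m n n" using \<phi> by (auto simp: rank_one_def)
  show ?thesis
  proof (rule that[of X])
    show "curve_mat n X 0 = A" "curve_mat n X 1 = B" unfolding XM r01 rz M_def using A B by auto
    show "?x t \<in> L" for t
    proof -
      have "?x t = (1 - t) \<cdot>\<^sub>v v + t \<cdot>\<^sub>v w" using vc wc by (intro eq_vecI) (auto simp: algebra_simps)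
      then show ?thesis using v w L by (auto simp: subspace_vec_iff)
    qed
    show "?x t \<noteq> 0\<^sub>v n" for t using \<phi>x[of t] \<phi>(1) by auto
  qed (use main \<phi>x in auto)
qed

lemma one_mat_in_cone:
  assumes "v \<in> L" "v \<noteq> 0\<^sub>v n"
  shows "1\<^sub>m n \<in> cone n (kalman_variety 1 n L)"
proof -
  obtain i where i: "i < n" using vec_nonzero_index[OF L_carrier[OF assms(1)] assms(2)] .
  then have "(1\<^sub>m n :: 'a mat) $$ (i,i) \<noteq> 0\<^sub>m n n $$ (i,i)" by simp
  then have "(1\<^sub>m n :: 'a mat) \<noteq> 0\<^sub>m n n" by metis
  moreover have "1\<^sub>m n *\<^sub>v v = 1 \<cdot>\<^sub>v v" using L_carrier[OF assms(1)] by simp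
  then have "\<exists>v\<in>L. v \<noteq> 0\<^sub>v n \<and> (\<exists>\<mu>. 1\<^sub>m n *\<^sub>v v = \<mu> \<cdot>\<^sub>v v)" using assms by blast
  ultimately show ?thesis unfolding cone_kalman_variety_1[OF L] by (auto simp: nonzero_mats_def)
qed

lemma proj_irreducible_kalman_variety:
  assumes closed: "proj_closed n (kalman_variety 1 n L)" and v: "v \<in> L" "v \<noteq> 0\<^sub>v n"
  shows "proj_irreducible n (kalman_variety 1 n L)"
proof (rule proj_irreducibleI[OF closed])
  show "cone n (kalman_variety 1 n L) \<noteq> {}" using one_mat_in_cone[OF v] by blast
  fix A B assume "A \<in> cone n (kalman_variety 1 n L)" "B \<in> cone n (kalman_variety 1 n L)"
  then obtain v w \<mu> \<nu> where A: "A \<in> carrier_mat n n" "v \<in> L" "v \<noteq> 0\<^sub>v n" "A *\<^sub>v v = \<mu> \<cdot>\<^sub>v v"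
    and B: "B \<in> carrier_mat n n" "w \<in> L" "w \<noteq> 0\<^sub>v n" "B *\<^sub>v w = \<nu> \<cdot>\<^sub>v w"
    unfolding cone_kalman_variety_1[OF L] by (auto simp: nonzero_mats_def)
  have vw: "v \<in> carrier_vec n" "w \<in> carrier_vec n" using A B L_carrier by auto
  obtain \<phi> where \<phi>: "\<phi> \<in> carrier_vec n" "\<phi> \<bullet> v \<noteq> 0" "\<phi> \<bullet> w \<noteq> 0" using common_functional[OF vw(1) A(3) vw(2) B(3)] .
  \<comment> \<open>With this scaling the segment between the eigenvectors stays in the affine
    hyperplane where \<phi> is 1 and hence avoids 0.\<close>
  let ?v = "inverse (\<phi> \<bullet> v) \<cdot>\<^sub>v v" and ?w = "inverse (\<phi> \<bullet> w) \<cdot>\<^sub>v w"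
  have vL: "?v \<in> L" "?w \<in> L" using A B L by (auto simp: subspace_vec_iff)
  have "\<phi> \<bullet> ?v = 1" "\<phi> \<bullet> ?w = 1" using \<phi> vw by auto
  from kalman_path[OF A(1) eigenvector_smult[OF A(1) vw(1) A(4)] vL(1) B(1) eigenvector_smult[OF B(1) vw(2) B(4)] vL(2) \<phi>(1) this]
  obtain X where X: "curve_mat n X 0 = A" "curve_mat n X 1 = B"
    and e: "\<And>t. curve_mat n X t *\<^sub>v (?v + t \<cdot>\<^sub>v (?w - ?v)) = (\<mu> + t * (\<nu> - \<mu>)) \<cdot>\<^sub>v (?v + t \<cdot>\<^sub>v (?w - ?v))"
      "\<And>t. ?v + t \<cdot>\<^sub>v (?w - ?v) \<in> L" "\<And>t. ?v + t \<cdot>\<^sub>v (?w - ?v) \<noteq> 0\<^sub>v n"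
    by metis
  then have "curve_mat n X t \<in> insert (0\<^sub>m n n) (cone n (kalman_variety 1 n L))" for t
    using kalman_coneI[OF curve_mat_carrier e(2,3,1)] by blast
  then show "\<exists>X. curve_mat n X 0 = A \<and> curve_mat n X 1 = B \<and>
      (\<forall>t. curve_mat n X t \<in> insert (0\<^sub>m n n) (cone n (kalman_variety 1 n L)))" using X by blast
qed

end

section \<open>Tangent spaces\<close>

lemma subspace_cone_tangent_space:
  "VectorSpace.subspace class_ring (cone_tangent_space n Z A) (module_mat TYPE('a::field) n n)"
  unfolding subspace_mat_iff
proof (intro conjI ballI allI)
  show "cone_tangent_space n Z A \<subseteq> carrier_mat n n" by (auto simp: cone_tangent_space_def)
  show "0\<^sub>m n n \<in> cone_tangent_space n Z A" by (auto simp: cone_tangent_space_def intro!: sum.neutral)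
  fix V assume V: "V \<in> cone_tangent_space n Z A"
  show "c \<cdot>\<^sub>m V \<in> cone_tangent_space n Z A" for c
  proof -
    have "(\<Sum>x\<in>{..<n} \<times> {..<n}. peval (partial x f) A * (c \<cdot>\<^sub>m V) $$ x)
      = c * (\<Sum>x\<in>{..<n} \<times> {..<n}. peval (partial x f) A * V $$ x)" for f
      unfolding sum_distrib_left using V by (intro sum.cong refl) (auto simp: cone_tangent_space_def)
    then show ?thesis using V by (auto simp: cone_tangent_space_def)
  qed
  fix W assume W: "W \<in> cone_tangent_space n Z A"
  have "(\<Sum>x\<in>{..<n} \<times> {..<n}. peval (partial x f) A * (V + W) $$ x)
      = (\<Sum>x\<in>{..<n} \<times> {..<n}. peval (partial x f) A * V $$ x) + (\<Sum>x\<in>{..<n} \<times> {..<n}. peval (partial x f) A * W $$ x)" for f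
    unfolding sum.distrib[symmetric] using V W
    by (intro sum.cong refl) (auto simp: cone_tangent_space_def algebra_simps)
  then show "V + W \<in> cone_tangent_space n Z A" using V W by (auto simp: cone_tangent_space_def)
qed

lemma zero_smult_vec:
  fixes y :: "'a::semiring_1 vec"
  assumes "y \<in> carrier_vec n"
  shows "0 \<cdot>\<^sub>v y = 0\<^sub>v n"
  using assms by (intro eq_vecI) auto

lemma curve_mat_mult_vec:
  assumes "x \<in> carrier_vec n" "i < n"
  shows "(curve_mat n X t *\<^sub>v x) $ i = (\<Sum>l<n. poly (X (i,l)) t * x $ l)"
  unfolding mult_mat_vec_entry[OF curve_mat_carrier assms] using assms
  by (intro sum.cong refl) (simp add: curve_mat_def)

lemma scalar_prod_sum:
  assumes "v \<in> carrier_vec n"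
  shows "\<phi> \<bullet> v = (\<Sum>l<n. \<phi> $ l * v $ l)"
  using assms by (simp add: scalar_prod_def lessThan_atLeast0)

lemma dual_functional:
  fixes v :: "'a::field vec"
  assumes "v \<in> carrier_vec n" "v \<noteq> 0\<^sub>v n"
  obtains \<phi> where "\<phi> \<in> carrier_vec n" "\<phi> \<bullet> v = 1"
proof -
  obtain i where i: "i < n" "v $ i \<noteq> 0" using vec_nonzero_index[OF assms] .
  show ?thesis
    by (rule that[of "inverse (v $ i) \<cdot>\<^sub>v unit_vec n i"])
      (use i assms in \<open>simp_all add: smult_scalar_prod_distrib[of _ n]\<close>)
qed

context
  fixes L :: "'a::alg_closed_field vec set" and n :: nat
  assumes L: "VectorSpace.subspace class_ring L (module_vec TYPE('a) n)"
begin

text \<open>The hypothesis \<open>eq\<close> is the derivative of the eigenvector equation with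
  eigenvector \<open>v + t w\<close> and eigenvalue \<open>\<mu> + t \<nu>\<close>. A quadratic
  correction of \<open>A + t V\<close> makes that equation hold exactly, so there is a genuine curve
  in the cone with velocity \<open>V\<close>.\<close>

lemma eigen_tangent:
  assumes A: "A \<in> carrier_mat n n" and v: "v \<in> L" "v \<noteq> 0\<^sub>v n" and Av: "A *\<^sub>v v = \<mu> \<cdot>\<^sub>v v"
    and w: "w \<in> L" and V: "V \<in> carrier_mat n n" and eq: "V *\<^sub>v v + A *\<^sub>v w = \<mu> \<cdot>\<^sub>v w + \<nu> \<cdot>\<^sub>v v"
  shows "V \<in> cone_tangent_space n (kalman_variety 1 n L) A"
proof -
  have vc: "v \<in> carrier_vec n" and wc: "w \<in> carrier_vec n" using v w L_carrier[OF L] by auto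
  obtain \<phi> where \<phi>: "\<phi> \<in> carrier_vec n" "\<phi> \<bullet> v = 1" using dual_functional[OF vc v(2)] .
  \<comment> \<open>Shifting \<open>w\<close> along \<open>v\<close> preserves \<open>eq\<close>
    because \<open>v\<close> is an eigenvector for \<mu>; with \<phi> zero on \<open>w'\<close>, the
    value of \<phi> on \<open>v + t w'\<close> stays 1.\<close>
  define w' where "w' = w + (- (\<phi> \<bullet> w)) \<cdot>\<^sub>v v"
  have w'L: "w' \<in> L" using v w L by (auto simp: w'_def subspace_vec_iff)
  then have w'c: "w' \<in> carrier_vec n" using L_carrier[OF L] by blast
  have w'i: "w' $ i = w $ i - (\<phi> \<bullet> w) * v $ i" if "i < n" for i using that vc wc by (simp add: w'_def)
  have \<phi>v: "(\<Sum>l<n. \<phi> $ l * v $ l) = 1" using \<phi> scalar_prod_sum[OF vc] by simp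
  have \<phi>w': "(\<Sum>l<n. \<phi> $ l * w' $ l) = 0"
  proof -
    have "(\<Sum>l<n. \<phi> $ l * w' $ l) = (\<Sum>l<n. \<phi> $ l * w $ l) - (\<phi> \<bullet> w) * (\<Sum>l<n. \<phi> $ l * v $ l)"
      unfolding sum_distrib_left sum_subtractf[symmetric]
      by (intro sum.cong refl) (simp add: w'i algebra_simps)
    then show ?thesis using \<phi>v scalar_prod_sum[OF wc, of \<phi>] by simp
  qed
  have Avi: "(\<Sum>l<n. A $$ (i,l) * v $ l) = \<mu> * v $ i" if "i < n" for i
    using mult_mat_vec_entry[OF A vc that] Av that vc by simp
  have Awi: "(\<Sum>l<n. V $$ (i,l) * v $ l) + (\<Sum>l<n. A $$ (i,l) * w' $ l) = \<mu> * w' $ i + \<nu> * v $ i" if i: "i < n" for i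
  proof -
    have "(V *\<^sub>v v + A *\<^sub>v w) $ i = \<mu> * w $ i + \<nu> * v $ i" unfolding eq using i vc wc by simp
    moreover have "(V *\<^sub>v v + A *\<^sub>v w) $ i = (V *\<^sub>v v) $ i + (A *\<^sub>v w) $ i" using A i by (intro index_add_vec) simp
    ultimately have "(\<Sum>l<n. V $$ (i,l) * v $ l) + (\<Sum>l<n. A $$ (i,l) * w $ l) = \<mu> * w $ i + \<nu> * v $ i"
      using mult_mat_vec_entry[OF V vc i] mult_mat_vec_entry[OF A wc i] by simp
    moreover have "(\<Sum>l<n. A $$ (i,l) * w $ l) = (\<Sum>l<n. A $$ (i,l) * w' $ l) + (\<phi> \<bullet> w) * (\<Sum>l<n. A $$ (i,l) * v $ l)"
      unfolding sum_distrib_left sum.distrib[symmetric]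
      by (intro sum.cong refl) (simp add: w'i algebra_simps)
    moreover have "w $ i = w' $ i + (\<phi> \<bullet> w) * v $ i" using w'i[OF i] by simp
    ultimately have "((\<Sum>l<n. V $$ (i,l) * v $ l) + (\<Sum>l<n. A $$ (i,l) * w' $ l)) + (\<phi> \<bullet> w) * (\<mu> * v $ i)
      = (\<mu> * w' $ i + \<nu> * v $ i) + (\<phi> \<bullet> w) * (\<mu> * v $ i)"
      unfolding Avi[OF i] by (simp only: distrib_left add.assoc mult.left_commute add.left_commute add.commute)
    then show ?thesis by simp
  qed
  \<comment> \<open>Applied to \<open>v + t w'\<close>, the matrix \<open>A + t V\<close> falls
    short of the eigenvector equation by exactly \<open>t\<^sup>2 r\<close>, which the term
    \<open>t\<^sup>2 r \<phi>\<close> supplies.\<close>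
  define r where "r i = \<nu> * w' $ i - (\<Sum>l<n. V $$ (i,l) * w' $ l)" for i
  define X where "X = (\<lambda>x. [:A $$ x:])"
  define Y where "Y = (\<lambda>(i,j). [:V $$ (i,j), r i * \<phi> $ j:])"
  have ne: "cone n (kalman_variety 1 n L) \<noteq> {}" using one_mat_in_cone[OF L v] by blast
  show ?thesis
  proof (rule tangent_vector_of_curves[OF ne, of 1 X Y])
    have XA: "curve_mat n X t = A" for t using A by (intro eq_matI) (auto simp: curve_mat_def X_def)
    show "curve_mat n X t \<in> insert (0\<^sub>m n n) (cone n (kalman_variety 1 n L))" for t
      unfolding XA by (rule kalman_coneI[OF L A v Av])
    show "curve_mat n X 0 = A" by (rule XA)
    show "curve_mat n Y 0 = V" using V by (intro eq_matI) (auto simp: curve_mat_def Y_def)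
    show "curve_mat n (\<lambda>x. X x + monom 1 1 * Y x) t \<in> insert (0\<^sub>m n n) (cone n (kalman_variety 1 n L))" for t
    proof (rule kalman_coneI[OF L curve_mat_carrier])
      let ?x = "v + t \<cdot>\<^sub>v w'"
      show "?x \<in> L" using v w'L L by (auto simp: subspace_vec_iff)
      have xc: "?x \<in> carrier_vec n" using vc w'c by simp
      have xi: "?x $ i = v $ i + t * w' $ i" if "i < n" for i using that vc w'c by simp
      have "\<phi> \<bullet> ?x = 1" unfolding scalar_prod_sum[OF xc]
        using \<phi>v \<phi>w' by (simp add: xi algebra_simps sum.distrib sum_distrib_left[symmetric])
      then show "?x \<noteq> 0\<^sub>v n" using \<phi>(1) by auto
      show "curve_mat n (\<lambda>x. X x + monom 1 1 * Y x) t *\<^sub>v ?x = (\<mu> + t * \<nu>) \<cdot>\<^sub>v ?x"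
      proof (rule eq_vecI)
        fix i assume "i < dim_vec ((\<mu> + t * \<nu>) \<cdot>\<^sub>v ?x)"
        then have i: "i < n" using w'c by simp
        have "(curve_mat n (\<lambda>x. X x + monom 1 1 * Y x) t *\<^sub>v ?x) $ i
            = (\<Sum>l<n. (A $$ (i,l) + t * (V $$ (i,l) + t * (r i * \<phi> $ l))) * (v $ l + t * w' $ l))"
          unfolding curve_mat_mult_vec[OF xc i]
          by (intro sum.cong refl) (simp only: xi lessThan_iff, simp add: X_def Y_def poly_monom algebra_simps)
        also have "\<dots> = (\<Sum>l<n. A $$ (i,l) * v $ l) + t * ((\<Sum>l<n. V $$ (i,l) * v $ l) + (\<Sum>l<n. A $$ (i,l) * w' $ l))
            + t * t * (\<Sum>l<n. V $$ (i,l) * w' $ l)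
            + t * t * r i * ((\<Sum>l<n. \<phi> $ l * v $ l) + t * (\<Sum>l<n. \<phi> $ l * w' $ l))"
          by (simp add: algebra_simps sum.distrib sum_distrib_left)
        also have "\<dots> = (\<mu> + t * \<nu>) * (v $ i + t * w' $ i)"
          unfolding Avi[OF i] Awi[OF i] \<phi>v \<phi>w' r_def by (simp add: algebra_simps)
        also have "\<dots> = ((\<mu> + t * \<nu>) \<cdot>\<^sub>v ?x) $ i" using xi[OF i] i w'c by simp
        finally show "(curve_mat n (\<lambda>x. X x + monom 1 1 * Y x) t *\<^sub>v ?x) $ i = ((\<mu> + t * \<nu>) \<cdot>\<^sub>v ?x) $ i" .
      qed (use w'c in \<open>simp add: curve_mat_def\<close>)
    qed
  qed simp
qed

lemma tangent_if_kills_eigenvector: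
  assumes "A \<in> carrier_mat n n" "v \<in> L" "v \<noteq> 0\<^sub>v n" "A *\<^sub>v v = \<mu> \<cdot>\<^sub>v v"
    and V: "V \<in> carrier_mat n n" "V *\<^sub>v v = 0\<^sub>v n"
  shows "V \<in> cone_tangent_space n (kalman_variety 1 n L) A"
proof (rule eigen_tangent[OF assms(1-4) _ V(1), of "0\<^sub>v n" 0])
  have "v \<in> carrier_vec n" using assms L_carrier[OF L] by blast
  then show "V *\<^sub>v v + A *\<^sub>v 0\<^sub>v n = \<mu> \<cdot>\<^sub>v 0\<^sub>v n + 0 \<cdot>\<^sub>v v"
    unfolding V mult_mat_zero_vec[OF assms(1)] by (intro eq_vecI) auto
  show "0\<^sub>v n \<in> L" using L by (simp add: subspace_vec_iff)
qed

text \<open>At a matrix with a Jordan block on \<open>\<langle>v, u\<rangle> \<subseteq> L\<close> the curve moving the eigenvector to \<open>v + \<tau>u\<close> is of the form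
  \<open>A + \<tau>V\<^sub>1 + \<tau>\<^sup>2V\<^sub>2\<close> where \<open>A + \<tau>V\<^sub>1\<close> stays in the variety and \<open>V\<^sub>2v\<close> is arbitrary.\<close>

lemma jordan_block_tangent:
  assumes A: "A \<in> carrier_mat n n" and v: "v \<in> L" "v \<noteq> 0\<^sub>v n" "A *\<^sub>v v = \<mu> \<cdot>\<^sub>v v"
    and u: "u \<in> L" "A *\<^sub>v u = \<mu> \<cdot>\<^sub>v u + v"
    and y: "y \<in> carrier_vec n"
    and \<phi>: "\<phi> \<in> carrier_vec n" "\<psi> \<in> carrier_vec n" "\<phi> \<bullet> v = 1" "\<phi> \<bullet> u = 0" "\<psi> \<bullet> v = 0" "\<psi> \<bullet> u = 1"
  shows "rank_one n y \<phi> \<in> cone_tangent_space n (kalman_variety 1 n L) A"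
proof -
  have vc: "v \<in> carrier_vec n" and uc: "u \<in> carrier_vec n" using v u L_carrier[OF L] by auto
  \<comment> \<open>\<open>X\<close> keeps the eigenvector \<open>v\<close> because \<psi> vanishes
    on it. On \<open>v + t u\<close> the term with \<psi> contributes
    \<open>t\<^sup>2 (u - y)\<close> and the term with \<phi> contributes
    \<open>t\<^sup>2 y\<close>; together with the Jordan relation this gives eigenvalue
    \<open>\<mu> + t\<close>, whatever \<open>y\<close> is.\<close>
  define X where "X = (\<lambda>(i,j). [:A $$ (i,j), (u $ i - y $ i) * \<psi> $ j:])"
  define Y where "Y = (\<lambda>(i,j). [:y $ i * \<phi> $ j:])"
  have Avi: "(\<Sum>l<n. A $$ (i,l) * v $ l) = \<mu> * v $ i" if "i < n" for i
    using mult_mat_vec_entry[OF A vc that] v that vc by simp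
  have Aui: "(\<Sum>l<n. A $$ (i,l) * u $ l) = \<mu> * u $ i + v $ i" if "i < n" for i
    using mult_mat_vec_entry[OF A uc that] u that uc vc by simp
  have pv: "(\<Sum>l<n. \<phi> $ l * v $ l) = 1" "(\<Sum>l<n. \<phi> $ l * u $ l) = 0" "(\<Sum>l<n. \<psi> $ l * v $ l) = 0" "(\<Sum>l<n. \<psi> $ l * u $ l) = 1"
    using \<phi> scalar_prod_sum[OF vc] scalar_prod_sum[OF uc] by auto
  have ne: "cone n (kalman_variety 1 n L) \<noteq> {}" using one_mat_in_cone[OF L v(1,2)] by blast
  show ?thesis
  proof (rule tangent_vector_of_curves[OF ne, of 2 X Y])
    show "curve_mat n X 0 = A" using A by (intro eq_matI) (auto simp: curve_mat_def X_def)
    show "curve_mat n Y 0 = rank_one n y \<phi>" by (intro eq_matI) (auto simp: curve_mat_def Y_def rank_one_def)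
    show "curve_mat n X t \<in> insert (0\<^sub>m n n) (cone n (kalman_variety 1 n L))" for t
    proof (rule kalman_coneI[OF L curve_mat_carrier v(1,2)])
      show "curve_mat n X t *\<^sub>v v = \<mu> \<cdot>\<^sub>v v"
      proof (rule eq_vecI)
        fix i assume "i < dim_vec (\<mu> \<cdot>\<^sub>v v)"
        then have i: "i < n" using vc by simp
        have "(curve_mat n X t *\<^sub>v v) $ i = (\<Sum>l<n. A $$ (i,l) * v $ l) + t * (u $ i - y $ i) * (\<Sum>l<n. \<psi> $ l * v $ l)"
          unfolding curve_mat_mult_vec[OF vc i] by (simp add: X_def algebra_simps sum.distrib sum_distrib_left sum_subtractf)
        then show "(curve_mat n X t *\<^sub>v v) $ i = (\<mu> \<cdot>\<^sub>v v) $ i" using Avi[OF i] pv i vc by simp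
      qed (use vc in \<open>simp add: curve_mat_def\<close>)
    qed
    show "curve_mat n (\<lambda>x. X x + monom 1 2 * Y x) t \<in> insert (0\<^sub>m n n) (cone n (kalman_variety 1 n L))" for t
    proof (rule kalman_coneI[OF L curve_mat_carrier])
      let ?x = "v + t \<cdot>\<^sub>v u"
      show "?x \<in> L" using v u L by (auto simp: subspace_vec_iff)
      have xc: "?x \<in> carrier_vec n" using vc uc by simp
      have xi: "?x $ i = v $ i + t * u $ i" if "i < n" for i using that vc uc by simp
      have "\<phi> \<bullet> ?x = 1" unfolding scalar_prod_sum[OF xc]
        using pv by (simp add: xi algebra_simps sum.distrib sum_distrib_left[symmetric])
      then show "?x \<noteq> 0\<^sub>v n" using \<phi>(1) by auto
      show "curve_mat n (\<lambda>x. X x + monom 1 2 * Y x) t *\<^sub>v ?x = (\<mu> + t) \<cdot>\<^sub>v ?x"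
      proof (rule eq_vecI)
        fix i assume "i < dim_vec ((\<mu> + t) \<cdot>\<^sub>v ?x)"
        then have i: "i < n" using uc by simp
        have "(curve_mat n (\<lambda>x. X x + monom 1 2 * Y x) t *\<^sub>v ?x) $ i
            = (\<Sum>l<n. (A $$ (i,l) + t * ((u $ i - y $ i) * \<psi> $ l) + t * t * (y $ i * \<phi> $ l)) * (v $ l + t * u $ l))"
          unfolding curve_mat_mult_vec[OF xc i]
          by (intro sum.cong refl) (simp only: xi lessThan_iff, simp add: X_def Y_def poly_monom power2_eq_square)
        also have "\<dots> = (\<Sum>l<n. A $$ (i,l) * v $ l) + t * (\<Sum>l<n. A $$ (i,l) * u $ l)
            + t * (u $ i - y $ i) * ((\<Sum>l<n. \<psi> $ l * v $ l) + t * (\<Sum>l<n. \<psi> $ l * u $ l))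
            + t * t * y $ i * ((\<Sum>l<n. \<phi> $ l * v $ l) + t * (\<Sum>l<n. \<phi> $ l * u $ l))"
          by (simp add: algebra_simps sum.distrib sum_distrib_left sum_subtractf)
        also have "\<dots> = (\<mu> + t) * (v $ i + t * u $ i)"
          unfolding Avi[OF i] Aui[OF i] pv by (simp add: algebra_simps)
        also have "\<dots> = ((\<mu> + t) \<cdot>\<^sub>v ?x) $ i" using xi[OF i] i uc by simp
        finally show "(curve_mat n (\<lambda>x. X x + monom 1 2 * Y x) t *\<^sub>v ?x) $ i = ((\<mu> + t) \<cdot>\<^sub>v ?x) $ i" .
      qed (use uc in \<open>simp add: curve_mat_def\<close>)
    qed
  qed simp
qed

text \<open>Every \<open>V\<close> differs from the rank one matrix with columns proportional to
  \<open>V v\<close> by a matrix killing \<open>v\<close>, which is tangent. The rank one matrix is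
  tangent because it kills a second eigenvector in \<open>L\<close>, or else by the Jordan block
  argument.\<close>

lemma tangent_space_eq_carrier:
  assumes A: "A \<in> carrier_mat n n" and W: "VectorSpace.subspace class_ring W (module_vec TYPE('a) n)" "W \<subseteq> L"
    and inv: "\<forall>v\<in>W. A *\<^sub>v v \<in> W" and dim: "2 \<le> subspace_dim n W"
  shows "cone_tangent_space n (kalman_variety 1 n L) A = carrier_mat n n"
proof -
  let ?T = "cone_tangent_space n (kalman_variety 1 n L) A"
  obtain v \<mu> where v: "v \<in> W" "v \<noteq> 0\<^sub>v n" "A *\<^sub>v v = \<mu> \<cdot>\<^sub>v v"
    using exists_eigenvector[OF A W(1) inv] dim by (metis one_le_numeral order_trans)
  have vL: "v \<in> L" using v W by blast
  have vc: "v \<in> carrier_vec n" using vL L_carrier[OF L] by blast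
  have "\<not> W \<subseteq> range (\<lambda>c. c \<cdot>\<^sub>v v)" using subspace_dim_le_1[OF vc W(1)] dim by force
  then obtain u0 where u0: "u0 \<in> W" "u0 \<notin> range (\<lambda>c. c \<cdot>\<^sub>v v)" by blast
  obtain w \<nu> where w: "w \<in> W" "w \<notin> range (\<lambda>c. c \<cdot>\<^sub>v v)" "A *\<^sub>v w + (- \<nu>) \<cdot>\<^sub>v w \<in> range (\<lambda>c. c \<cdot>\<^sub>v v)"
    using exists_eigenvector_modulo[OF A W(1) inv subspace_line[OF vc] u0] by blast
  have wc: "w \<in> carrier_vec n" using w W L_carrier[OF L] by blast
  have Awc: "A *\<^sub>v w \<in> carrier_vec n" using A wc by auto
  obtain \<beta> where \<beta>: "A *\<^sub>v w + (- \<nu>) \<cdot>\<^sub>v w = \<beta> \<cdot>\<^sub>v v" using w(3) by blast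
  have Aw: "A *\<^sub>v w = \<nu> \<cdot>\<^sub>v w + \<beta> \<cdot>\<^sub>v v"
  proof (rule eq_vecI)
    fix i assume "i < dim_vec (\<nu> \<cdot>\<^sub>v w + \<beta> \<cdot>\<^sub>v v)"
    then have i: "i < n" using vc by simp
    have "(A *\<^sub>v w + (- \<nu>) \<cdot>\<^sub>v w) $ i = (\<beta> \<cdot>\<^sub>v v) $ i" using \<beta> by simp
    moreover have "(A *\<^sub>v w + (- \<nu>) \<cdot>\<^sub>v w) $ i = (A *\<^sub>v w) $ i - \<nu> * w $ i" using i wc by simp
    ultimately show "(A *\<^sub>v w) $ i = (\<nu> \<cdot>\<^sub>v w + \<beta> \<cdot>\<^sub>v v) $ i"
      using i wc vc by (simp add: algebra_simps del: index_mult_mat_vec)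
  qed (use A vc in simp)
  have key: "rank_one n y \<phi> \<in> ?T \<Longrightarrow> \<phi> \<bullet> v = 1 \<Longrightarrow> \<phi> \<in> carrier_vec n \<Longrightarrow> V \<in> carrier_mat n n \<Longrightarrow> y = V *\<^sub>v v \<Longrightarrow> V \<in> ?T" for V y \<phi>
  proof -
    assume R: "rank_one n y \<phi> \<in> ?T" and \<phi>: "\<phi> \<bullet> v = 1" "\<phi> \<in> carrier_vec n" and V: "V \<in> carrier_mat n n" "y = V *\<^sub>v v"
    have y: "y \<in> carrier_vec n" using V vc by simp
    have Ry: "rank_one n y \<phi> *\<^sub>v v = y" using rank_one_mult_vec[OF y \<phi>(2) vc] \<phi>(1) y by simp
    have "(V - rank_one n y \<phi>) *\<^sub>v v = 0\<^sub>v n"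
      using minus_mult_distrib_mat_vec[OF V(1) rank_one_carrier vc] V Ry y by simp
    then have "V - rank_one n y \<phi> \<in> ?T"
      by (rule tangent_if_kills_eigenvector[OF A vL v(2,3) minus_carrier_mat[OF rank_one_carrier]])
    then have "(V - rank_one n y \<phi>) + rank_one n y \<phi> \<in> ?T"
      using R subspace_cone_tangent_space unfolding subspace_mat_iff by blast
    moreover have "(V - rank_one n y \<phi>) + rank_one n y \<phi> = V"
      using V(1) by (intro eq_matI) (auto simp: rank_one_def)
    ultimately show "V \<in> ?T" by simp
  qed
  have two: "V \<in> ?T" if V: "V \<in> carrier_mat n n" and x: "x \<in> L" "x \<notin> range (\<lambda>c. c \<cdot>\<^sub>v v)" "A *\<^sub>v x = \<kappa> \<cdot>\<^sub>v x" for V x \<kappa>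
  proof -
    have xc: "x \<in> carrier_vec n" using x L_carrier[OF L] by blast
    have "x \<noteq> c \<cdot>\<^sub>v v" for c using x by blast
    then obtain \<phi> \<psi> where \<phi>: "\<phi> \<in> carrier_vec n" "\<phi> \<bullet> v = 1" "\<phi> \<bullet> x = 0" using dual_pair[OF vc v(2) xc] by metis
    have "0\<^sub>v n = 0 \<cdot>\<^sub>v v" using vc by (intro eq_vecI) auto
    then have x0: "x \<noteq> 0\<^sub>v n" using x(2) by auto
    have y: "V *\<^sub>v v \<in> carrier_vec n" using V vc by simp
    have "rank_one n (V *\<^sub>v v) \<phi> *\<^sub>v x = 0\<^sub>v n" unfolding rank_one_mult_vec[OF y \<phi>(1) xc] \<phi>(3) by (rule zero_smult_vec[OF y])
    then have "rank_one n (V *\<^sub>v v) \<phi> \<in> ?T" by (intro tangent_if_kills_eigenvector[OF A x(1) x0 x(3)]) auto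
    then show ?thesis using key \<phi> V by blast
  qed
  have "V \<in> ?T" if V: "V \<in> carrier_mat n n" for V
  \<comment> \<open>On the plane spanned by \<open>v\<close> and \<open>w\<close> the matrix is
    triangular with diagonal entries \<mu>, \<nu> and corner \<beta>; this condition says that it is
    a Jordan block.\<close>
  proof (cases "\<nu> = \<mu> \<and> \<beta> \<noteq> 0")
    case True
    define u where "u = inverse \<beta> \<cdot>\<^sub>v w"
    have uL: "u \<in> L" using w W L by (auto simp: u_def subspace_vec_iff)
    have uc: "u \<in> carrier_vec n" using wc by (simp add: u_def)
    have Au: "A *\<^sub>v u = \<mu> \<cdot>\<^sub>v u + v"
      unfolding u_def mult_mat_vec[OF A wc] Aw using True wc vc by (intro eq_vecI) (auto simp: field_simps)
    have "u \<noteq> c \<cdot>\<^sub>v v" for c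
    proof
      assume "u = c \<cdot>\<^sub>v v"
      then have "\<beta> \<cdot>\<^sub>v u = (\<beta> * c) \<cdot>\<^sub>v v" by (simp add: smult_smult_assoc)
      then have "w = (\<beta> * c) \<cdot>\<^sub>v v" using True by (simp add: u_def smult_smult_assoc)
      then show False using w(2) by blast
    qed
    then obtain \<phi> \<psi> where p: "\<phi> \<in> carrier_vec n" "\<psi> \<in> carrier_vec n" "\<phi> \<bullet> v = 1" "\<phi> \<bullet> u = 0" "\<psi> \<bullet> v = 0" "\<psi> \<bullet> u = 1"
      using dual_pair[OF vc v(2) uc] by metis
    have "rank_one n (V *\<^sub>v v) \<phi> \<in> ?T"
      by (rule jordan_block_tangent[OF A vL v(2,3) uL Au _ p]) (use V vc in auto)
    then show ?thesis using key p V by blast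
  next
    case False
    \<comment> \<open>Solves \<open>\<beta> + c \<mu> = \<nu> c\<close>, which makes
      \<open>w + c v\<close> an eigenvector. If \<nu> equals \<mu>, then \<beta> is 0 here and
      division by zero yields the correct value 0.\<close>
    define c where "c = \<beta> / (\<nu> - \<mu>)"
    define x where "x = w + c \<cdot>\<^sub>v v"
    have xL: "x \<in> L" using w W L vL by (auto simp: x_def subspace_vec_iff)
    have xn: "x \<notin> range (\<lambda>c. c \<cdot>\<^sub>v v)"
    proof
      assume "x \<in> range (\<lambda>c. c \<cdot>\<^sub>v v)"
      then obtain b where b: "x = b \<cdot>\<^sub>v v" by blast
      have "w = (b - c) \<cdot>\<^sub>v v"
      proof (rule eq_vecI)
        fix i assume "i < dim_vec ((b - c) \<cdot>\<^sub>v v)"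
        then have i: "i < n" using vc by simp
        have "x $ i = b * v $ i" using b i vc by simp
        then show "w $ i = ((b - c) \<cdot>\<^sub>v v) $ i" using i vc wc by (simp add: x_def algebra_simps)
      qed (use wc vc in simp)
      then show False using w(2) by blast
    qed
    have c: "\<beta> + c * \<mu> = \<nu> * c" using False by (cases "\<nu> = \<mu>") (auto simp: c_def field_simps)
    have "A *\<^sub>v x = A *\<^sub>v w + c \<cdot>\<^sub>v (A *\<^sub>v v)" unfolding x_def using A wc vc by (simp add: mult_add_distrib_mat_vec[OF A] mult_mat_vec[OF A])
    also have "\<dots> = \<nu> \<cdot>\<^sub>v x" unfolding Aw v(3)
    proof (rule eq_vecI)
      fix i assume "i < dim_vec (\<nu> \<cdot>\<^sub>v x)"
      then have i: "i < n" using vc by (simp add: x_def)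
      have "\<beta> * v $ i + c * (\<mu> * v $ i) = \<nu> * c * v $ i" unfolding c[symmetric] by (simp add: algebra_simps)
      then show "(\<nu> \<cdot>\<^sub>v w + \<beta> \<cdot>\<^sub>v v + c \<cdot>\<^sub>v (\<mu> \<cdot>\<^sub>v v)) $ i = (\<nu> \<cdot>\<^sub>v x) $ i"
        using i vc wc by (simp add: x_def algebra_simps)
    qed (use vc in \<open>simp add: x_def\<close>)
    finally show ?thesis using two[OF V xL xn] by blast
  qed
  then show ?thesis using subspace_cone_tangent_space unfolding subspace_mat_iff by blast
qed

end

section \<open>Generalised cross products\<close>

lemma det_zero_row:
  fixes N :: "'a::comm_ring_1 mat"
  assumes "N \<in> carrier_mat n n" "i < n" "\<And>j. j < n \<Longrightarrow> N $$ (i,j) = 0"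
  shows "det N = 0"
  unfolding laplace_expansion_row[OF assms(1,2)] using assms(3) by simp

text \<open>For \<open>n > 0\<close>, cofactors along the last row, that is the cross product of the
  first \<open>n - 1\<close> rows of \<open>N\<close>. It solves the linear system of these rows by
  polynomials in their entries.\<close>

definition cross_vec :: "nat \<Rightarrow> 'a::comm_ring_1 mat \<Rightarrow> 'a vec" where
  "cross_vec n N = vec n (\<lambda>j. cofactor N (n - 1) j)"

lemma cross_vec_carrier [simp]: "cross_vec n N \<in> carrier_vec n"
  by (simp add: cross_vec_def)

lemma dim_cross_vec [simp]: "dim_vec (cross_vec n N) = n"
  by (simp add: cross_vec_def)

text \<open>The cross product is the last column of the adjugate, and \<open>N\<close> times its
  adjugate is \<open>det N\<close>, which is 0 because of the zero row.\<close>

lemma cross_vec_kernel: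
  fixes N :: "'a::comm_ring_1 mat"
  assumes N: "N \<in> carrier_mat n n" "n > 0" and z: "\<And>j. j < n \<Longrightarrow> N $$ (n - 1, j) = 0"
  shows "N *\<^sub>v cross_vec n N = 0\<^sub>v n"
proof (rule eq_vecI)
  fix i assume "i < dim_vec (0\<^sub>v n)"
  then have i: "i < n" by simp
  have "det N = 0" by (rule det_zero_row[OF N(1) _ z]) (use N in auto)
  then have "(N * adj_mat N) $$ (i, n - 1) = 0" unfolding adj_mat(2)[OF N(1)] using i N by simp
  then have "(\<Sum>l<n. N $$ (i,l) * adj_mat N $$ (l, n - 1)) = 0"
    using mult_mat_entry[OF N(1) adj_mat(1)[OF N(1)] i, of "n - 1"] N by simp
  then show "(N *\<^sub>v cross_vec n N) $ i = 0\<^sub>v n $ i"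
    unfolding mult_mat_vec_entry[OF N(1) cross_vec_carrier i] using i N by (simp add: cross_vec_def adj_mat_def)
qed (use N in simp)

text \<open>Replacing the zero row of \<open>N\<close> by the \<open>p\<close>-th unit row gives a
  matrix \<open>M\<close> whose determinant is the \<open>p\<close>-th coordinate of the cross
  product, hence nonzero. The difference of the two sides is killed by \<open>M\<close>.\<close>

lemma cross_vec_unique:
  fixes N :: "'a::field mat"
  assumes N: "N \<in> carrier_mat n n" "n > 0" and z: "\<And>j. j < n \<Longrightarrow> N $$ (n - 1, j) = 0"
    and x: "x \<in> carrier_vec n" "N *\<^sub>v x = 0\<^sub>v n" and p: "p < n" "cross_vec n N $ p \<noteq> 0"
  shows "cross_vec n N $ p \<cdot>\<^sub>v x = x $ p \<cdot>\<^sub>v cross_vec n N"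
proof -
  let ?c = "cross_vec n N"
  define M where "M = mat n n (\<lambda>(i,j). if i = n - 1 then (if j = p then 1 else 0) else N $$ (i,j))"
  have M: "M \<in> carrier_mat n n" by (simp add: M_def)
  have cof: "cofactor M (n - 1) j = cofactor N (n - 1) j" for j
  proof -
    have "mat_delete M (n - 1) j = mat_delete N (n - 1) j"
      using N by (intro eq_matI) (auto simp: mat_delete_def M_def)
    then show ?thesis by (simp add: cofactor_def)
  qed
  have "det M = (\<Sum>j<n. M $$ (n - 1, j) * cofactor M (n - 1) j)"
    using N by (intro laplace_expansion_row[OF M]) simp
  also have "\<dots> = (\<Sum>j<n. if j = p then cofactor N (n - 1) p else 0)"
    unfolding cof using N by (intro sum.cong refl) (auto simp: M_def)
  also have "\<dots> = ?c $ p" using p by (simp add: cross_vec_def)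
  finally have det: "det M \<noteq> 0" using p by simp
  define y where "y = ?c $ p \<cdot>\<^sub>v x + (- x $ p) \<cdot>\<^sub>v ?c"
  have y: "y \<in> carrier_vec n" using x by (simp add: y_def)
  have Nc: "N *\<^sub>v ?c = 0\<^sub>v n" by (rule cross_vec_kernel[OF N z])
  have Ny: "N *\<^sub>v y = 0\<^sub>v n"
    unfolding y_def mult_add_distrib_mat_vec[OF N(1) smult_carrier_vec[THEN iffD2, OF x(1)] smult_carrier_vec[THEN iffD2, OF cross_vec_carrier]]
      mult_mat_vec[OF N(1) x(1)] mult_mat_vec[OF N(1) cross_vec_carrier] x(2) Nc
    by (intro eq_vecI) auto
  have "M *\<^sub>v y = 0\<^sub>v n"
  proof (rule eq_vecI)
    fix i assume "i < dim_vec (0\<^sub>v n)"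
    then have i: "i < n" by simp
    show "(M *\<^sub>v y) $ i = 0\<^sub>v n $ i"
    proof (cases "i = n - 1")
      case True
      have "(M *\<^sub>v y) $ i = (\<Sum>l<n. if l = p then y $ p else 0)"
        unfolding mult_mat_vec_entry[OF M y i] using True i by (intro sum.cong refl) (auto simp: M_def)
      also have "\<dots> = 0" using p x by (simp add: y_def mult.commute)
      finally show ?thesis using i by simp
    next
      case False
      have "(M *\<^sub>v y) $ i = (N *\<^sub>v y) $ i"
        unfolding mult_mat_vec_entry[OF M y i] mult_mat_vec_entry[OF N(1) y i]
        using False i by (intro sum.cong refl) (auto simp: M_def)
      then show ?thesis using Ny by simp
    qed
  qed (use M in simp)
  then have "y = 0\<^sub>v n" using det det_0_iff_vec_prod_zero_field[OF M] y by blast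
  then show ?thesis
    using add_smult_eq_zero_iff[of "?c $ p \<cdot>\<^sub>v x" n ?c "x $ p"] x unfolding y_def by simp
qed

lemma pick_omit:
  assumes "p < n" "b < n - 1"
  shows "pick ({..<n} - {p}) b = (if b < p then b else Suc b)"
proof -
  let ?J = "{..<n} - {p}" and ?x = "if b < p then b else Suc b"
  have "?x \<in> ?J" using assms by auto
  moreover have "{a \<in> ?J. a < ?x} = (if b < p then {..<b} else {..<Suc b} - {p})" using assms by auto
  then have "card {a \<in> ?J. a < ?x} = b" by auto
  ultimately show ?thesis using pick_card_in_set[of ?x ?J] by simp
qed

lemma card_nonempty_omit:
  assumes "J \<subseteq> {..<n}" "card J = n - 1" "n > 0"
  obtains p where "p < n" "J = {..<n} - {p}"
proof -
  have "card ({..<n} - J) = 1" using assms by (subst card_Diff_subset) (auto intro: finite_subset)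
  then obtain p where p: "{..<n} - J = {p}" using card_1_singletonE by blast
  then have "p < n" "J = {..<n} - {p}" using assms(1) by blast+
  then show ?thesis using that by blast
qed

lemma coeff_mult_1: "coeff (p * q) 1 = coeff p 0 * coeff q 1 + coeff p 1 * coeff (q :: 'a::comm_ring_1 poly) 0"
  by (simp add: coeff_mult)

context
  fixes C :: "'a::alg_closed_field mat" and m n d :: nat
  assumes C: "C \<in> carrier_mat m n"
begin

lemma kernel_subspace: "VectorSpace.subspace class_ring (mat_kernel C) (module_vec TYPE('a) n)"
  by (rule subspace_mat_kernel[OF C])

text \<open>Near \<open>A\<close> the eigenvector of a matrix \<open>B\<close> in the variety is the generalized cross product \<open>c(B)\<close> of \<open>n - 1\<close>
  rows of its Kalman matrix. Hence the equations \<open>C c(B) = 0\<close> and \<open>c(B) \<and> B c(B) = 0\<close>, which hold on the whole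
  variety, cut out its tangent space at \<open>A\<close>.\<close>

lemma tangent_imp_eigen:
  assumes A: "A \<in> carrier_mat n n" and n: "n > 0"
    and v: "v \<in> mat_kernel C" "v \<noteq> 0\<^sub>v n" "A *\<^sub>v v = \<mu> \<cdot>\<^sub>v v"
    and dim: "subspace_dim n (mat_kernel (kalman_matrix d C A)) = 1"
    and V: "V \<in> cone_tangent_space n (kalman_variety 1 n (mat_kernel C)) A"
  shows "\<exists>w\<in>mat_kernel C. \<exists>\<nu>. V *\<^sub>v v + A *\<^sub>v w = \<mu> \<cdot>\<^sub>v w + \<nu> \<cdot>\<^sub>v v"
proof -
  let ?X = "kalman_variety 1 n (mat_kernel C)"
  let ?R = "\<lambda>B. kalman_matrix d C B"
  note Rc = kalman_matrix_carrier[OF C, of _ d]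
  have Vc: "V \<in> carrier_mat n n" using V by (simp add: cone_tangent_space_def)
  have vc: "v \<in> carrier_vec n" using v mat_kernelD[OF C] by blast
  have "n - 1 \<le> mat_rank (?R A)" using rank_plus_nullity[OF Rc[OF A]] dim by simp
  then obtain I J where I: "I \<subseteq> {..<(d + 1) * m}" "card I = n - 1" and J: "J \<subseteq> {..<n}" "card J = n - 1"
    and minor: "det (submatrix (?R A) I J) \<noteq> 0"
    using minor_exists[OF Rc[OF A]] by metis
  obtain p where p: "p < n" "J = {..<n} - {p}" using card_nonempty_omit[OF J n] .
  have pI: "pick I a < (d + 1) * m" if "a < n - 1" for a using pick_in_set_le[of a I] that I by auto
  \<comment> \<open>The rows \<open>I\<close> of the Kalman matrix of \<open>B\<close>, completed by
    a zero row to a square matrix. The set \<open>I\<close> is chosen at \<open>A\<close> and then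
    kept for all \<open>B\<close>.\<close>
  define N where "N B = mat n n (\<lambda>(i,j). if i < n - 1 then ?R B $$ (pick I i, j) else 0)" for B
  have N: "N B \<in> carrier_mat n n" for B by (simp add: N_def)
  have Nz: "N B $$ (n - 1, j) = 0" if "j < n" for B j using that n by (simp add: N_def)
  define c where "c B = cross_vec n (N B)" for B
  have cc: "c B \<in> carrier_vec n" for B by (simp add: c_def)
  \<comment> \<open>Row \<open>pick I i\<close> lies in the block \<open>C B\<^sup>k\<close> with
    \<open>k = pick I i div m\<close> and has degree \<open>k\<close>; so all coordinates of the
    cross product are forms of the same degree \<open>e\<close>.\<close>
  define e where "e = (\<Sum>i<n - 1. pick I i div m)"
  have cpoly: "poly_fun n (hom_monomials n e) (\<lambda>B. c B $ j)" if j: "j < n" for j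
  proof -
    have "poly_fun n (hom_monomials n e) (\<lambda>B. det (mat_delete (N B) (n - 1) j))"
      unfolding e_def
    proof (rule hom_poly_fun_det)
      fix a b assume ab: "a < n - 1" "b < n - 1"
      define b' where "b' = (if b < j then b else Suc b)"
      have b': "b' < n" using ab by (auto simp: b'_def)
      have "m > 0" using pI[OF ab(1)] by (cases m) auto
      then have "poly_fun n (hom_monomials n (pick I a div m)) (\<lambda>B. (C * B ^\<^sub>m (pick I a div m)) $$ (pick I a mod m, b'))"
        using b' by (intro hom_poly_fun_kalman_entry[OF C]) auto
      moreover have "(C * B ^\<^sub>m (pick I a div m)) $$ (pick I a mod m, b') = mat_delete (N B) (n - 1) j $$ (a, b)"
        if B: "B \<in> carrier_mat n n" for B
        using kalman_matrix_index[OF C B pI[OF ab(1)] b'] ab b' by (simp add: mat_delete_def N_def b'_def)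
      ultimately show "poly_fun n (hom_monomials n (pick I a div m)) (\<lambda>B. mat_delete (N B) (n - 1) j $$ (a, b))"
        by (rule poly_fun_cong)
    qed (rule mat_delete_carrier[OF N])
    then have "poly_fun n (hom_monomials n e) (\<lambda>B. (-1) ^ (n - 1 + j) * det (mat_delete (N B) (n - 1) j))"
      by (rule hom_poly_fun_cmult)
    then show ?thesis using j by (simp add: c_def cross_vec_def cofactor_def)
  qed
  \<comment> \<open>Up to sign this is the nonvanishing minor with rows \<open>I\<close> and all
    columns except \<open>p\<close>.\<close>
  have cpA: "c A $ p \<noteq> 0"
  proof -
    have sets: "{i. i < (d + 1) * m \<and> i \<in> I} = I" "{j. j < n \<and> j \<in> J} = J" using I J by auto
    have car: "submatrix (?R A) I J \<in> carrier_mat (n - 1) (n - 1)"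
      unfolding submatrix_def carrier_matD[OF Rc[OF A]] sets I J by simp
    have "mat_delete (N A) (n - 1) p = submatrix (?R A) I J"
    proof (rule eq_matI)
      fix a b assume "a < dim_row (submatrix (?R A) I J)" "b < dim_col (submatrix (?R A) I J)"
      then have ab: "a < n - 1" "b < n - 1" using car by auto
      have "card {i. i < dim_row (?R A) \<and> i \<in> I} = n - 1" "card {j. j < dim_col (?R A) \<and> j \<in> J} = n - 1"
        by (simp_all only: carrier_matD[OF Rc[OF A]] sets I J)
      then have "submatrix (?R A) I J $$ (a,b) = ?R A $$ (pick I a, pick J b)"
        using ab by (intro submatrix_index) auto
      also have "pick J b = (if b < p then b else Suc b)" unfolding p(2) by (rule pick_omit[OF p(1) ab(2)])
      finally show "mat_delete (N A) (n - 1) p $$ (a, b) = submatrix (?R A) I J $$ (a, b)"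
        using ab p by (simp add: mat_delete_def N_def)
    qed (use car N[of A] in auto)
    then show ?thesis using minor p by (simp add: c_def cross_vec_def cofactor_def)
  qed
  have Nker: "N B *\<^sub>v u = 0\<^sub>v n" if B: "B \<in> carrier_mat n n" and u: "u \<in> mat_kernel C" "B *\<^sub>v u = \<rho> \<cdot>\<^sub>v u" for B u \<rho>
  proof -
    have uc: "u \<in> carrier_vec n" using u mat_kernelD[OF C] by blast
    have "range (\<lambda>c. c \<cdot>\<^sub>v u) \<subseteq> mat_kernel C" using u kernel_subspace by (auto simp: subspace_vec_iff)
    moreover have "\<forall>x\<in>range (\<lambda>c. c \<cdot>\<^sub>v u). B *\<^sub>v x \<in> range (\<lambda>c. c \<cdot>\<^sub>v u)"
      using eigenvector_smult[OF B uc u(2)] by (auto simp: smult_smult_assoc)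
    ultimately have "range (\<lambda>c. c \<cdot>\<^sub>v u) \<subseteq> mat_kernel (?R B)" by (rule invariant_subset_kernel_kalman_matrix[OF C B])
    moreover have "u = 1 \<cdot>\<^sub>v u" using uc by simp
    ultimately have "u \<in> mat_kernel (?R B)" by blast
    then have Ru: "?R B *\<^sub>v u = 0\<^sub>v ((d + 1) * m)" using mat_kernelD[OF Rc[OF B]] by blast
    show ?thesis
    proof (rule eq_vecI)
      fix i assume "i < dim_vec (0\<^sub>v n)"
      then have i: "i < n" by simp
      show "(N B *\<^sub>v u) $ i = 0\<^sub>v n $ i"
      proof (cases "i < n - 1")
        case True
        have "(N B *\<^sub>v u) $ i = (?R B *\<^sub>v u) $ (pick I i)"
          unfolding mult_mat_vec_entry[OF N uc i] mult_mat_vec_entry[OF Rc[OF B] uc pI[OF True]]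
          using True i by (intro sum.cong refl) (simp add: N_def)
        then show ?thesis using Ru pI[OF True] i by simp
      next
        case False
        then show ?thesis unfolding mult_mat_vec_entry[OF N uc i] using i by (auto simp: N_def intro!: sum.neutral)
      qed
    qed (use N[of B] in simp)
  qed
  have mult: "c B $ q \<cdot>\<^sub>v u = u $ q \<cdot>\<^sub>v c B"
    if B: "B \<in> carrier_mat n n" and u: "u \<in> mat_kernel C" "B *\<^sub>v u = \<rho> \<cdot>\<^sub>v u" and q: "q < n" "c B $ q \<noteq> 0" for B u \<rho> q
    unfolding c_def
    by (rule cross_vec_unique[OF N n Nz _ Nker[OF B u] q(1)]) (use q u mat_kernelD[OF C] in \<open>auto simp: c_def\<close>)
  \<comment> \<open>Either \<open>c B\<close> is 0 and the equations are trivial, or it is a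
    multiple of every eigenvector of \<open>B\<close> in \<open>L\<close>. They thus hold on all of
    the cone, as is required for testing tangent vectors.\<close>
  have eqs: "C *\<^sub>v c B = 0\<^sub>v m \<and> (\<exists>\<rho>. B *\<^sub>v c B = \<rho> \<cdot>\<^sub>v c B)" if B: "B \<in> cone n ?X" for B
  proof (cases "c B = 0\<^sub>v n")
    case True
    have Bc: "B \<in> carrier_mat n n" using B by (rule cone_carrier)
    have "B *\<^sub>v 0\<^sub>v n = 0 \<cdot>\<^sub>v 0\<^sub>v n" unfolding mult_mat_zero_vec[OF Bc] by auto
    then show ?thesis using True mult_mat_zero_vec[OF C] by auto
  next
    case False
    have Bc: "B \<in> carrier_mat n n" using B by (rule cone_carrier)
    obtain q where q: "q < n" "c B $ q \<noteq> 0" using vec_nonzero_index[OF cc False] .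
    obtain u \<rho> where u: "u \<in> mat_kernel C" "u \<noteq> 0\<^sub>v n" "B *\<^sub>v u = \<rho> \<cdot>\<^sub>v u"
      using B unfolding cone_kalman_variety_1[OF kernel_subspace] by blast
    have uc: "u \<in> carrier_vec n" using u mat_kernelD[OF C] by blast
    note eq = mult[OF Bc u(1,3) q]
    have "u $ q \<noteq> 0"
    proof
      assume "u $ q = 0"
      then have "c B $ q \<cdot>\<^sub>v u = 0\<^sub>v n" using eq zero_smult_vec[OF cc] by simp
      then have "inverse (c B $ q) \<cdot>\<^sub>v (c B $ q \<cdot>\<^sub>v u) = 0\<^sub>v n" by auto
      then show False using q u by (simp add: smult_smult_assoc)
    qed
    then have "c B = (inverse (u $ q) * c B $ q) \<cdot>\<^sub>v u"
      using arg_cong[OF eq, of "\<lambda>x. inverse (u $ q) \<cdot>\<^sub>v x"] by (simp add: smult_smult_assoc)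
    then obtain k where cu: "c B = k \<cdot>\<^sub>v u" by blast
    have "c B \<in> mat_kernel C" unfolding cu using u kernel_subspace by (auto simp: subspace_vec_iff)
    moreover have "B *\<^sub>v c B = \<rho> \<cdot>\<^sub>v c B" unfolding cu by (rule eigenvector_smult[OF Bc uc u(3)])
    ultimately show ?thesis using mat_kernelD[OF C] by blast
  qed
  define a where "a = c A"
  have a: "a \<in> carrier_vec n" "a $ p \<noteq> 0" using cpA cc by (auto simp: a_def)
  have av: "a = (inverse (v $ p) * a $ p) \<cdot>\<^sub>v v" and vp: "v $ p \<noteq> 0"
  proof -
    note eq = mult[OF A v(1,3) p(1) cpA]
    show vp: "v $ p \<noteq> 0"
    proof
      assume "v $ p = 0"
      then have "c A $ p \<cdot>\<^sub>v v = 0\<^sub>v n" using eq zero_smult_vec[OF cc] by simp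
      then have "inverse (c A $ p) \<cdot>\<^sub>v (c A $ p \<cdot>\<^sub>v v) = 0\<^sub>v n" by auto
      then show False using cpA v by (simp add: smult_smult_assoc)
    qed
    then show "a = (inverse (v $ p) * a $ p) \<cdot>\<^sub>v v"
      using arg_cong[OF eq, of "\<lambda>x. inverse (v $ p) \<cdot>\<^sub>v x"] by (simp add: smult_smult_assoc a_def)
  qed
  define \<kappa> where "\<kappa> = inverse (v $ p) * a $ p"
  have \<kappa>: "\<kappa> \<noteq> 0" "a = \<kappa> \<cdot>\<^sub>v v" using vp a(2) av by (auto simp: \<kappa>_def)
  have Aa: "A *\<^sub>v a = \<mu> \<cdot>\<^sub>v a" unfolding \<kappa>(2) by (rule eigenvector_smult[OF A vc v(3)])
  have "\<forall>k<n. \<exists>f. f \<in> homogeneous_polys n \<and> (\<forall>B\<in>carrier_mat n n. peval f B = c B $ k)"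
    using poly_fun_homogeneous[OF cpoly] by blast
  then obtain f where f: "\<And>k. k < n \<Longrightarrow> f k \<in> homogeneous_polys n"
    "\<And>k B. k < n \<Longrightarrow> B \<in> carrier_mat n n \<Longrightarrow> peval (f k) B = c B $ k" by metis
  define X where "X = (\<lambda>x. [:A $$ x, V $$ x:])"
  define q where "q k = curve.eval (f k) X" for k
  have pq: "poly (q k) t = c (curve_mat n X t) $ k" if "k < n" for k t
    unfolding q_def peval_curve_mat[OF f(1)[OF that], symmetric] using f(2)[OF that] by simp
  \<comment> \<open>The derivative of the cross product along the line \<open>A + t V\<close> at
    \<open>t = 0\<close>; \<open>a\<close> is its value there. Up to scaling, \<open>b\<close>
    becomes the required vector \<open>w\<close>.\<close>
  define b where "b = vec n (\<lambda>k. coeff (q k) 1)"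
  have b: "b \<in> carrier_vec n" by (simp add: b_def)
  have qa: "coeff (q k) 0 = a $ k" if "k < n" for k
  proof -
    have "curve_mat n X 0 = A" using A by (intro eq_matI) (auto simp: curve_mat_def X_def)
    then show ?thesis using pq[OF that, of 0] by (simp add: a_def poly_0_coeff_0)
  qed
  \<comment> \<open>The way tangency is used: the restriction \<open>Q\<close> of a form that
    vanishes on the cone to the line \<open>A + t V\<close> has no linear term.\<close>
  have deriv: "coeff Q 1 = 0" if g: "poly_fun n (hom_monomials n e') g" "\<And>B. B \<in> cone n ?X \<Longrightarrow> g B = 0"
    and Q: "\<And>t. poly Q t = g (curve_mat n X t)" for g e' Q
  proof -
    obtain h where h: "h \<in> homogeneous_polys n" "\<forall>B\<in>carrier_mat n n. peval h B = g B"
      using poly_fun_homogeneous[OF g(1)] by blast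
    have hv: "h \<in> vanishing_polys n ?X" unfolding vanishing_polys_iff using h g(2) cone_carrier by metis
    have "Q = curve.eval h X"
    proof -
      have "poly (Q - curve.eval h X) t = 0" for t
        using Q[of t] peval_curve_mat[OF h(1), of X t] h(2) by simp
      then have "Q - curve.eval h X = 0" using poly_eq_0_if_cofinite[of "{}"] by blast
      then show ?thesis by simp
    qed
    then have "coeff Q 1 = (\<Sum>x\<in>{..<n} \<times> {..<n}. peval (partial x h) A * V $$ x)"
      using coeff_1_line[OF h(1), of A V] by (simp add: X_def)
    also have "\<dots> = 0" using V hv by (auto simp: cone_tangent_space_def)
    finally show ?thesis .
  qed
  have Cb: "b \<in> mat_kernel C"
  proof (rule mat_kernelI[OF C b], rule eq_vecI)
    fix i assume "i < dim_vec (0\<^sub>v m)"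
    then have i: "i < m" by simp
    have "coeff (\<Sum>k<n. Polynomial.smult (C $$ (i,k)) (q k)) 1 = 0"
    proof (rule deriv)
      show "poly_fun n (hom_monomials n e) (\<lambda>B. \<Sum>k<n. C $$ (i,k) * c B $ k)"
        by (intro poly_fun_sum hom_poly_fun_cmult cpoly) simp
      show "(\<Sum>k<n. C $$ (i,k) * c B $ k) = 0" if "B \<in> cone n ?X" for B
        using eqs[OF that] mult_mat_vec_entry[OF C cc i, of B] i by simp
      show "poly (\<Sum>k<n. Polynomial.smult (C $$ (i,k)) (q k)) t = (\<Sum>k<n. C $$ (i,k) * c (curve_mat n X t) $ k)" for t
        by (simp add: poly_sum pq)
    qed
    then have "(\<Sum>k<n. C $$ (i,k) * b $ k) = 0" by (simp add: coeff_sum b_def)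
    then show "(C *\<^sub>v b) $ i = 0\<^sub>v m $ i" using mult_mat_vec_entry[OF C b i] i by simp
  qed (use C in simp)
  define y where "y = V *\<^sub>v a + A *\<^sub>v b"
  have y: "y \<in> carrier_vec n" using A Vc a b by (simp add: y_def)
  have yi: "y $ i = (\<Sum>k<n. V $$ (i,k) * a $ k) + (\<Sum>k<n. A $$ (i,k) * b $ k)" if i: "i < n" for i
  proof -
    have "y $ i = (V *\<^sub>v a) $ i + (A *\<^sub>v b) $ i" unfolding y_def using i A by (intro index_add_vec) simp
    then show ?thesis using mult_mat_vec_entry[OF Vc a(1) i] mult_mat_vec_entry[OF A b i] by simp
  qed
  define S where "S i = (\<Sum>k<n. X (i,k) * q k)" for i
  have S0: "coeff (S i) 0 = \<mu> * a $ i" if i: "i < n" for i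
  proof -
    have "coeff (S i) 0 = (\<Sum>k<n. A $$ (i,k) * a $ k)" by (simp add: S_def coeff_sum coeff_mult_0 X_def qa)
    then show ?thesis using mult_mat_vec_entry[OF A a(1) i] Aa i a by simp
  qed
  have S1: "coeff (S i) 1 = y $ i" if i: "i < n" for i
    unfolding yi[OF i] S_def coeff_sum sum.distrib[symmetric]
    by (intro sum.cong refl) (simp only: coeff_mult_1 lessThan_iff, simp add: X_def qa b_def)
  \<comment> \<open>The linear coefficient of the 2 by 2 minors of the matrix with columns
    \<open>c(B)\<close> and \<open>B c(B)\<close> along the line.\<close>
  have rel: "a $ i * y $ j + b $ i * (\<mu> * a $ j) - (a $ j * y $ i + b $ j * (\<mu> * a $ i)) = 0" if ij: "i < n" "j < n" for i j
  proof -
    have "coeff (q i * S j - q j * S i) 1 = 0"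
    proof (rule deriv)
      have "poly_fun n (hom_monomials n (e + (1 + e))) (\<lambda>B. c B $ i * (\<Sum>k<n. B $$ (j,k) * c B $ k) + (-1) * (c B $ j * (\<Sum>k<n. B $$ (i,k) * c B $ k)))"
        by (intro poly_fun_add hom_poly_fun_cmult hom_poly_fun_mult poly_fun_sum cpoly hom_poly_fun_entry) (use ij in auto)
      then show "poly_fun n (hom_monomials n (e + (1 + e))) (\<lambda>B. c B $ i * (\<Sum>k<n. B $$ (j,k) * c B $ k) - c B $ j * (\<Sum>k<n. B $$ (i,k) * c B $ k))"
        by simp
      show "c B $ i * (\<Sum>k<n. B $$ (j,k) * c B $ k) - c B $ j * (\<Sum>k<n. B $$ (i,k) * c B $ k) = 0" if B: "B \<in> cone n ?X" for B
      proof -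
        obtain \<rho> where "B *\<^sub>v c B = \<rho> \<cdot>\<^sub>v c B" using eqs[OF B] by blast
        then have "(\<Sum>k<n. B $$ (l,k) * c B $ k) = \<rho> * c B $ l" if "l < n" for l
          using mult_mat_vec_entry[OF cone_carrier[OF B] cc that, of B] that carrier_vecD[OF cc[of B]] by simp
        then show ?thesis using ij by simp
      qed
      show "poly (q i * S j - q j * S i) t = c (curve_mat n X t) $ i * (\<Sum>k<n. curve_mat n X t $$ (j,k) * c (curve_mat n X t) $ k)
          - c (curve_mat n X t) $ j * (\<Sum>k<n. curve_mat n X t $$ (i,k) * c (curve_mat n X t) $ k)" for t
      proof -
        have "poly (S l) t = (\<Sum>k<n. curve_mat n X t $$ (l,k) * c (curve_mat n X t) $ k)" if "l < n" for l
          unfolding S_def poly_sum using that by (intro sum.cong refl) (simp add: pq, simp add: curve_mat_def)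
        then show ?thesis using ij by (simp add: pq)
      qed
    qed
    then show ?thesis
      unfolding coeff_diff coeff_mult_1 using ij by (simp only: qa S0 S1, simp add: b_def)
  qed
  \<comment> \<open>By \<open>rel\<close>, \<open>y - \<mu> b\<close> is proportional to
    \<open>a\<close>; the ratio is read off at the coordinate \<open>p\<close>, where
    \<open>a\<close> does not vanish.\<close>
  define \<nu> where "\<nu> = (y $ p - \<mu> * b $ p) / a $ p"
  have y_eq: "y = \<mu> \<cdot>\<^sub>v b + \<nu> \<cdot>\<^sub>v a"
  proof (rule eq_vecI)
    fix j assume "j < dim_vec (\<mu> \<cdot>\<^sub>v b + \<nu> \<cdot>\<^sub>v a)"
    then have j: "j < n" using a by simp
    have "a $ p * (y $ j - \<mu> * b $ j) = a $ j * (y $ p - \<mu> * b $ p)" using rel[OF p(1) j] by (simp add: algebra_simps)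
    then have "y $ j - \<mu> * b $ j = \<nu> * a $ j" using a(2) by (simp add: \<nu>_def field_simps)
    then show "y $ j = (\<mu> \<cdot>\<^sub>v b + \<nu> \<cdot>\<^sub>v a) $ j" using j a b by (simp add: algebra_simps)
  qed (use a y in simp)
  define w where "w = inverse \<kappa> \<cdot>\<^sub>v b"
  have w: "w \<in> mat_kernel C" using Cb kernel_subspace by (auto simp: w_def subspace_vec_iff)
  have "V *\<^sub>v v + A *\<^sub>v w = inverse \<kappa> \<cdot>\<^sub>v y"
  proof -
    have "v = inverse \<kappa> \<cdot>\<^sub>v a" using \<kappa> by (simp add: smult_smult_assoc)
    then have "V *\<^sub>v v + A *\<^sub>v w = inverse \<kappa> \<cdot>\<^sub>v (V *\<^sub>v a) + inverse \<kappa> \<cdot>\<^sub>v (A *\<^sub>v b)"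
      unfolding w_def using mult_mat_vec[OF Vc a(1)] mult_mat_vec[OF A b] by metis
    also have "\<dots> = inverse \<kappa> \<cdot>\<^sub>v y" unfolding y_def
      by (rule smult_add_distrib_vec[symmetric, of _ n]) (use A Vc a b in auto)
    finally show ?thesis .
  qed
  also have "\<dots> = \<mu> \<cdot>\<^sub>v w + \<nu> \<cdot>\<^sub>v v"
    unfolding y_eq w_def using \<kappa> b vc by (intro eq_vecI) (auto simp: field_simps)
  finally show ?thesis using w by blast
qed

end

section \<open>Dimensions of spaces of matrices and of the tangent spaces\<close>

lemma module_mat_fin_dim_dim:
  "vectorspace.fin_dim class_ring (module_mat TYPE('a::field) n m) \<and>
   vectorspace.dim class_ring (module_mat TYPE('a) n m) = n * m"
proof -
  let ?V = "module_vec TYPE('a) (n * m)" and ?U = "module_mat TYPE('a) n m"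
  define T where "T v = mat n m (\<lambda>(i,j). v $ (i * m + j))" for v :: "'a vec"
  interpret V: vectorspace class_ring ?V by (rule vec_vs)
  interpret U: vectorspace class_ring ?U by (rule matrix_vs)
  have idx: "i * m + j < n * m" if "i < n" "j < m" for i j
  proof -
    have "i * m + j < (i + 1) * m" using that by simp
    also have "\<dots> \<le> n * m" using that by (intro mult_right_mono) auto
    finally show ?thesis .
  qed
  interpret lm: linear_map class_ring ?V ?U T
    by unfold_locales (use idx in \<open>auto simp: mod_hom_axioms_def module_hom_def module_vec_simps module_mat_simps class_ring_simps T_def\<close>)
  have surj: "T ` carrier ?V = carrier ?U"
  proof (intro equalityI subsetI)
    fix M assume "M \<in> carrier ?U"
    then have M: "M \<in> carrier_mat n m" by (simp add: module_mat_simps)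
    have "T (vec (n * m) (\<lambda>k. M $$ (k div m, k mod m))) = M"
    proof (rule eq_matI)
      fix i j assume "i < dim_row M" "j < dim_col M"
      then have ij: "i < n" "j < m" using M by auto
      then show "T (vec (n * m) (\<lambda>k. M $$ (k div m, k mod m))) $$ (i,j) = M $$ (i,j)"
        using idx[OF ij] by (simp add: T_def)
    qed (use M in \<open>auto simp: T_def\<close>)
    then show "M \<in> T ` carrier ?V"
      by (intro image_eqI[of M T "vec (n * m) (\<lambda>k. M $$ (k div m, k mod m))"]) (simp_all add: module_vec_simps)
  qed (auto simp: T_def module_mat_simps)
  have inj: "inj_on T (carrier ?V)"
  proof (rule inj_onI)
    fix x y assume xy: "x \<in> carrier ?V" "y \<in> carrier ?V" "T x = T y"
    then have c: "x \<in> carrier_vec (n * m)" "y \<in> carrier_vec (n * m)" by (auto simp: module_vec_simps)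
    show "x = y"
    proof (rule eq_vecI)
      fix k assume "k < dim_vec y"
      then have k: "k < n * m" using c by simp
      then have m: "m > 0" by (cases m) auto
      have "k div m < n" using k by (simp add: less_mult_imp_div_less)
      then have "T x $$ (k div m, k mod m) = x $ k" "T y $$ (k div m, k mod m) = y $ k" using m by (auto simp: T_def)
      then show "x $ k = y $ k" using xy by simp
    qed (use c in simp)
  qed
  have "U.fin_dim" by (rule lm.surj_fin_dim[OF vec_fin_dim surj])
  moreover have "V.dim = U.dim" by (rule lm.dim_eq[OF vec_fin_dim inj surj])
  moreover have "V.dim = n * m"
  proof -
    interpret vec_space "TYPE('a)" "n * m" .
    show ?thesis by (rule dim_is_n)
  qed
  ultimately show ?thesis by simp
qed

lemma mat_carrier_update: "(module_mat TYPE('a::semiring_1) n m)\<lparr>carrier := carrier_mat n m\<rparr> = module_mat TYPE('a) n m"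
  by (simp add: module_mat_def)

text \<open>Rank-nullity for evaluation at \<open>v\<close>: rank one matrices show that it maps
  onto \<open>S\<close>, and its kernel is the same for every \<open>S\<close>. Comparison with the
  case where \<open>S\<close> is the whole space, with preimage of dimension \<open>n * n\<close>,
  eliminates the kernel.\<close>

lemma dim_mats_mapping_into:
  fixes v :: "'a::field vec"
  assumes v: "v \<in> carrier_vec n" "v \<noteq> 0\<^sub>v n" and S: "VectorSpace.subspace class_ring S (module_vec TYPE('a) n)"
  shows "vectorspace.dim class_ring ((module_mat TYPE('a) n n)\<lparr>carrier := {V \<in> carrier_mat n n. V *\<^sub>v v \<in> S}\<rparr>) + n
    = n * n + subspace_dim n S"
proof -
  let ?dim = "\<lambda>X. vectorspace.dim class_ring ((module_mat TYPE('a) n n)\<lparr>carrier := X\<rparr>)"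
  let ?E = "\<lambda>S. {V \<in> carrier_mat n n. V *\<^sub>v v \<in> S}"
  obtain \<phi> where \<phi>: "\<phi> \<in> carrier_vec n" "\<phi> \<bullet> v = 1" using dual_functional[OF v] .
  have main: "subspace_dim n S + ?dim {V \<in> carrier_mat n n. V *\<^sub>v v = 0\<^sub>v n} = ?dim (?E S)"
    if S: "VectorSpace.subspace class_ring S (module_vec TYPE('a) n)" for S
  proof -
    have S': "S \<subseteq> carrier_vec n" "0\<^sub>v n \<in> S" "\<And>v w. v \<in> S \<Longrightarrow> w \<in> S \<Longrightarrow> v + w \<in> S" "\<And>c v. v \<in> S \<Longrightarrow> c \<cdot>\<^sub>v v \<in> S"
      using S by (auto simp: subspace_vec_iff)
    have add: "(V + W) *\<^sub>v v = V *\<^sub>v v + W *\<^sub>v v" if "V \<in> carrier_mat n n" "W \<in> carrier_mat n n" for V W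
      using that v(1) by (rule add_mult_distrib_mat_vec)
    have smult: "(c \<cdot>\<^sub>m V) *\<^sub>v v = c \<cdot>\<^sub>v (V *\<^sub>v v)" if "V \<in> carrier_mat n n" for c V
      by (rule smult_mat_mult_vec[OF that v(1)])
    have "0\<^sub>m n n *\<^sub>v v = 0\<^sub>v n" using v by (intro eq_vecI) auto
    then have E: "VectorSpace.subspace class_ring (?E S) (module_mat TYPE('a) n n)"
      unfolding subspace_mat_iff using S' by (auto simp: add smult)
    have img: "(\<lambda>V. V *\<^sub>v v) ` ?E S = S"
    proof (intro equalityI subsetI)
      fix y assume y: "y \<in> S"
      then have yc: "y \<in> carrier_vec n" using S' by blast
      have "rank_one n y \<phi> *\<^sub>v v = y" using rank_one_mult_vec[OF yc \<phi>(1) v(1)] \<phi>(2) yc by simp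
      then show "y \<in> (\<lambda>V. V *\<^sub>v v) ` ?E S" using y by (intro image_eqI[of _ _ "rank_one n y \<phi>"]) auto
    qed auto
    have ker: "{V \<in> ?E S. V *\<^sub>v v = 0\<^sub>v n} = {V \<in> carrier_mat n n. V *\<^sub>v v = 0\<^sub>v n}" using S' by auto
    have "vectorspace.dim class_ring ((module_vec TYPE('a) n)\<lparr>carrier := (\<lambda>V. V *\<^sub>v v) ` ?E S\<rparr>)
      + ?dim {V \<in> ?E S. V *\<^sub>v v = \<zero>\<^bsub>module_vec TYPE('a) n\<^esub>} = ?dim (?E S)"
      by (rule rank_nullity_sub[OF matrix_vs _ E vec_vs])
        (use module_mat_fin_dim_dim in \<open>auto simp: module_vec_simps module_mat_simps add smult subsetD[OF S'(1)]\<close>)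
    then show ?thesis by (simp only: img module_vec_simps ker subspace_dim_def)
  qed
  have "?E (carrier_vec n) = carrier_mat n n" using v by auto
  then have "?dim (?E (carrier_vec n)) = n * n" using module_mat_fin_dim_dim[where 'a='a, of n n] by (simp only: mat_carrier_update)
  then show ?thesis using main[OF S] main[OF subspace_carrier_vec] by simp
qed

context
  fixes C :: "'a::alg_closed_field mat" and m n d :: nat and A :: "'a mat"
  assumes C: "C \<in> carrier_mat m n" and dimC: "subspace_dim n (mat_kernel C) = d" and A: "A \<in> carrier_mat n n"
begin

lemma kernel_kalman_subset: "mat_kernel (kalman_matrix d C A) \<subseteq> mat_kernel C"
proof
  fix v assume "v \<in> mat_kernel (kalman_matrix d C A)"
  then have "v \<in> carrier_vec n" "A ^\<^sub>m 0 *\<^sub>v v \<in> mat_kernel C" unfolding kernel_kalman_matrix[OF C A] by blast+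
  then show "v \<in> mat_kernel C" using A by simp
qed

lemma cone_tangent_dim_singular:
  assumes "2 \<le> subspace_dim n (mat_kernel (kalman_matrix d C A))"
  shows "cone_tangent_dim n (kalman_variety 1 n (mat_kernel C)) A = n * n"
proof -
  have "cone_tangent_space n (kalman_variety 1 n (mat_kernel C)) A = carrier_mat n n"
    by (rule tangent_space_eq_carrier[OF kernel_subspace[OF C] A subspace_mat_kernel[OF kalman_matrix_carrier[OF C A]]
          kernel_kalman_subset _ assms])
      (use kernel_kalman_matrix_invariant[OF C A] dimC in auto)
  then show ?thesis unfolding cone_tangent_dim_def using module_mat_fin_dim_dim[where 'a='a, of n n] by (simp only: mat_carrier_update)
qed

text \<open>The tangent condition on \<open>V\<close> is linear in \<open>V v\<close>: this vector
  has to lie in a subspace \<open>S\<close>, the image of \<open>L\<close> under an injective map.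
  So \<open>S\<close> has dimension \<open>d\<close>, and matrices sending \<open>v\<close> into it
  are counted.\<close>

lemma cone_tangent_dim_regular:
  assumes dim: "subspace_dim n (mat_kernel (kalman_matrix d C A)) = 1"
  shows "cone_tangent_dim n (kalman_variety 1 n (mat_kernel C)) A + n = n * n + d"
proof -
  let ?K = "mat_kernel (kalman_matrix d C A)" and ?L = "mat_kernel C"
  let ?T = "cone_tangent_space n (kalman_variety 1 n ?L) A"
  note L = kernel_subspace[OF C]
  have K: "VectorSpace.subspace class_ring ?K (module_vec TYPE('a) n)"
    by (rule subspace_mat_kernel[OF kalman_matrix_carrier[OF C A]])
  have Kinv: "\<forall>v\<in>?K. A *\<^sub>v v \<in> ?K" using kernel_kalman_matrix_invariant[OF C A] dimC by simp
  obtain v \<mu> where v: "v \<in> ?K" "v \<noteq> 0\<^sub>v n" "A *\<^sub>v v = \<mu> \<cdot>\<^sub>v v"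
    using exists_eigenvector[OF A K Kinv] dim by auto
  have vL: "v \<in> ?L" using v kernel_kalman_subset by blast
  have vc: "v \<in> carrier_vec n" using vL mat_kernelD[OF C] by blast
  have n: "n > 0" using vec_nonzero_index[OF vc v(2)] by (metis gr_zeroI not_less_zero)
  obtain \<phi> where \<phi>: "\<phi> \<in> carrier_vec n" "\<phi> \<bullet> v = 1" using dual_functional[OF vc v(2)] .
  have Kline: "\<exists>c. w = c \<cdot>\<^sub>v v" if w: "w \<in> ?K" for w
  proof (rule ccontr)
    assume "\<not> ?thesis"
    then have ind: "w \<noteq> c \<cdot>\<^sub>v v" for c by blast
    have wc: "w \<in> carrier_vec n" using w K by (auto simp: subspace_vec_iff)
    obtain \<phi> \<psi> where p: "\<phi> \<in> carrier_vec n" "\<psi> \<in> carrier_vec n" "\<phi> \<bullet> v = 1" "\<phi> \<bullet> w = 0" "\<psi> \<bullet> v = 0" "\<psi> \<bullet> w = 1"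
      using dual_pair[OF vc v(2) wc ind] .
    define T where "T = mat n 2 (\<lambda>(i,j). if j = 0 then v $ i else w $ i)"
    have T: "T \<in> carrier_mat n 2" by (simp add: T_def)
    have Tx: "T *\<^sub>v x = x $ 0 \<cdot>\<^sub>v v + x $ 1 \<cdot>\<^sub>v w" if x: "x \<in> carrier_vec 2" for x
    proof (rule eq_vecI)
      fix i assume "i < dim_vec (x $ 0 \<cdot>\<^sub>v v + x $ 1 \<cdot>\<^sub>v w)"
      then have i: "i < n" using wc by simp
      have "{..<2::nat} = {0, 1}" by auto
      then show "(T *\<^sub>v x) $ i = (x $ 0 \<cdot>\<^sub>v v + x $ 1 \<cdot>\<^sub>v w) $ i"
        unfolding mult_mat_vec_entry[OF T x i] using i vc wc by (simp add: T_def mult.commute)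
    qed (use wc T in simp)
    have "2 \<le> subspace_dim n ?K"
    proof (rule subspace_dim_ge[OF T K])
      fix x :: "'a vec" assume x: "x \<in> carrier_vec 2"
      show "T *\<^sub>v x \<in> ?K" unfolding Tx[OF x] using v w K by (auto simp: subspace_vec_iff)
      assume "T *\<^sub>v x = 0\<^sub>v n"
      then have z: "x $ 0 \<cdot>\<^sub>v v + x $ 1 \<cdot>\<^sub>v w = 0\<^sub>v n" using Tx[OF x] by simp
      have "f \<bullet> (x $ 0 \<cdot>\<^sub>v v + x $ 1 \<cdot>\<^sub>v w) = x $ 0 * (f \<bullet> v) + x $ 1 * (f \<bullet> w)" if "f \<in> carrier_vec n" for f
        using that vc wc by (simp add: scalar_prod_add_distrib[of _ n])
      from this[OF p(1)] this[OF p(2)] have "x $ 0 = 0" "x $ 1 = 0" unfolding z using p by auto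
      then have "x $ i = 0" if "i < 2" for i using that by (metis less_2_cases One_nat_def)
      then show "x = 0\<^sub>v 2" using x by (intro eq_vecI) auto
    qed
    then show False using dim by simp
  qed
  \<comment> \<open>The rank one summand absorbs the free multiple of \<open>v\<close> in the
    tangent condition: the vectors \<open>\<mu> w + \<nu> v - A w\<close> with \<open>w\<close> in
    \<open>L\<close> form exactly the image of \<open>L\<close> under \<open>B\<close>.\<close>
  define B where "B = A + (- \<mu>) \<cdot>\<^sub>m 1\<^sub>m n + rank_one n v \<phi>"
  have B: "B \<in> carrier_mat n n" using A by (simp add: B_def)
  have Bx: "B *\<^sub>v x = A *\<^sub>v x + (- \<mu>) \<cdot>\<^sub>v x + (\<phi> \<bullet> x) \<cdot>\<^sub>v v" if x: "x \<in> carrier_vec n" for x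
  proof -
    have "B *\<^sub>v x = (A + (- \<mu>) \<cdot>\<^sub>m 1\<^sub>m n) *\<^sub>v x + rank_one n v \<phi> *\<^sub>v x"
      unfolding B_def using A x by (intro add_mult_distrib_mat_vec[of _ n n]) auto
    also have "(A + (- \<mu>) \<cdot>\<^sub>m 1\<^sub>m n) *\<^sub>v x = A *\<^sub>v x + ((- \<mu>) \<cdot>\<^sub>m 1\<^sub>m n) *\<^sub>v x"
      using A x by (intro add_mult_distrib_mat_vec[of _ n n]) auto
    also have "((- \<mu>) \<cdot>\<^sub>m 1\<^sub>m n) *\<^sub>v x = (- \<mu>) \<cdot>\<^sub>v x" using smult_mat_mult_vec[OF one_carrier_mat x, of "- \<mu>"] x by simp
    finally show ?thesis using rank_one_mult_vec[OF vc \<phi>(1) x] by simp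
  qed
  have Binj: "x = 0\<^sub>v n" if x: "x \<in> ?L" "B *\<^sub>v x = 0\<^sub>v n" for x
  proof -
    have xc: "x \<in> carrier_vec n" using x mat_kernelD[OF C] by blast
    have Ax: "A *\<^sub>v x = \<mu> \<cdot>\<^sub>v x + (- (\<phi> \<bullet> x)) \<cdot>\<^sub>v v"
    proof (rule eq_vecI)
      fix i assume "i < dim_vec (\<mu> \<cdot>\<^sub>v x + (- (\<phi> \<bullet> x)) \<cdot>\<^sub>v v)"
      then have i: "i < n" using vc by simp
      have "(B *\<^sub>v x) $ i = (A *\<^sub>v x) $ i + - \<mu> * x $ i + (\<phi> \<bullet> x) * v $ i"
        unfolding Bx[OF xc] using i vc xc A by (simp del: index_mult_mat_vec)
      then show "(A *\<^sub>v x) $ i = (\<mu> \<cdot>\<^sub>v x + (- (\<phi> \<bullet> x)) \<cdot>\<^sub>v v) $ i"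
        unfolding x(2) using i xc vc by (simp add: algebra_simps del: index_mult_mat_vec)
    qed (use A vc in simp)
    \<comment> \<open>\<open>B x = 0\<close> means
      \<open>A x = \<mu> x - (\<phi> \<bullet> x) v\<close>, so \<open>v\<close> and
      \<open>x\<close> span an invariant subspace of \<open>L\<close>. It lies in the
      one-dimensional \<open>?K\<close>, which makes \<open>x\<close> a multiple of
      \<open>v\<close>.\<close>
    define W where "W = {a \<cdot>\<^sub>v v + b \<cdot>\<^sub>v x | a b. True}"
    have "W \<subseteq> ?L" using vL x L by (auto simp: W_def subspace_vec_iff)
    moreover have "\<forall>w\<in>W. A *\<^sub>v w \<in> W"
    proof
      fix w assume "w \<in> W"
      then obtain a b where w: "w = a \<cdot>\<^sub>v v + b \<cdot>\<^sub>v x" by (auto simp: W_def)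
      have "A *\<^sub>v w = a \<cdot>\<^sub>v (A *\<^sub>v v) + b \<cdot>\<^sub>v (A *\<^sub>v x)"
        unfolding w using A vc xc by (simp add: mult_add_distrib_mat_vec[OF A] mult_mat_vec[OF A])
      also have "\<dots> = (a * \<mu> - b * (\<phi> \<bullet> x)) \<cdot>\<^sub>v v + (b * \<mu>) \<cdot>\<^sub>v x"
        unfolding v(3) Ax using vc xc by (intro eq_vecI) (auto simp: algebra_simps)
      finally show "A *\<^sub>v w \<in> W" by (auto simp: W_def)
    qed
    ultimately have "W \<subseteq> ?K" by (rule invariant_subset_kernel_kalman_matrix[OF C A])
    moreover have "x = 0 \<cdot>\<^sub>v v + 1 \<cdot>\<^sub>v x" using vc xc by (intro eq_vecI) auto
    then have "x \<in> W" unfolding W_def by blast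
    ultimately obtain c where c: "x = c \<cdot>\<^sub>v v" using Kline by blast
    have "A *\<^sub>v x = \<mu> \<cdot>\<^sub>v x" unfolding c by (rule eigenvector_smult[OF A vc v(3)])
    then have "B *\<^sub>v x = c \<cdot>\<^sub>v v" unfolding Bx[OF xc] using c \<phi> vc by (intro eq_vecI) auto
    then show ?thesis using c x(2) by simp
  qed
  define S where "S = (\<lambda>x. B *\<^sub>v x) ` ?L"
  have S: "VectorSpace.subspace class_ring S (module_vec TYPE('a) n)" unfolding S_def by (rule subspace_image[OF B L])
  have dimS: "subspace_dim n S = d" unfolding S_def using subspace_dim_inj_image[OF B L Binj] dimC by simp
  have "?T = {V \<in> carrier_mat n n. V *\<^sub>v v \<in> S}"
  proof (intro equalityI subsetI)
    fix V assume V: "V \<in> ?T"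
    then have Vc: "V \<in> carrier_mat n n" by (simp add: cone_tangent_space_def)
    obtain w \<nu> where w: "w \<in> ?L" "V *\<^sub>v v + A *\<^sub>v w = \<mu> \<cdot>\<^sub>v w + \<nu> \<cdot>\<^sub>v v"
      using tangent_imp_eigen[OF C A n vL v(2,3) dim V] by blast
    have wc: "w \<in> carrier_vec n" using w mat_kernelD[OF C] by blast
    \<comment> \<open>The multiple of \<open>v\<close> is chosen such that \<phi> takes the value
      \<nu> on \<open>x\<close>; the two contributions of \<open>v\<close> with factor \<mu> then
      cancel in \<open>B x\<close>.\<close>
    define x where "x = (- 1) \<cdot>\<^sub>v w + (\<nu> + \<phi> \<bullet> w) \<cdot>\<^sub>v v"
    have x: "x \<in> ?L" using w vL L by (auto simp: x_def subspace_vec_iff)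
    have xc: "x \<in> carrier_vec n" using x mat_kernelD[OF C] by blast
    have "\<phi> \<bullet> x = \<nu>" unfolding x_def using \<phi> wc vc by (simp add: scalar_prod_add_distrib[of _ n])
    moreover have "A *\<^sub>v x = (- 1) \<cdot>\<^sub>v (A *\<^sub>v w) + (\<nu> + \<phi> \<bullet> w) \<cdot>\<^sub>v (\<mu> \<cdot>\<^sub>v v)"
      unfolding x_def v(3)[symmetric] using A vc wc by (simp add: mult_add_distrib_mat_vec[OF A] mult_mat_vec[OF A])
    ultimately have Bxx: "B *\<^sub>v x = (- 1) \<cdot>\<^sub>v (A *\<^sub>v w) + (\<nu> + \<phi> \<bullet> w) \<cdot>\<^sub>v (\<mu> \<cdot>\<^sub>v v) + (- \<mu>) \<cdot>\<^sub>v x + \<nu> \<cdot>\<^sub>v v"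
      using Bx[OF xc] by simp
    have "V *\<^sub>v v = B *\<^sub>v x"
    proof (rule eq_vecI)
      fix i assume "i < dim_vec (B *\<^sub>v x)"
      then have i: "i < n" using B by simp
      have "(V *\<^sub>v v) $ i + (A *\<^sub>v w) $ i = (V *\<^sub>v v + A *\<^sub>v w) $ i" using i A by (intro index_add_vec[symmetric]) simp
      then have e: "(V *\<^sub>v v) $ i + (A *\<^sub>v w) $ i = \<mu> * w $ i + \<nu> * v $ i" unfolding w(2) using i vc wc by simp
      have "(B *\<^sub>v x) $ i = - (A *\<^sub>v w) $ i + (\<nu> + \<phi> \<bullet> w) * (\<mu> * v $ i) - \<mu> * x $ i + \<nu> * v $ i"
        unfolding Bxx using i vc xc A by (simp del: index_mult_mat_vec)
      also have "x $ i = - w $ i + (\<nu> + \<phi> \<bullet> w) * v $ i" using i vc wc by (simp add: x_def)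
      finally have "(B *\<^sub>v x) $ i = \<mu> * w $ i + \<nu> * v $ i - (A *\<^sub>v w) $ i" by (simp add: algebra_simps del: index_mult_mat_vec)
      then show "(V *\<^sub>v v) $ i = (B *\<^sub>v x) $ i" unfolding e[symmetric] by simp
    qed (use B Vc in simp)
    then show "V \<in> {V \<in> carrier_mat n n. V *\<^sub>v v \<in> S}" using x Vc by (auto simp: S_def)
  next
    fix V assume "V \<in> {V \<in> carrier_mat n n. V *\<^sub>v v \<in> S}"
    then obtain x where V: "V \<in> carrier_mat n n" and x: "x \<in> ?L" "V *\<^sub>v v = B *\<^sub>v x" by (auto simp: S_def)
    have xc: "x \<in> carrier_vec n" using x mat_kernelD[OF C] by blast
    define w where "w = (- 1) \<cdot>\<^sub>v x"
    have w: "w \<in> ?L" using x L by (auto simp: w_def subspace_vec_iff)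
    have "V *\<^sub>v v + A *\<^sub>v w = \<mu> \<cdot>\<^sub>v w + (\<phi> \<bullet> x) \<cdot>\<^sub>v v"
    proof (rule eq_vecI)
      fix i assume "i < dim_vec (\<mu> \<cdot>\<^sub>v w + (\<phi> \<bullet> x) \<cdot>\<^sub>v v)"
      then have i: "i < n" using vc by simp
      have "(V *\<^sub>v v + A *\<^sub>v w) $ i = (B *\<^sub>v x) $ i + (A *\<^sub>v w) $ i" unfolding x(2) using i A by (intro index_add_vec) simp
      also have "(A *\<^sub>v w) $ i = - (A *\<^sub>v x) $ i" unfolding w_def mult_mat_vec[OF A xc] using i A by (simp del: index_mult_mat_vec)
      also have "(B *\<^sub>v x) $ i = (A *\<^sub>v x) $ i + - \<mu> * x $ i + (\<phi> \<bullet> x) * v $ i"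
        unfolding Bx[OF xc] using i vc xc A by (simp del: index_mult_mat_vec)
      finally show "(V *\<^sub>v v + A *\<^sub>v w) $ i = (\<mu> \<cdot>\<^sub>v w + (\<phi> \<bullet> x) \<cdot>\<^sub>v v) $ i"
        using i xc vc by (simp add: w_def del: index_mult_mat_vec index_add_vec, simp)
    qed (use A vc in simp)
    then show "V \<in> ?T" by (rule eigen_tangent[OF L A vL v(2,3) w V])
  qed
  then show ?thesis unfolding cone_tangent_dim_def using dim_mats_mapping_into[OF vc v(2) S] dimS by simp
qed

end

section \<open>Hilbert functions and lengths of chains\<close>

text \<open>A lower bound for the Hilbert function of \<open>S\<close>.\<close>

definition independent_forms :: "nat \<Rightarrow> 'a::field mat set \<Rightarrow> nat \<Rightarrow> nat \<Rightarrow> bool" where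
  "independent_forms n S e k \<longleftrightarrow> (\<exists>G. (\<forall>i<k. poly_fun n (hom_monomials n e) (G i)) \<and>
     (\<forall>c. (\<forall>A\<in>S. (\<Sum>i<k. c i * G i A) = 0) \<longrightarrow> (\<forall>i<k. c i = 0)))"

lemma independent_forms_mono:
  assumes "independent_forms n S e k" "S \<subseteq> S'" "k' \<le> k"
  shows "independent_forms n S' e k'"
proof -
  obtain G where G: "\<forall>i<k. poly_fun n (hom_monomials n e) (G i)"
    "\<And>c. \<forall>A\<in>S. (\<Sum>i<k. c i * G i A) = 0 \<Longrightarrow> \<forall>i<k. c i = 0"
    using assms(1) unfolding independent_forms_def by blast
  have "\<forall>i<k'. c i = 0" if c: "\<forall>A\<in>S'. (\<Sum>i<k'. c i * G i A) = 0" for c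
  proof -
    let ?c = "\<lambda>i. if i < k' then c i else 0"
    have "(\<Sum>i<k. ?c i * G i A) = (\<Sum>i<k'. c i * G i A)" for A
      using assms(3) by (intro sum.mono_neutral_cong_right) auto
    then have z: "\<forall>i<k. ?c i = 0" using c assms(2) by (intro G(2)) auto
    show ?thesis
    proof (intro allI impI)
      fix i assume "i < k'"
      then show "c i = 0" using z[rule_format, of i] assms(3) by simp
    qed
  qed
  then show ?thesis unfolding independent_forms_def using G(1) assms(3) by (intro exI[of _ G]) auto
qed

lemma independent_forms_1:
  assumes "A \<in> S" "A \<in> nonzero_mats n"
  shows "independent_forms n S e 1"
proof -
  have A: "A \<in> carrier_mat n n" "A \<noteq> 0\<^sub>m n n" using assms(2) by (auto simp: nonzero_mats_def)
  have "\<exists>i<n. \<exists>j<n. A $$ (i,j) \<noteq> 0"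
  proof (rule ccontr)
    assume "\<not> ?thesis"
    then have "A = 0\<^sub>m n n" using A(1) by (intro eq_matI) auto
    then show False using A(2) by simp
  qed
  then obtain i j where ij: "i < n" "j < n" "A $$ (i,j) \<noteq> 0" by blast
  have "poly_fun n (hom_monomials n (1 * e)) (\<lambda>A. A $$ (i,j) ^ e)"
    by (intro hom_poly_fun_power hom_poly_fun_entry ij)
  then show ?thesis unfolding independent_forms_def
    using assms(1) ij(3) by (intro exI[of _ "\<lambda>_ A. A $$ (i,j) ^ e"]) auto
qed

lemma poly_fun_lincomb:
  assumes "\<And>i. i < k \<Longrightarrow> poly_fun n (hom_monomials n e) (G i)"
  shows "poly_fun n (hom_monomials n e) (\<lambda>A. \<Sum>i<k. c i * G i A)"
  using assms by (intro poly_fun_sum hom_poly_fun_cmult) auto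

lemma irreducible_poly_fun_mult:
  assumes irr: "proj_irreducible n Z" and G: "poly_fun n (hom_monomials n e) G" and H: "poly_fun n (hom_monomials n e') H"
    and z: "\<And>X. X \<in> cone n Z \<Longrightarrow> G X * H X = 0" and A: "A \<in> cone n Z" "G A \<noteq> 0" and B: "B \<in> cone n Z"
  shows "H B = 0"
proof (rule ccontr)
  assume HB: "H B \<noteq> 0"
  obtain g where g: "g \<in> homogeneous_polys n" "\<forall>A\<in>carrier_mat n n. peval g A = G A" using poly_fun_homogeneous[OF G] by blast
  obtain h where h: "h \<in> homogeneous_polys n" "\<forall>A\<in>carrier_mat n n. peval h A = H A" using poly_fun_homogeneous[OF H] by blast
  have "peval g A \<noteq> 0" "peval h B \<noteq> 0" using A B HB g h cone_carrier by metis+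
  then obtain X where X: "X \<in> cone n Z" "peval g X \<noteq> 0" "peval h X \<noteq> 0"
    using proj_irreducible_mult[OF irr g(1) h(1) A(1) _ B] by blast
  then show False using z[OF X(1)] g(2) h(2) cone_carrier[OF X(1)] by auto
qed

text \<open>On \<open>Z\<close> a relation loses its multiples of \<open>f\<close>, so its first
  \<open>k\<close> coefficients vanish. What remains is a multiple of \<open>f\<close>, and
  \<open>f\<close> can be cancelled on the irreducible \<open>Z'\<close> because it does not vanish
  there identically.\<close>

lemma independent_forms_step:
  assumes irr: "proj_irreducible n Z'" and sub: "cone n Z \<subseteq> cone n Z'"
    and f: "poly_fun n (hom_monomials n a) f" "\<And>A. A \<in> cone n Z \<Longrightarrow> f A = 0" and A: "A \<in> cone n Z'" "f A \<noteq> 0"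
    and k: "independent_forms n (cone n Z) (a + e) k" and l: "independent_forms n (cone n Z') e l"
  shows "independent_forms n (cone n Z') (a + e) (k + l)"
proof -
  obtain G where G: "\<And>i. i < k \<Longrightarrow> poly_fun n (hom_monomials n (a + e)) (G i)"
    "\<And>c. \<forall>A\<in>cone n Z. (\<Sum>i<k. c i * G i A) = 0 \<Longrightarrow> \<forall>i<k. c i = 0"
    using k unfolding independent_forms_def by blast
  obtain H where H: "\<And>i. i < l \<Longrightarrow> poly_fun n (hom_monomials n e) (H i)"
    "\<And>c. \<forall>A\<in>cone n Z'. (\<Sum>i<l. c i * H i A) = 0 \<Longrightarrow> \<forall>i<l. c i = 0"
    using l unfolding independent_forms_def by blast
  define J where "J i = (if i < k then G i else (\<lambda>A. f A * H (i - k) A))" for i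
  have split: "(\<Sum>i<k + l. c i * J i A) = (\<Sum>i<k. c i * G i A) + f A * (\<Sum>i<l. c (k + i) * H i A)" for c A
  proof -
    have "(\<Sum>i<k + l. c i * J i A) = (\<Sum>i<k. c i * J i A) + (\<Sum>i<l. c (k + i) * J (k + i) A)"
      by (induction l) (auto simp: add.assoc)
    also have "(\<Sum>i<k. c i * J i A) = (\<Sum>i<k. c i * G i A)" by (intro sum.cong refl) (simp add: J_def)
    also have "(\<Sum>i<l. c (k + i) * J (k + i) A) = f A * (\<Sum>i<l. c (k + i) * H i A)"
      unfolding sum_distrib_left by (intro sum.cong refl) (simp add: J_def mult.left_commute)
    finally show ?thesis .
  qed
  have "\<forall>i<k + l. c i = 0" if c: "\<forall>A\<in>cone n Z'. (\<Sum>i<k + l. c i * J i A) = 0" for c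
  proof -
    have "\<forall>A\<in>cone n Z. (\<Sum>i<k. c i * G i A) = 0" using c sub f(2) unfolding split by fastforce
    then have c1: "\<forall>i<k. c i = 0" by (rule G(2))
    then have z: "f X * (\<Sum>i<l. c (k + i) * H i X) = 0" if "X \<in> cone n Z'" for X
      using c that unfolding split by fastforce
    have "(\<Sum>i<l. c (k + i) * H i X) = 0" if "X \<in> cone n Z'" for X
      by (rule irreducible_poly_fun_mult[OF irr f(1) poly_fun_lincomb[OF H(1)] z A that])
    then have "\<forall>i<l. c (k + i) = 0" by (intro H(2)) blast
    then show ?thesis using c1 by (metis add_diff_inverse_nat nat_add_left_cancel_less)
  qed
  moreover have "poly_fun n (hom_monomials n (a + e)) (J i)" if "i < k + l" for i
    using G(1) hom_poly_fun_mult[OF f(1) H(1)] that by (cases "i < k") (auto simp: J_def)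
  ultimately show ?thesis unfolding independent_forms_def by blast
qed

lemma irreducible_cone_nonempty:
  assumes "proj_irreducible n Z"
  obtains A where "A \<in> cone n Z" "A \<in> nonzero_mats n"
proof -
  have "proj_closed n Z" "Z \<noteq> {}" using assms by (auto simp: proj_irreducible_def)
  then have "cone n Z \<noteq> {}" using proj_closed_image_cone by blast
  then show ?thesis using that by (auto simp: cone_def)
qed

text \<open>Let \<open>f\<close> be a form of degree \<open>b\<close> vanishing on \<open>Z\<^sub>k\<close> but not on \<open>Z\<^sub>k\<^sub>+\<^sub>1\<close>. Forms that are independent on \<open>Z\<^sub>k\<close>, together with
  the products with \<open>f\<close> of forms that are independent on \<open>Z\<^sub>k\<^sub>+\<^sub>1\<close>, are independent on \<open>Z\<^sub>k\<^sub>+\<^sub>1\<close>; summing up gives the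
  binomial coefficient by Pascal's rule.\<close>

lemma chain_independent_forms:
  assumes "\<And>i. i \<le> k \<Longrightarrow> proj_irreducible n (Z i)" and "\<And>i. i < k \<Longrightarrow> Z i \<subset> Z (Suc i)"
  shows "\<exists>a\<ge>1. \<forall>m. independent_forms n (cone n (Z k)) (a * m) ((m + k) choose k)"
  using assms
proof (induction k)
  case 0
  obtain A where "A \<in> cone n (Z 0)" "A \<in> nonzero_mats n" using irreducible_cone_nonempty 0 by blast
  then show ?case using independent_forms_1 by (intro exI[of _ 1]) auto
next
  case (Suc k)
  then obtain a where a: "a \<ge> 1" "\<And>m. independent_forms n (cone n (Z k)) (a * m) ((m + k) choose k)" by auto
  have irr: "proj_irreducible n (Z k)" "proj_irreducible n (Z (Suc k))" and lt: "Z k \<subset> Z (Suc k)" using Suc.prems by auto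
  have cl: "proj_closed n (Z k)" "proj_closed n (Z (Suc k))" using irr by (auto simp: proj_irreducible_def)
  obtain F where F: "F \<subseteq> homogeneous_polys n" "Z k = proj_zeros n F" using cl(1) unfolding proj_closed_def by blast
  have "\<not> cone n (Z (Suc k)) \<subseteq> cone n (Z k)" using subset_if_cone_subset[OF cl(2)] lt by blast
  then obtain A f where A: "A \<in> cone n (Z (Suc k))" and f: "f \<in> F" "peval f A \<noteq> 0"
    unfolding F(2) cone_proj_zeros[OF F(1)] by (auto simp: cone_def)
  have f0: "peval f B = 0" if "B \<in> cone n (Z k)" for B using that f(1) unfolding F(2) cone_proj_zeros[OF F(1)] by blast
  have "f \<in> homogeneous_polys n" using f F by blast
  then obtain b where b: "poly_fun n (hom_monomials n b) (peval f)" by (rule homogeneous_poly_fun)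
  \<comment> \<open>A form of degree 0 takes the same value everywhere, but \<open>f\<close>
    vanishes on \<open>Z k\<close> and not at \<open>A\<close>.\<close>
  have "b \<noteq> 0"
  proof
    assume "b = 0"
    obtain B where B: "B \<in> cone n (Z k)" using irreducible_cone_nonempty[OF irr(1)] .
    have "peval f (0 \<cdot>\<^sub>m B) = peval f B" "peval f (0 \<cdot>\<^sub>m A) = peval f A"
      using poly_fun_smult[OF b, of _ 0] cone_carrier[OF A] cone_carrier[OF B] \<open>b = 0\<close> by simp_all
    moreover have "0 \<cdot>\<^sub>m B = 0 \<cdot>\<^sub>m A" using cone_carrier[OF A] cone_carrier[OF B] by (intro eq_matI) auto
    ultimately show False using f(2) f0[OF B] by simp
  qed
  \<comment> \<open>The forms on \<open>Z k\<close> are available in degrees divisible by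
    \<open>a\<close>, while \<open>f\<close> has degree \<open>b\<close>; the power of degree
    \<open>b * a\<close> makes the degrees compatible. On \<open>Z k\<close> the hypothesis is used
    at \<open>b * Suc m\<close>, which gives even more forms than Pascal's rule requires.\<close>
  have fa: "poly_fun n (hom_monomials n (b * a)) (\<lambda>B. peval f B ^ a)" by (rule hom_poly_fun_power[OF b])
  have "independent_forms n (cone n (Z (Suc k))) (b * a * m) ((m + Suc k) choose Suc k)" for m
  proof (induction m)
    case 0
    have "A \<in> nonzero_mats n" using A by (simp add: cone_def)
    then show ?case using independent_forms_1[OF A] by simp
  next
    case (Suc m)
    have "independent_forms n (cone n (Z k)) (a * (b * Suc m)) ((b * Suc m + k) choose k)" by (rule a(2))
    moreover have "(Suc m + k) choose k \<le> (b * Suc m + k) choose k"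
    proof (rule binomial_right_mono)
      have "1 * Suc m \<le> b * Suc m" using \<open>b \<noteq> 0\<close> by (intro mult_right_mono) auto
      then show "Suc m + k \<le> b * Suc m + k" by simp
    qed
    ultimately have 1: "independent_forms n (cone n (Z k)) (b * a + b * a * m) ((Suc m + k) choose k)"
      by (auto intro: independent_forms_mono simp: algebra_simps)
    have "independent_forms n (cone n (Z (Suc k))) (b * a + b * a * m) (((Suc m + k) choose k) + ((m + Suc k) choose Suc k))"
    proof (rule independent_forms_step[OF irr(2) _ fa _ A _ 1 Suc])
      show "cone n (Z k) \<subseteq> cone n (Z (Suc k))" using lt by (intro cone_mono) blast
    qed (use f f0 a in auto)
    then show ?case by simp
  qed
  moreover have "b * a \<ge> 1" using \<open>b \<noteq> 0\<close> a(1) by simp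
  ultimately show ?case by blast
qed

section \<open>Growth of binomial coefficients and polynomials of bounded degree in each
  variable\<close>

lemma binomial_lower_bound: "(m + 1) ^ r \<le> fact r * ((m + r) choose r)"
proof (induction r)
  case (Suc r)
  have "(m + 1) ^ Suc r \<le> (m + r + 1) * (fact r * ((m + r) choose r))"
    using Suc by (simp only: power_Suc) (intro mult_mono; simp)
  also have "\<dots> = fact r * (Suc (m + r) * ((m + r) choose r))" by (simp add: algebra_simps)
  also have "\<dots> = fact r * (Suc r * (Suc (m + r) choose Suc r))" by (simp only: Suc_times_binomial_eq mult.commute)
  also have "\<dots> = fact (Suc r) * ((m + Suc r) choose Suc r)" by (simp add: algebra_simps)
  finally show ?case .
qed simp

text \<open>If \<open>k > D\<close>, the left side is at least
  \<open>(m + 1)\<^sup>D\<^sup>+\<^sup>1\<close> divided by the factorial of \<open>D + 1\<close>.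
  After cancelling \<open>(m + 1)\<^sup>D\<close> this bounds \<open>m + 1\<close> by a constant,
  which is refuted by taking that constant for \<open>m\<close>.\<close>

lemma growth_degree:
  assumes "\<And>m. (m + k) choose k \<le> (a * m + 1) ^ D" and a: "a \<ge> 1"
  shows "k \<le> D"
proof (rule ccontr)
  assume "\<not> k \<le> D"
  then have k: "Suc D \<le> k" by simp
  have "m + 1 \<le> fact (Suc D) * a ^ D" for m
  proof -
    have "(m + Suc D) choose m \<le> (m + k) choose m" using k by (intro binomial_right_mono) simp
    then have le: "(m + Suc D) choose Suc D \<le> (m + k) choose k"
      using binomial_symmetric[of m "m + Suc D"] binomial_symmetric[of m "m + k"] by simp
    have "(m + 1) ^ D * (m + 1) \<le> fact (Suc D) * ((m + Suc D) choose Suc D)"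
      using binomial_lower_bound[of m "Suc D"] by (simp add: mult.commute)
    also have "\<dots> \<le> fact (Suc D) * (a * m + 1) ^ D"
      using le assms(1)[of m] by (intro mult_left_mono) (auto intro: order_trans)
    also have "\<dots> \<le> fact (Suc D) * (a * (m + 1)) ^ D"
      using a by (intro mult_left_mono power_mono) auto
    also have "\<dots> = (m + 1) ^ D * (fact (Suc D) * a ^ D)" by (simp only: power_mult_distrib ac_simps)
    finally show ?thesis by (simp only: mult_le_cancel1) simp
  qed
  from this[of "fact (Suc D) * a ^ D"] show False by simp
qed

text \<open>The bound concerns each exponent separately and not the total degree. The number of such
  monomials is a plain power, and forms pull back well along maps that are affine in each
  parameter.\<close>

definition bounded_monomials :: "(nat \<times> nat) set \<Rightarrow> nat \<Rightarrow> (nat \<times> nat \<Rightarrow>\<^sub>0 nat) set" where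
  "bounded_monomials I e = {m. Poly_Mapping.keys m \<subseteq> I \<and> (\<forall>x. Poly_Mapping.lookup m x \<le> e)}"

lemma bounded_monomials_add:
  assumes "m \<in> bounded_monomials I e" "m' \<in> bounded_monomials I e'"
  shows "m + m' \<in> bounded_monomials I (e + e')"
  using assms keys_add[of m m'] by (fastforce simp: bounded_monomials_def lookup_add intro: add_mono)

lemma bounded_monomials_card:
  assumes "finite I"
  shows "finite (bounded_monomials I e)" "card (bounded_monomials I e) \<le> (e + 1) ^ card I"
proof -
  let ?r = "\<lambda>m. restrict (Poly_Mapping.lookup m) I"
  have inj: "inj_on ?r (bounded_monomials I e)"
  proof (rule inj_onI, rule poly_mapping_eqI)
    fix m m' x assume m: "m \<in> bounded_monomials I e" "m' \<in> bounded_monomials I e" "?r m = ?r m'"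
    show "Poly_Mapping.lookup m x = Poly_Mapping.lookup m' x"
    proof (cases "x \<in> I")
      case True
      then show ?thesis using fun_cong[OF m(3), of x] by simp
    next
      case False
      then have "x \<notin> Poly_Mapping.keys m" "x \<notin> Poly_Mapping.keys m'" using m(1,2) by (auto simp: bounded_monomials_def)
      then show ?thesis by (simp add: in_keys_iff)
    qed
  qed
  have img: "?r ` bounded_monomials I e \<subseteq> PiE I (\<lambda>_. {..e})" by (auto simp: bounded_monomials_def)
  have fin: "finite (PiE I (\<lambda>_. {..e}))" using assms by (intro finite_PiE) auto
  show "finite (bounded_monomials I e)" using finite_imageD[OF finite_subset[OF img fin] inj] .
  show "card (bounded_monomials I e) \<le> (e + 1) ^ card I"
    using card_inj_on_le[OF inj img fin] assms by (simp add: card_PiE)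
qed

lemma bounded_poly_fun_power:
  assumes "poly_fun n (bounded_monomials I 1) G"
  shows "poly_fun n (bounded_monomials I k) (\<lambda>A. G A ^ k)"
proof (induction k)
  case 0
  show ?case by (simp, rule poly_fun_const) (simp add: bounded_monomials_def)
next
  case (Suc k)
  have "poly_fun n (bounded_monomials I (1 + k)) (\<lambda>A. G A * G A ^ k)"
    by (rule poly_fun_mult[OF assms Suc bounded_monomials_add])
  then show ?case by simp
qed

lemma bounded_poly_fun_prod:
  assumes "finite S" "\<And>i. i \<in> S \<Longrightarrow> poly_fun n (bounded_monomials I (e i)) (G i)"
  shows "poly_fun n (bounded_monomials I (sum e S)) (\<lambda>A. \<Prod>i\<in>S. G i A)"
  using assms
proof (induction S)
  case empty
  show ?case by (simp, rule poly_fun_const) (simp add: bounded_monomials_def)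
next
  case (insert i S)
  have "poly_fun n (bounded_monomials I (e i + sum e S)) (\<lambda>A. G i A * (\<Prod>i\<in>S. G i A))"
    using insert by (intro poly_fun_mult[OF _ _ bounded_monomials_add]) auto
  then show ?case using insert by simp
qed

lemma poly_fun_cmult:
  assumes "poly_fun n M G"
  shows "poly_fun n M (\<lambda>A. c * G A)"
  by (rule poly_fun_mult[OF poly_fun_const[of "{0}"] assms]) auto

text \<open>A monomial of degree \<open>e\<close> is a product of \<open>e\<close> entries, and each
  entry of \<Gamma> contributes at most 1 to every exponent.\<close>

lemma poly_fun_compose:
  assumes G: "poly_fun n (hom_monomials n e) G"
    and \<Gamma>: "\<And>i j. i < n \<Longrightarrow> j < n \<Longrightarrow> poly_fun n (bounded_monomials I 1) (\<lambda>Y. \<Gamma> Y $$ (i,j))"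
    and \<Gamma>c: "\<And>Y. Y \<in> carrier_mat n n \<Longrightarrow> \<Gamma> Y \<in> carrier_mat n n"
  shows "poly_fun n (bounded_monomials I e) (\<lambda>Y. G (\<Gamma> Y))"
proof -
  obtain f where f: "Poly_Mapping.keys f \<subseteq> hom_monomials n e" "\<forall>A\<in>carrier_mat n n. peval f A = G A"
    using G unfolding poly_fun_def by blast
  have "poly_fun n (bounded_monomials I e) (\<lambda>Y. \<Sum>m\<in>Poly_Mapping.keys f. Poly_Mapping.lookup f m * monomial_value m (\<lambda>x. \<Gamma> Y $$ x))"
  proof (intro poly_fun_sum poly_fun_cmult)
    fix m assume "m \<in> Poly_Mapping.keys f"
    then have m: "m \<in> hom_monomials n e" using f(1) by blast
    then have "poly_fun n (bounded_monomials I (\<Sum>x\<in>Poly_Mapping.keys m. Poly_Mapping.lookup m x)) (\<lambda>Y. \<Prod>x\<in>Poly_Mapping.keys m. \<Gamma> Y $$ x ^ Poly_Mapping.lookup m x)"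
      using \<Gamma> by (intro bounded_poly_fun_prod bounded_poly_fun_power) (auto simp: hom_monomials_def subset_iff)
    then show "poly_fun n (bounded_monomials I e) (\<lambda>Y. monomial_value m (\<lambda>x. \<Gamma> Y $$ x))"
      using m by (simp add: monomial_value_def hom_monomials_def)
  qed
  then show ?thesis by (rule poly_fun_cong) (use f(2) \<Gamma>c in \<open>auto simp: peval_eval scalar.eval_def\<close>)
qed

text \<open>The pullbacks along \<Gamma> lie in the span of the bounded monomials. With more forms
  than monomials some nontrivial combination pulls back to 0, and by \<open>dense\<close> it
  vanishes on \<open>S\<close>.\<close>

lemma independent_forms_le:
  fixes S :: "'a::field mat set"
  assumes ind: "independent_forms n S e k" and I: "finite I"
    and \<Gamma>: "\<And>i j. i < n \<Longrightarrow> j < n \<Longrightarrow> poly_fun n (bounded_monomials I 1) (\<lambda>Y. \<Gamma> Y $$ (i,j))"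
    and \<Gamma>c: "\<And>Y. Y \<in> carrier_mat n n \<Longrightarrow> \<Gamma> Y \<in> carrier_mat n n"
    and dense: "\<And>G A. poly_fun n (hom_monomials n e) G \<Longrightarrow> \<forall>Y\<in>carrier_mat n n. G (\<Gamma> Y) = 0 \<Longrightarrow> A \<in> S \<Longrightarrow> G A = 0"
  shows "k \<le> (e + 1) ^ card I"
proof (rule ccontr)
  assume neg: "\<not> ?thesis"
  obtain G where G: "\<And>i. i < k \<Longrightarrow> poly_fun n (hom_monomials n e) (G i)"
    "\<And>c. \<forall>A\<in>S. (\<Sum>i<k. c i * G i A) = 0 \<Longrightarrow> \<forall>i<k. c i = 0"
    using ind unfolding independent_forms_def by blast
  let ?M = "bounded_monomials I e"
  have "\<forall>i<k. \<exists>f. Poly_Mapping.keys f \<subseteq> ?M \<and> (\<forall>Y\<in>carrier_mat n n. peval f Y = G i (\<Gamma> Y))"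
    using poly_fun_compose[OF G(1) \<Gamma> \<Gamma>c] unfolding poly_fun_def by blast
  then obtain f where f: "\<And>i. i < k \<Longrightarrow> Poly_Mapping.keys (f i) \<subseteq> ?M"
    "\<And>i Y. i < k \<Longrightarrow> Y \<in> carrier_mat n n \<Longrightarrow> peval (f i) Y = G i (\<Gamma> Y)" by metis
  obtain ms where ms: "set ms = ?M" "length ms = card ?M"
    using bounded_monomials_card(1)[OF I] finite_distinct_list distinct_card by metis
  define E where "E = mat (length ms) k (\<lambda>(r,i). Poly_Mapping.lookup (f i) (ms ! r))"
  have E: "E \<in> carrier_mat (length ms) k" by (simp add: E_def)
  have "length ms < k" using neg bounded_monomials_card(2)[OF I, of e] ms(2) by simp
  then obtain c where c: "c \<in> carrier_vec k" "c \<noteq> 0\<^sub>v k" "E *\<^sub>v c = 0\<^sub>v (length ms)"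
    using nontrivial_kernel[OF E] by blast
  have rel: "(\<Sum>i<k. c $ i * Poly_Mapping.lookup (f i) m) = 0" if m: "m \<in> ?M" for m
  proof -
    obtain r where r: "r < length ms" "ms ! r = m" using m unfolding ms(1)[symmetric] in_set_conv_nth by blast
    have "(E *\<^sub>v c) $ r = 0" using c(3) r(1) by (simp del: index_mult_mat_vec)
    then have "(\<Sum>i<k. E $$ (r,i) * c $ i) = 0" unfolding mult_mat_vec_entry[OF E c(1) r(1)] .
    moreover have "(\<Sum>i<k. E $$ (r,i) * c $ i) = (\<Sum>i<k. c $ i * Poly_Mapping.lookup (f i) m)"
      by (intro sum.cong refl) (simp add: E_def r)
    ultimately show ?thesis by simp
  qed
  have "(\<Sum>i<k. c $ i * G i (\<Gamma> Y)) = 0" if Y: "Y \<in> carrier_mat n n" for Y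
  proof -
    have "(\<Sum>i<k. c $ i * G i (\<Gamma> Y)) = (\<Sum>i<k. \<Sum>m\<in>?M. c $ i * Poly_Mapping.lookup (f i) m * monomial_value m (\<lambda>x. Y $$ x))"
    proof (rule sum.cong[OF refl])
      fix i assume "i \<in> {..<k}"
      then have i: "i < k" by simp
      have "G i (\<Gamma> Y) = (\<Sum>m\<in>?M. Poly_Mapping.lookup (f i) m * monomial_value m (\<lambda>x. Y $$ x))"
        unfolding f(2)[OF i Y, symmetric] peval_eval
        by (rule scalar.eval_superset[OF bounded_monomials_card(1)[OF I] f(1)[OF i]])
      then show "c $ i * G i (\<Gamma> Y) = (\<Sum>m\<in>?M. c $ i * Poly_Mapping.lookup (f i) m * monomial_value m (\<lambda>x. Y $$ x))"
        by (simp add: sum_distrib_left mult.assoc)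
    qed
    also have "\<dots> = (\<Sum>m\<in>?M. (\<Sum>i<k. c $ i * Poly_Mapping.lookup (f i) m) * monomial_value m (\<lambda>x. Y $$ x))"
      by (subst sum.swap) (simp add: sum_distrib_right)
    also have "\<dots> = 0" using rel by simp
    finally show ?thesis .
  qed
  then have z: "\<forall>Y\<in>carrier_mat n n. (\<Sum>i<k. c $ i * G i (\<Gamma> Y)) = 0" by blast
  have "(\<Sum>i<k. c $ i * G i A) = 0" if "A \<in> S" for A
    by (rule dense[OF poly_fun_lincomb[OF G(1)] z that])
  then have "\<forall>A\<in>S. (\<Sum>i<k. c $ i * G i A) = 0" by blast
  then have "\<forall>i<k. c $ i = 0" by (rule G(2))
  then have "c = 0\<^sub>v k" using c(1) by (intro eq_vecI) auto
  then show False using c(2) by simp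
qed

section \<open>The upper bound for the dimension\<close>

lemma adapted_mem_iff:
  fixes P Q :: "'a::field mat"
  assumes ad: "adapted_coords d n L P Q" and d: "d \<le> n"
  shows "v \<in> L \<longleftrightarrow> v \<in> carrier_vec n \<and> (\<forall>i<n. d \<le> i \<longrightarrow> (Q *\<^sub>v v) $ i = 0)"
proof
  note adD = adapted_coordsD[OF ad d]
  assume "v \<in> L"
  then obtain x where x: "x \<in> carrier_vec d" "v = (P * incl_mat n d) *\<^sub>v x" using adD(5) by blast
  have ix: "incl_mat n d *\<^sub>v x \<in> carrier_vec n" using incl_mat_carrier x(1) by (rule mult_mat_vec_carrier)
  have v: "v = P *\<^sub>v (incl_mat n d *\<^sub>v x)" unfolding x(2) by (rule assoc_mult_mat_vec[OF adD(1) incl_mat_carrier x(1)])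
  have "Q *\<^sub>v v = incl_mat n d *\<^sub>v x" unfolding v by (rule mult_inverse_vec[OF adD(1,2,4) ix])
  then show "v \<in> carrier_vec n \<and> (\<forall>i<n. d \<le> i \<longrightarrow> (Q *\<^sub>v v) $ i = 0)"
    using v adD(1) ix by (auto simp: incl_mat_mult_vec[OF x(1)])
next
  note adD = adapted_coordsD[OF ad d]
  assume v: "v \<in> carrier_vec n \<and> (\<forall>i<n. d \<le> i \<longrightarrow> (Q *\<^sub>v v) $ i = 0)"
  define x where "x = vec d (\<lambda>i. (Q *\<^sub>v v) $ i)"
  have x: "x \<in> carrier_vec d" by (simp add: x_def)
  have "incl_mat n d *\<^sub>v x = Q *\<^sub>v v"
    unfolding incl_mat_mult_vec[OF x] using v adD(2) by (intro eq_vecI) (auto simp: x_def)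
  then have "v = (P * incl_mat n d) *\<^sub>v x"
    unfolding assoc_mult_mat_vec[OF adD(1) incl_mat_carrier x] using mult_inverse_vec[OF adD(2,1,3)] v by simp
  then show "v \<in> L" using adD(5) x by blast
qed

context
  fixes P Q :: "'a::alg_closed_field mat" and L :: "'a vec set" and d n :: nat
  assumes ad: "adapted_coords d n L P Q" and d: "d \<le> n" "d > 0"
    and L: "VectorSpace.subspace class_ring L (module_vec TYPE('a) n)"
begin

lemmas adD = adapted_coordsD[OF ad d(1)]

text \<open>The matrices with eigenvalue \<open>1\<close> and an eigenvector \<open>P (1, x\<^sub>1, \<dots>, x\<^sub>d\<^sub>-\<^sub>1, 0, \<dots>, 0)\<close> are parametrised by
  the \<open>x\<^sub>i\<close> (stored in column \<open>0\<close> of \<open>Y\<close>) and the last \<open>n - 1\<close> columns of the matrix in the coordinates \<open>P\<close>.\<close>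

definition param_vec :: "'a mat \<Rightarrow> nat \<Rightarrow> 'a" where
  "param_vec Y i = (if i = 0 then 1 else if i < d then Y $$ (i,0) else 0)"

text \<open>Column 0 is determined by requiring \<open>param_vec Y\<close> to be fixed by the
  matrix, which is solvable without division because its coordinate 0 is 1.\<close>

definition param_core :: "'a mat \<Rightarrow> 'a mat" where
  "param_core Y = mat n n (\<lambda>(i,j). if j = 0 then param_vec Y i - (\<Sum>l\<in>{1..<d}. param_vec Y l * Y $$ (i,l)) else Y $$ (i,j))"

definition param_mat :: "'a mat \<Rightarrow> 'a mat" where
  "param_mat Y = P * param_core Y * Q"

definition param_index :: "(nat \<times> nat) set" where
  "param_index = {..<n} \<times> {1..<n} \<union> {1..<d} \<times> {0}"

lemma param_core_carrier: "param_core Y \<in> carrier_mat n n"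
  by (simp add: param_core_def)

lemma param_mat_carrier: "param_mat Y \<in> carrier_mat n n"
  unfolding param_mat_def using adD(1,2) param_core_carrier by auto

text \<open>This is the claimed local dimension. Fixing the eigenvalue to 1 accounts for the
  projective scaling.\<close>

lemma card_param_index: "card param_index = n * (n - 1) + (d - 1)"
  unfolding param_index_def by (subst card_Un_disjoint) (auto simp: card_cartesian_product)

lemma finite_param_index: "finite param_index"
  unfolding param_index_def by auto

lemma bounded_poly_fun_var:
  assumes "x \<in> param_index"
  shows "poly_fun n (bounded_monomials param_index 1) (\<lambda>Y. Y $$ x)"
  by (rule poly_fun_var) (use assms in \<open>simp add: bounded_monomials_def lookup_single when_def\<close>)

lemma bounded_poly_fun_const: "poly_fun n (bounded_monomials I e) (\<lambda>Y. c)"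
  by (rule poly_fun_const) (simp add: bounded_monomials_def)

lemma bounded_poly_fun_var_mult:
  assumes "x \<in> param_index" "y \<in> param_index" "x \<noteq> y"
  shows "poly_fun n (bounded_monomials param_index 1) (\<lambda>Y. Y $$ x * Y $$ y)"
proof -
  let ?m = "Poly_Mapping.single x 1 + Poly_Mapping.single y (1::nat)"
  have "?m \<in> bounded_monomials param_index 1"
    using assms keys_add[of "Poly_Mapping.single x (1::nat)" "Poly_Mapping.single y 1"]
    by (auto simp: bounded_monomials_def lookup_add lookup_single when_def split: if_splits)
  from poly_fun_monomial[OF this, of n 1]
  show ?thesis by (simp add: monomial_value_add monomial_value_single)
qed

lemma bounded_poly_fun_param_vec:
  "i < n \<Longrightarrow> poly_fun n (bounded_monomials param_index 1) (\<lambda>Y. param_vec Y i)"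
  unfolding param_vec_def using bounded_poly_fun_var[of "(i,0)"]
  by (cases "i = 0"; cases "i < d") (auto simp: bounded_poly_fun_const param_index_def)

lemma bounded_poly_fun_param_core:
  assumes ij: "i < n" "j < n"
  shows "poly_fun n (bounded_monomials param_index 1) (\<lambda>Y. param_core Y $$ (i,j))"
proof (cases "j = 0")
  case True
  \<comment> \<open>Every product pairs a variable of column 0 with one of a column
    \<open>l > 0\<close>, so no variable is squared.\<close>
  have "poly_fun n (bounded_monomials param_index 1)
    (\<lambda>Y. param_vec Y i + (-1) * (\<Sum>l\<in>{1..<d}. Y $$ (l,0) * Y $$ (i,l)))"
    using ij d by (intro poly_fun_add poly_fun_cmult poly_fun_sum bounded_poly_fun_var_mult bounded_poly_fun_param_vec)
      (auto simp: param_index_def)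
  moreover have "(\<Sum>l\<in>{1..<d}. Y $$ (l,0) * Y $$ (i,l)) = (\<Sum>l\<in>{1..<d}. param_vec Y l * Y $$ (i,l))" for Y
    by (intro sum.cong refl) (simp add: param_vec_def)
  ultimately show ?thesis using ij True by (simp add: param_core_def)
next
  case False
  have "poly_fun n (bounded_monomials param_index 1) (\<lambda>Y. Y $$ (i,j))"
    using ij False by (intro bounded_poly_fun_var) (auto simp: param_index_def)
  then show ?thesis using ij False by (simp add: param_core_def)
qed

lemma bounded_poly_fun_param_mat:
  assumes ij: "i < n" "j < n"
  shows "poly_fun n (bounded_monomials param_index 1) (\<lambda>Y. param_mat Y $$ (i,j))"
proof -
  have "param_mat Y $$ (i,j) = (\<Sum>l<n. \<Sum>k<n. (P $$ (i,k) * Q $$ (l,j)) * param_core Y $$ (k,l))" for Y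
  proof -
    have PM: "P * param_core Y \<in> carrier_mat n n" using adD(1) param_core_carrier by auto
    have "param_mat Y $$ (i,j) = (\<Sum>l<n. (P * param_core Y) $$ (i,l) * Q $$ (l,j))"
      unfolding param_mat_def by (rule mult_mat_entry[OF PM adD(2) ij])
    also have "\<dots> = (\<Sum>l<n. (\<Sum>k<n. P $$ (i,k) * param_core Y $$ (k,l)) * Q $$ (l,j))"
      using mult_mat_entry[OF adD(1) param_core_carrier ij(1)] by (intro sum.cong refl) simp
    also have "\<dots> = (\<Sum>l<n. \<Sum>k<n. (P $$ (i,k) * Q $$ (l,j)) * param_core Y $$ (k,l))"
      unfolding sum_distrib_right by (intro sum.cong refl) (simp add: mult_ac)
    finally show ?thesis .
  qed
  moreover have "poly_fun n (bounded_monomials param_index 1) (\<lambda>Y. \<Sum>l<n. \<Sum>k<n. (P $$ (i,k) * Q $$ (l,j)) * param_core Y $$ (k,l))"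
    by (intro poly_fun_sum poly_fun_cmult bounded_poly_fun_param_core) auto
  ultimately show ?thesis by simp
qed

lemma param_mat_surj:
  assumes A: "A \<in> carrier_mat n n" and v: "v \<in> L" "A *\<^sub>v v = v" "(Q *\<^sub>v v) $ 0 = 1"
  shows "\<exists>Y\<in>carrier_mat n n. param_mat Y = A"
proof -
  have vc: "v \<in> carrier_vec n" and v0: "\<And>i. i < n \<Longrightarrow> d \<le> i \<Longrightarrow> (Q *\<^sub>v v) $ i = 0"
    using v(1) adapted_mem_iff[OF ad d(1)] by auto
  define y where "y = Q *\<^sub>v v"
  define B where "B = Q * A * P"
  have yc: "y \<in> carrier_vec n" using adD(2) vc by (simp add: y_def)
  have B: "B \<in> carrier_mat n n" using adD A by (simp add: B_def)
  have By: "B *\<^sub>v y = y"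
  proof -
    have "B *\<^sub>v y = (Q * A) *\<^sub>v (P *\<^sub>v y)" unfolding B_def using adD A yc by (intro assoc_mult_mat_vec) auto
    also have "P *\<^sub>v y = v" unfolding y_def by (rule mult_inverse_vec[OF adD(2,1,3) vc])
    also have "(Q * A) *\<^sub>v v = Q *\<^sub>v (A *\<^sub>v v)" using adD A vc by (intro assoc_mult_mat_vec) auto
    finally show ?thesis using v(2) by (simp add: y_def)
  qed
  define Y where "Y = mat n n (\<lambda>(i,j). if j = 0 then y $ i else B $$ (i,j))"
  have n: "n > 0" using d by simp
  have pv: "param_vec Y i = y $ i" if "i < n" for i
    using that v(3) v0[OF that] d by (auto simp: param_vec_def Y_def y_def)
  have "param_core Y = B"
  proof (rule eq_matI)
    fix i j assume "i < dim_row B" "j < dim_col B"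
    then have ij: "i < n" "j < n" using B by auto
    show "param_core Y $$ (i,j) = B $$ (i,j)"
    proof (cases "j = 0")
      case True
      have "y $ i = (\<Sum>l<n. B $$ (i,l) * y $ l)" using By mult_mat_vec_entry[OF B yc ij(1)] by simp
      also have "\<dots> = (\<Sum>l\<in>insert 0 {1..<d}. B $$ (i,l) * y $ l)"
        using d v0 by (intro sum.mono_neutral_right) (auto simp: y_def)
      also have "\<dots> = B $$ (i,0) + (\<Sum>l\<in>{1..<d}. B $$ (i,l) * y $ l)" using v(3) by (simp add: y_def)
      also have "(\<Sum>l\<in>{1..<d}. B $$ (i,l) * y $ l) = (\<Sum>l\<in>{1..<d}. param_vec Y l * Y $$ (i,l))"
        using ij d by (intro sum.cong refl) (auto simp: pv, auto simp: Y_def mult.commute)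
      finally show ?thesis using True ij n by (simp add: param_core_def pv)
    next
      case False
      then show ?thesis using ij by (simp add: param_core_def Y_def)
    qed
  qed (use B in \<open>auto simp: param_core_def\<close>)
  then have "param_mat Y = P * (Q * A * P) * Q" by (simp add: param_mat_def B_def)
  also have "\<dots> = A"
  proof -
    have "P * (Q * A * P) = P * (Q * (A * P))" using adD A by (simp add: assoc_mult_mat[of _ n n _ n _ n])
    also have "\<dots> = (P * Q) * (A * P)" using adD A by (intro assoc_mult_mat[symmetric, of _ n n _ n _ n]) auto
    also have "\<dots> = A * P" using adD A by simp
    finally have "P * (Q * A * P) * Q = A * P * Q" by simp
    also have "\<dots> = A * (P * Q)" using adD A by (intro assoc_mult_mat[of _ n n _ n _ n]) auto
    finally show ?thesis using adD A by simp
  qed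
  finally show ?thesis by (intro bexI[of _ Y]) (auto simp: Y_def)
qed

text \<open>Up to scaling, the parametrisation reaches all matrices with a nonzero eigenvalue whose
  eigenvector in \<open>L\<close> has nonzero coordinate 0. A path from \<open>A\<close> to the
  identity matrix, with eigenvector moving to a multiple of \<open>P\<close> applied to the unit
  vector 0, meets this set for almost all parameters; hence \<open>G\<close> vanishes along the
  whole path.\<close>

lemma param_dense:
  assumes G: "poly_fun n (hom_monomials n e) G" and z: "\<forall>Y\<in>carrier_mat n n. G (param_mat Y) = 0"
    and A: "A \<in> cone n (kalman_variety 1 n L)"
  shows "G A = 0"
proof -
  have main: "G B = 0" if B: "B \<in> carrier_mat n n" and v: "v \<in> L" "B *\<^sub>v v = \<rho> \<cdot>\<^sub>v v" and \<rho>: "\<rho> \<noteq> 0" and v0: "(Q *\<^sub>v v) $ 0 \<noteq> 0" for B v \<rho>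
  proof -
    define a where "a = (Q *\<^sub>v v) $ 0"
    define u where "u = inverse a \<cdot>\<^sub>v v"
    have vc: "v \<in> carrier_vec n" using v L_carrier[OF L] by blast
    have uL: "u \<in> L" using v L by (auto simp: u_def subspace_vec_iff)
    have uc: "u \<in> carrier_vec n" using uL L_carrier[OF L] by blast
    have "Q *\<^sub>v u = inverse a \<cdot>\<^sub>v (Q *\<^sub>v v)" unfolding u_def by (rule mult_mat_vec[OF adD(2) vc])
    then have u0: "(Q *\<^sub>v u) $ 0 = 1" using d v0 adD(2) by (simp add: a_def[symmetric])
    define B' where "B' = inverse \<rho> \<cdot>\<^sub>m B"
    have B': "B' \<in> carrier_mat n n" using B by (simp add: B'_def)
    have "B' *\<^sub>v u = inverse \<rho> \<cdot>\<^sub>v (B *\<^sub>v u)" unfolding B'_def by (rule smult_mat_mult_vec[OF B uc])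
    also have "B *\<^sub>v u = \<rho> \<cdot>\<^sub>v u" unfolding u_def by (rule eigenvector_smult[OF B vc v(2)])
    finally have "B' *\<^sub>v u = u" using \<rho> by (simp add: smult_smult_assoc)
    then obtain Y where "Y \<in> carrier_mat n n" "param_mat Y = B'" using param_mat_surj[OF B' uL _ u0] by blast
    then have "G B' = 0" using z by blast
    moreover have "B = \<rho> \<cdot>\<^sub>m B'" using \<rho> by (simp add: B'_def smult_smult_mat)
    ultimately show ?thesis using poly_fun_smult[OF G B', of \<rho>] by simp
  qed
  have Ac: "A \<in> carrier_mat n n" using A by (rule cone_carrier)
  obtain w \<mu> where w: "w \<in> L" "w \<noteq> 0\<^sub>v n" "A *\<^sub>v w = \<mu> \<cdot>\<^sub>v w" using A unfolding cone_kalman_variety_1[OF L] by blast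
  have wc: "w \<in> carrier_vec n" using w L_carrier[OF L] by blast
  define v where "v = P *\<^sub>v unit_vec n 0"
  have uvc: "unit_vec n 0 \<in> carrier_vec n" by simp
  have vc: "v \<in> carrier_vec n" using adD(1) by (simp add: v_def)
  have Qv: "Q *\<^sub>v v = unit_vec n 0" unfolding v_def by (rule mult_inverse_vec[OF adD(1,2,4) uvc])
  have vL: "v \<in> L" unfolding adapted_mem_iff[OF ad d(1)] Qv using vc d by auto
  have v0: "v \<noteq> 0\<^sub>v n"
  proof
    assume "v = 0\<^sub>v n"
    then have "unit_vec n 0 = (0\<^sub>v n :: 'a vec)" using Qv mult_mat_zero_vec[OF adD(2)] by simp
    then have "unit_vec n 0 $ 0 = (0\<^sub>v n :: 'a vec) $ 0" by simp
    then show False using d by simp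
  qed
  obtain \<phi> where \<phi>: "\<phi> \<in> carrier_vec n" "\<phi> \<bullet> w \<noteq> 0" "\<phi> \<bullet> v \<noteq> 0" using common_functional[OF wc w(2) vc v0] .
  let ?w = "inverse (\<phi> \<bullet> w) \<cdot>\<^sub>v w" and ?v = "inverse (\<phi> \<bullet> v) \<cdot>\<^sub>v v"
  have wvL: "?w \<in> L" "?v \<in> L" using w vL L by (auto simp: subspace_vec_iff)
  have wvc: "?w \<in> carrier_vec n" "?v \<in> carrier_vec n" using wc vc by auto
  have one: "1\<^sub>m n *\<^sub>v ?v = 1 \<cdot>\<^sub>v ?v" using wvc by simp
  have p1: "\<phi> \<bullet> ?w = 1" "\<phi> \<bullet> ?v = 1" using \<phi> wc vc by auto
  obtain X where X: "curve_mat n X 0 = A"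
    and e: "\<And>t. curve_mat n X t *\<^sub>v (?w + t \<cdot>\<^sub>v (?v - ?w)) = (\<mu> + t * (1 - \<mu>)) \<cdot>\<^sub>v (?w + t \<cdot>\<^sub>v (?v - ?w))"
      "\<And>t. ?w + t \<cdot>\<^sub>v (?v - ?w) \<in> L"
    using kalman_path[OF L Ac eigenvector_smult[OF Ac wc w(3)] wvL(1) one_carrier_mat one wvL(2) \<phi>(1) p1] by metis
  define \<alpha> where "\<alpha> = (Q *\<^sub>v ?w) $ 0"
  define \<beta> where "\<beta> = (Q *\<^sub>v ?v) $ 0"
  have \<beta>: "\<beta> \<noteq> 0" unfolding \<beta>_def mult_mat_vec[OF adD(2) vc] Qv using \<phi> d by simp
  have Qx: "(Q *\<^sub>v (?w + t \<cdot>\<^sub>v (?v - ?w))) $ 0 = \<alpha> + t * (\<beta> - \<alpha>)" for t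
  proof -
    have dc: "?v - ?w \<in> carrier_vec n" using wvc by simp
    have "Q *\<^sub>v (?w + t \<cdot>\<^sub>v (?v - ?w)) = Q *\<^sub>v ?w + t \<cdot>\<^sub>v (Q *\<^sub>v ?v - Q *\<^sub>v ?w)"
      unfolding mult_add_distrib_mat_vec[OF adD(2) wvc(1) smult_carrier_vec[THEN iffD2, OF dc]] mult_mat_vec[OF adD(2) dc]
        mult_minus_distrib_mat_vec[OF adD(2) wvc(2,1)] ..
    then show ?thesis using adD(2) d unfolding \<alpha>_def \<beta>_def by (simp del: index_mult_mat_vec)
  qed
  obtain g where g: "g \<in> homogeneous_polys n" "\<forall>B\<in>carrier_mat n n. peval g B = G B" using poly_fun_homogeneous[OF G] by blast
  \<comment> \<open>The exceptional parameters, at which the eigenvalue or coordinate 0 of the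
    eigenvector vanishes. Both linear polynomials are nonzero since their values at 1 are 1 and
    \<beta>.\<close>
  define F where "F = {t. poly [:\<mu>, 1 - \<mu>:] t = 0} \<union> {t. poly [:\<alpha>, \<beta> - \<alpha>:] t = 0}"
  have "[:\<mu>, 1 - \<mu>:] \<noteq> 0" "[:\<alpha>, \<beta> - \<alpha>:] \<noteq> 0" using \<beta> by (auto simp: pCons_eq_0_iff)
  then have "finite F" unfolding F_def using poly_roots_finite by blast
  moreover have "poly (curve.eval g X) t = 0" if "t \<notin> F" for t
  proof -
    have "\<mu> + t * (1 - \<mu>) \<noteq> 0" "\<alpha> + t * (\<beta> - \<alpha>) \<noteq> 0" using that by (auto simp: F_def)
    then have "G (curve_mat n X t) = 0" using main[OF curve_mat_carrier e(2,1)] Qx by simp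
    then show ?thesis using peval_curve_mat[OF g(1), of X t] g(2) by simp
  qed
  ultimately have "curve.eval g X = 0" by (rule poly_eq_0_if_cofinite)
  then show ?thesis using peval_curve_mat[OF g(1), of X 0] g(2) X Ac by simp
qed

lemma chain_length_le:
  assumes irr: "\<And>i. i \<le> k \<Longrightarrow> proj_irreducible n (Z i)" and lt: "\<And>i. i < k \<Longrightarrow> Z i \<subset> Z (Suc i)"
    and sub: "Z k \<subseteq> kalman_variety 1 n L"
  shows "k \<le> n * (n - 1) + (d - 1)"
proof -
  obtain a where a: "a \<ge> 1" "\<And>m. independent_forms n (cone n (Z k)) (a * m) ((m + k) choose k)"
    using chain_independent_forms[of k n Z, OF irr lt] by blast
  have "((m + k) choose k) \<le> (a * m + 1) ^ (n * (n - 1) + (d - 1))" for m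
    unfolding card_param_index[symmetric]
  proof (rule independent_forms_le[where \<Gamma> = param_mat and n = n])
    show "independent_forms n (cone n (kalman_variety 1 n L)) (a * m) ((m + k) choose k)"
      using a(2) cone_mono[OF sub] by (rule independent_forms_mono) simp
    show "G A = 0" if "poly_fun n (hom_monomials n (a * m)) G" "\<forall>Y\<in>carrier_mat n n. G (param_mat Y) = 0"
      "A \<in> cone n (kalman_variety 1 n L)" for G A
      using that by (rule param_dense)
  qed (rule finite_param_index bounded_poly_fun_param_mat param_mat_carrier; assumption?)+
  then show ?thesis by (rule growth_degree) (rule a(1))
qed

end

section \<open>The lower bound for the dimension\<close>

definition mat_entry :: "nat \<Rightarrow> 'a mat \<Rightarrow> nat \<Rightarrow> 'a" where
  "mat_entry n A k = A $$ (k div n, k mod n)"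

lemma div_mod_less:
  assumes "k < n * n"
  shows "k div n < n" "k mod n < (n::nat)"
  using assms by (auto simp: less_mult_imp_div_less) (metis mod_less_divisor mult_0 neq0_conv not_less_zero)

lemma mult_add_less:
  assumes "i < n" "j < (n::nat)"
  shows "i * n + j < n * n"
proof -
  have "i * n + j < (i + 1) * n" using assms by simp
  also have "\<dots> \<le> n * n" using assms by (intro mult_right_mono) auto
  finally show ?thesis .
qed

lemma sum_mat_entries:
  fixes f :: "nat \<Rightarrow> nat \<Rightarrow> 'a::comm_monoid_add" and n :: nat
  shows "(\<Sum>k<n * n. f (k div n) (k mod n)) = (\<Sum>i<n. \<Sum>j<n. f i j)"
proof -
  have "(\<Sum>i<n. \<Sum>j<n. f i j) = (\<Sum>(i,j)\<in>{..<n} \<times> {..<n}. f i j)" by (simp add: sum.cartesian_product)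
  also have "\<dots> = (\<Sum>k<n * n. f (k div n) (k mod n))"
    by (rule sum.reindex_bij_witness[of _ "\<lambda>k. (k div n, k mod n)" "\<lambda>(i,j). i * n + j"])
      (auto simp: mult_add_less div_mod_less)
  finally show ?thesis by simp
qed

definition linear_form :: "nat \<Rightarrow> 'a::comm_ring_1 vec \<Rightarrow> 'a mat \<Rightarrow> 'a" where
  "linear_form n e B = (\<Sum>k<n * n. e $ k * mat_entry n B k)"

lemma hom_poly_fun_linear_form: "poly_fun n (hom_monomials n 1) (linear_form n e)"
proof -
  have "poly_fun n (hom_monomials n 1) (\<lambda>B. \<Sum>k<n * n. e $ k * B $$ (k div n, k mod n))"
    by (intro poly_fun_sum hom_poly_fun_cmult hom_poly_fun_entry) (auto simp: div_mod_less)
  then show ?thesis by (rule poly_fun_cong) (simp add: linear_form_def mat_entry_def)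
qed

lemma linear_form_add_smult:
  assumes "A \<in> carrier_mat n n" "B \<in> carrier_mat n n"
  shows "linear_form n e (a \<cdot>\<^sub>m A + b \<cdot>\<^sub>m B) = a * linear_form n e A + b * linear_form n e B"
  unfolding linear_form_def sum_distrib_left sum.distrib[symmetric]
  using assms by (intro sum.cong refl) (simp add: mat_entry_def div_mod_less algebra_simps)

definition linear_variety :: "nat \<Rightarrow> 'a::field vec list \<Rightarrow> 'a mat set set" where
  "linear_variety n es = {proj_point A | A. A \<in> nonzero_mats n \<and> (\<forall>e\<in>set es. linear_form n e A = 0)}"

lemma cone_linear_variety:
  fixes es :: "'a::field vec list"
  shows "cone n (linear_variety n es) = {A \<in> nonzero_mats n. \<forall>e\<in>set es. linear_form n e A = 0}"
  unfolding linear_variety_def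
proof (rule cone_Collect)
  fix A and c :: 'a assume A: "A \<in> nonzero_mats n" "\<forall>e\<in>set es. linear_form n e A = 0"
  have "linear_form n e (c \<cdot>\<^sub>m A) = c * linear_form n e A" for e
    unfolding linear_form_def sum_distrib_left
    using A(1) by (intro sum.cong refl) (auto simp: mat_entry_def nonzero_mats_def div_mod_less[of _ n])
  then show "\<forall>e\<in>set es. linear_form n e (c \<cdot>\<^sub>m A) = 0" using A(2) by simp
qed

lemma proj_closed_linear_variety:
  fixes es :: "'a::field vec list"
  shows "proj_closed n (linear_variety n es)"
proof -
  have "\<forall>e :: 'a vec. \<exists>f\<in>homogeneous_polys n. \<forall>A\<in>carrier_mat n n. peval f A = linear_form n e A"
    using poly_fun_homogeneous[OF hom_poly_fun_linear_form] by blast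
  then obtain f :: "'a vec \<Rightarrow> 'a entry_poly" where f: "\<And>e. f e \<in> homogeneous_polys n" "\<And>e A. A \<in> carrier_mat n n \<Longrightarrow> peval (f e) A = linear_form n e A"
    by metis
  have "linear_variety n es = proj_zeros n (f ` set es)"
    unfolding linear_variety_def proj_zeros_def
    by (intro Collect_cong iff_exI conj_cong refl) (auto simp: f nonzero_mats_def)
  then show ?thesis unfolding proj_closed_def using f(1) by blast
qed

lemma proj_irreducible_linear_variety:
  fixes es :: "'a::alg_closed_field vec list"
  assumes "A \<in> cone n (linear_variety n es)"
  shows "proj_irreducible n (linear_variety n es)"
proof (rule proj_irreducibleI[OF proj_closed_linear_variety])
  show "cone n (linear_variety n es) \<noteq> {}" using assms by blast
  fix A B assume A: "A \<in> cone n (linear_variety n es)" and B: "B \<in> cone n (linear_variety n es)"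
  note Ac = cone_carrier[OF A] and Bc = cone_carrier[OF B]
  define X where "X = (\<lambda>x. [:A $$ x, B $$ x - A $$ x:])"
  have XM: "curve_mat n X t = (1 - t) \<cdot>\<^sub>m A + t \<cdot>\<^sub>m B" for t
    using Ac Bc by (intro eq_matI) (auto simp: curve_mat_def X_def algebra_simps)
  have "linear_form n e (curve_mat n X t) = 0" if "e \<in> set es" for e t
    unfolding XM linear_form_add_smult[OF Ac Bc] using A B that by (simp add: cone_linear_variety)
  then have "curve_mat n X t \<in> insert (0\<^sub>m n n) (cone n (linear_variety n es))" for t
    unfolding cone_linear_variety by (auto simp: nonzero_mats_def)
  moreover have "curve_mat n X 0 = A" "curve_mat n X 1 = B" unfolding XM using Ac Bc by (auto intro!: eq_matI)
  ultimately show "\<exists>X. curve_mat n X 0 = A \<and> curve_mat n X 1 = B \<and> (\<forall>t. curve_mat n X t \<in> insert (0\<^sub>m n n) (cone n (linear_variety n es)))"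
    by blast
qed

lemma linear_forms_common_zero:
  fixes es :: "'a::field vec list"
  assumes "length es < n * n"
  obtains B where "B \<in> nonzero_mats n" "\<forall>e\<in>set es. linear_form n e B = 0"
proof -
  define E where "E = mat (length es) (n * n) (\<lambda>(r,k). es ! r $ k)"
  have E: "E \<in> carrier_mat (length es) (n * n)" by (simp add: E_def)
  obtain w where w: "w \<in> carrier_vec (n * n)" "w \<noteq> 0\<^sub>v (n * n)" "E *\<^sub>v w = 0\<^sub>v (length es)"
    using nontrivial_kernel[OF E assms] by blast
  define B where "B = mat n n (\<lambda>(i,j). w $ (i * n + j))"
  have ent: "mat_entry n B k = w $ k" if "k < n * n" for k
    using div_mod_less[OF that] by (simp add: mat_entry_def B_def)
  have "B \<noteq> 0\<^sub>m n n"
  proof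
    assume "B = 0\<^sub>m n n"
    then have "mat_entry n B k = 0" if "k < n * n" for k using div_mod_less[OF that] by (simp add: mat_entry_def)
    then have "w = 0\<^sub>v (n * n)" using ent w(1) by (intro eq_vecI) auto
    then show False using w(2) by simp
  qed
  moreover have "linear_form n e B = 0" if e: "e \<in> set es" for e
  proof -
    obtain r where r: "r < length es" "es ! r = e" using e unfolding in_set_conv_nth by blast
    have "(E *\<^sub>v w) $ r = 0" using w(3) r(1) by (simp del: index_mult_mat_vec)
    then have "(\<Sum>k<n * n. E $$ (r,k) * w $ k) = 0" unfolding mult_mat_vec_entry[OF E w(1) r(1)] .
    moreover have "(\<Sum>k<n * n. E $$ (r,k) * w $ k) = linear_form n e B"
      unfolding linear_form_def by (intro sum.cong refl) (simp add: E_def r ent)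
    ultimately show ?thesis by simp
  qed
  ultimately show ?thesis using that[of B] by (auto simp: nonzero_mats_def B_def)
qed

text \<open>Counting equations, the variety has projective dimension at least \<open>k\<close>. Each
  step down adds an equation that holds at \<open>A\<close> but fails at another point
  \<open>B\<close> of the variety.\<close>

lemma linear_chain:
  fixes es :: "'a::alg_closed_field vec list"
  assumes "A \<in> cone n (linear_variety n es)" "length es + k + 1 = n * n"
  shows "\<exists>Z. Z k = linear_variety n es \<and> (\<forall>i\<le>k. proj_irreducible n (Z i) \<and> proj_point A \<in> Z i) \<and> (\<forall>i<k. Z i \<subset> Z (Suc i))"
  using assms
proof (induction k arbitrary: es)
  case 0
  then show ?case using proj_irreducible_linear_variety[OF 0(1)]
    by (intro exI[of _ "\<lambda>_. linear_variety n es"]) (auto simp: cone_def)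
next
  case (Suc k)
  have A: "A \<in> nonzero_mats n" "\<forall>e\<in>set es. linear_form n e A = 0" using Suc.prems(1) by (auto simp: cone_linear_variety)
  have entry: "\<exists>x<n * n. mat_entry n B x \<noteq> 0" if "B \<in> nonzero_mats n" for B :: "'a mat"
  proof (rule ccontr)
    assume neg: "\<not> ?thesis"
    have "B = 0\<^sub>m n n"
    proof (rule eq_matI)
      fix i j assume "i < dim_row (0\<^sub>m n n)" "j < dim_col (0\<^sub>m n n)"
      then have ij: "i < n" "j < n" by auto
      then have "mat_entry n B (i * n + j) = 0" using neg mult_add_less[OF ij] by blast
      then show "B $$ (i,j) = 0\<^sub>m n n $$ (i,j)" using ij by (simp add: mat_entry_def)
    qed (use that in \<open>auto simp: nonzero_mats_def\<close>)
    then show False using that by (simp add: nonzero_mats_def)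
  qed
  obtain x where x: "x < n * n" "mat_entry n A x \<noteq> 0" using entry[OF A(1)] by blast
  have unit: "linear_form n (a \<cdot>\<^sub>v unit_vec (n * n) y + b \<cdot>\<^sub>v unit_vec (n * n) z) B = a * mat_entry n B y + b * mat_entry n B z"
    if "y < n * n" "z < n * n" for a b y z and B :: "'a mat"
  proof -
    have "linear_form n (a \<cdot>\<^sub>v unit_vec (n * n) y + b \<cdot>\<^sub>v unit_vec (n * n) z) B
      = (\<Sum>k<n * n. (if k = y then a * mat_entry n B y else 0) + (if k = z then b * mat_entry n B z else 0))"
      unfolding linear_form_def using that by (intro sum.cong refl) (auto simp: unit_vec_def distrib_right)
    then show ?thesis using that by (simp add: sum.distrib)
  qed
  \<comment> \<open>The extra equation demands that entry \<open>x\<close> vanishes; as it is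
    nonzero in \<open>A\<close>, the point \<open>B\<close> is not proportional to
    \<open>A\<close>.\<close>
  obtain B where B: "B \<in> nonzero_mats n" "\<forall>e\<in>set ((1 \<cdot>\<^sub>v unit_vec (n * n) x + 0 \<cdot>\<^sub>v unit_vec (n * n) x) # es). linear_form n e B = 0"
    using linear_forms_common_zero[of "(1 \<cdot>\<^sub>v unit_vec (n * n) x + 0 \<cdot>\<^sub>v unit_vec (n * n) x) # es" n] Suc.prems(2) by auto
  then have Bx: "mat_entry n B x = 0" using unit[OF x(1) x(1), of 1 0 B] by simp
  obtain y where y: "y < n * n" "mat_entry n B y \<noteq> 0" using entry[OF B(1)] by blast
  \<comment> \<open>The 2 by 2 minor of the entries \<open>x\<close> and \<open>y\<close> formed
    with \<open>A\<close>: it vanishes at \<open>A\<close>, and at \<open>B\<close> it is a product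
    of two nonzero entries because \<open>B\<close> is zero at \<open>x\<close>.\<close>
  define e where "e = mat_entry n A x \<cdot>\<^sub>v unit_vec (n * n) y + (- mat_entry n A y) \<cdot>\<^sub>v unit_vec (n * n) x"
  have eA: "linear_form n e A = 0" unfolding e_def unit[OF y(1) x(1)] by (simp add: mult.commute)
  have eB: "linear_form n e B \<noteq> 0" unfolding e_def unit[OF y(1) x(1)] using Bx x y by simp
  have "A \<in> cone n (linear_variety n (e # es))" using A eA by (simp add: cone_linear_variety)
  from Suc.IH[OF this] obtain Z where Z: "Z k = linear_variety n (e # es)"
    "\<forall>i\<le>k. proj_irreducible n (Z i) \<and> proj_point A \<in> Z i" "\<forall>i<k. Z i \<subset> Z (Suc i)" using Suc.prems(2) by auto
  define Z' where "Z' i = (if i \<le> k then Z i else linear_variety n es)" for i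
  have "linear_variety n (e # es) \<subset> linear_variety n es"
  proof
    show "linear_variety n (e # es) \<subseteq> linear_variety n es" by (auto simp: linear_variety_def)
    have "B \<in> cone n (linear_variety n es)" "B \<notin> cone n (linear_variety n (e # es))"
      using B eB by (auto simp: cone_linear_variety)
    then show "linear_variety n (e # es) \<noteq> linear_variety n es" by auto
  qed
  then have "Z' i \<subset> Z' (Suc i)" if "i < Suc k" for i
    using Z that by (cases "i = k") (auto simp: Z'_def)
  moreover have "proj_irreducible n (Z' i) \<and> proj_point A \<in> Z' i" if "i \<le> Suc k" for i
    using Z(2) proj_irreducible_linear_variety[OF Suc.prems(1)] Suc.prems(1) by (auto simp: Z'_def cone_def)
  ultimately show ?case by (intro exI[of _ Z']) (auto simp: Z'_def)
qed

section \<open>Kalman varieties of a complete flag starting with a given eigenvector\<close>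

context
  fixes P Q :: "'a::alg_closed_field mat" and n :: nat and v :: "'a vec"
  assumes P: "P \<in> carrier_mat n n" and Q: "Q \<in> carrier_mat n n" and PQ: "P * Q = 1\<^sub>m n" and QP: "Q * P = 1\<^sub>m n"
    and v: "v \<in> carrier_vec n" "v \<noteq> 0\<^sub>v n" and Qv: "Q *\<^sub>v v = unit_vec n 0"
begin

definition flag_space :: "nat \<Rightarrow> 'a vec set" where
  "flag_space i = {x \<in> carrier_vec n. \<forall>r<n. i \<le> r \<longrightarrow> (Q *\<^sub>v x) $ r = 0}"

text \<open>A square matrix with kernel \<open>flag_space i\<close>, so that the results on kernels
  of \<open>C\<close> apply to every member of the flag.\<close>

definition flag_mat :: "nat \<Rightarrow> 'a mat" where
  "flag_mat i = mat n n (\<lambda>(r,c). if i \<le> r then Q $$ (r,c) else 0)"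

lemma flag_mat_carrier: "flag_mat i \<in> carrier_mat n n"
  by (simp add: flag_mat_def)

lemma flag_space_kernel: "flag_space i = mat_kernel (flag_mat i)"
proof -
  have "flag_mat i *\<^sub>v x = 0\<^sub>v n \<longleftrightarrow> (\<forall>r<n. i \<le> r \<longrightarrow> (Q *\<^sub>v x) $ r = 0)" if x: "x \<in> carrier_vec n" for x
  proof -
    have e: "(flag_mat i *\<^sub>v x) $ r = (if i \<le> r then (Q *\<^sub>v x) $ r else 0)" if "r < n" for r
      unfolding mult_mat_vec_entry[OF flag_mat_carrier x that] mult_mat_vec_entry[OF Q x that]
      using that by (auto simp: flag_mat_def intro!: sum.neutral)
    show ?thesis
    proof
      assume "flag_mat i *\<^sub>v x = 0\<^sub>v n"
      then show "\<forall>r<n. i \<le> r \<longrightarrow> (Q *\<^sub>v x) $ r = 0" using e by (metis index_zero_vec(1))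
    next
      assume "\<forall>r<n. i \<le> r \<longrightarrow> (Q *\<^sub>v x) $ r = 0"
      then show "flag_mat i *\<^sub>v x = 0\<^sub>v n" using e carrier_matD(1)[OF flag_mat_carrier]
        by (intro eq_vecI) (auto simp del: index_mult_mat_vec)
    qed
  qed
  then show ?thesis unfolding flag_space_def mat_kernel[OF flag_mat_carrier] by auto
qed

lemma flag_subspace: "VectorSpace.subspace class_ring (flag_space i) (module_vec TYPE('a) n)"
  unfolding flag_space_kernel by (rule subspace_mat_kernel[OF flag_mat_carrier])

lemma flag_mono: "i \<le> j \<Longrightarrow> flag_space i \<subseteq> flag_space j"
  by (auto simp: flag_space_def)

lemma v_in_flag: "i \<ge> 1 \<Longrightarrow> v \<in> flag_space i"
  using v Qv by (auto simp: flag_space_def)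

abbreviation "flag_variety i \<equiv> kalman_variety 1 n (flag_space i)"

lemma flag_variety_irreducible:
  assumes "i \<ge> 1"
  shows "proj_irreducible n (flag_variety i)"
proof -
  have n: "1 \<le> n" using vec_nonzero_index[OF v] by (metis One_nat_def Suc_leI gr_zeroI not_less_zero)
  have "subspace_dim n (mat_kernel (flag_mat i)) \<le> n" using rank_plus_nullity[OF flag_mat_carrier] by (metis le_add2)
  then have "proj_closed n (flag_variety i)"
    unfolding flag_space_kernel by (rule proj_closed_kalman_variety[OF flag_mat_carrier _ n])
  then show ?thesis by (rule proj_irreducible_kalman_variety[OF flag_subspace _ v_in_flag[OF assms] v(2)])
qed

text \<open>In the coordinates \<open>Q\<close> the witness is the nilpotent shift sending unit
  vector \<open>c\<close> to \<open>c + 1\<close> for \<open>c < i\<close> and the others to 0. Unit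
  vector \<open>i\<close> is an eigenvector in the larger space, but the shift has no eigenvector in
  the smaller one.\<close>

lemma flag_variety_strict:
  assumes i: "1 \<le> i" "i < n"
  shows "flag_variety i \<subset> flag_variety (Suc i)"
proof
  show "flag_variety i \<subseteq> flag_variety (Suc i)"
    unfolding kalman_variety_def using flag_mono[of i "Suc i"] by fastforce
  define J where "J = mat n n (\<lambda>(r,c). if r = Suc c \<and> c < i then (1::'a) else 0)"
  have J: "J \<in> carrier_mat n n" by (simp add: J_def)
  have Jz: "(J *\<^sub>v z) $ r = (if r \<ge> 1 \<and> r \<le> i then z $ (r - 1) else 0)" if z: "z \<in> carrier_vec n" and r: "r < n" for z r
  proof -
    have "(J *\<^sub>v z) $ r = (\<Sum>c<n. if r \<ge> 1 \<and> c = r - 1 \<and> c < i then z $ c else 0)"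
      unfolding mult_mat_vec_entry[OF J z r] using r by (intro sum.cong refl) (auto simp: J_def)
    also have "\<dots> = (\<Sum>c<n. if c = r - 1 then (if r \<ge> 1 \<and> r \<le> i then z $ (r - 1) else 0) else 0)"
      by (intro sum.cong refl) auto
    also have "\<dots> = (if r \<ge> 1 \<and> r \<le> i then z $ (r - 1) else 0)" using r by (auto simp: sum.delta)
    finally show ?thesis .
  qed
  define A where "A = P * J * Q"
  have A: "A \<in> carrier_mat n n" using P J Q by (simp add: A_def)
  have Ax: "Q *\<^sub>v (A *\<^sub>v x) = J *\<^sub>v (Q *\<^sub>v x)" if x: "x \<in> carrier_vec n" for x
  proof -
    have Qx: "Q *\<^sub>v x \<in> carrier_vec n" using Q x by (rule mult_mat_vec_carrier)
    have JQx: "J *\<^sub>v (Q *\<^sub>v x) \<in> carrier_vec n" using J Qx by (rule mult_mat_vec_carrier)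
    have PJ: "P * J \<in> carrier_mat n n" using P J by simp
    have "A *\<^sub>v x = P *\<^sub>v (J *\<^sub>v (Q *\<^sub>v x))"
      unfolding A_def assoc_mult_mat_vec[OF PJ Q x] assoc_mult_mat_vec[OF P J Qx] ..
    then show ?thesis using mult_inverse_vec[OF P Q QP JQx] by simp
  qed
  define u where "u = P *\<^sub>v unit_vec n i"
  have uc: "u \<in> carrier_vec n" using P by (simp add: u_def)
  have Qu: "Q *\<^sub>v u = unit_vec n i" unfolding u_def by (rule mult_inverse_vec[OF P Q QP]) simp
  have Au: "A *\<^sub>v u = 0 \<cdot>\<^sub>v u"
  proof -
    have "J *\<^sub>v unit_vec n i = 0\<^sub>v n"
    proof (rule eq_vecI)
      fix r assume "r < dim_vec (0\<^sub>v n)"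
      then have r: "r < n" by simp
      show "(J *\<^sub>v unit_vec n i) $ r = 0\<^sub>v n $ r" unfolding Jz[OF unit_vec_carrier r] using r i by (auto simp: unit_vec_def)
    qed (use J in simp)
    then have "Q *\<^sub>v (A *\<^sub>v u) = 0\<^sub>v n" unfolding Ax[OF uc] Qu .
    moreover have "A *\<^sub>v u \<in> carrier_vec n" using A uc by (rule mult_mat_vec_carrier)
    ultimately have "A *\<^sub>v u = 0\<^sub>v n" using mult_inverse_vec[OF Q P PQ] mult_mat_zero_vec[OF P] by metis
    then show ?thesis using zero_smult_vec[OF uc] by simp
  qed
  have uF: "u \<in> flag_space (Suc i)" using uc i Qu by (auto simp: flag_space_def simp del: index_mult_mat_vec)
  have u0: "u \<noteq> 0\<^sub>v n"
  proof
    assume "u = 0\<^sub>v n"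
    then have "unit_vec n i = (0\<^sub>v n :: 'a vec)" using Qu mult_mat_zero_vec[OF Q] by simp
    then have "unit_vec n i $ i = (0\<^sub>v n :: 'a vec) $ i" by simp
    then show False using i by simp
  qed
  have A0: "A \<noteq> 0\<^sub>m n n"
  proof
    assume z: "A = 0\<^sub>m n n"
    have "A *\<^sub>v v = 0\<^sub>v n" unfolding z using v by (intro eq_vecI) auto
    then have "J *\<^sub>v unit_vec n 0 = 0\<^sub>v n" using Ax[OF v(1)] mult_mat_zero_vec[OF Q] unfolding Qv by simp
    then have "(J *\<^sub>v unit_vec n 0) $ 1 = 0" using i by (simp del: index_mult_mat_vec)
    then show False using Jz[of "unit_vec n 0" 1] i by simp
  qed
  have in1: "A \<in> cone n (flag_variety (Suc i))"
    unfolding cone_kalman_variety_1[OF flag_subspace] using A A0 uF u0 Au by (auto simp: nonzero_mats_def)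
  have "A \<notin> cone n (flag_variety i)"
  proof
    assume "A \<in> cone n (flag_variety i)"
    then obtain x \<mu> where x: "x \<in> flag_space i" "x \<noteq> 0\<^sub>v n" "A *\<^sub>v x = \<mu> \<cdot>\<^sub>v x"
      unfolding cone_kalman_variety_1[OF flag_subspace] by blast
    have xc: "x \<in> carrier_vec n" using x by (simp add: flag_space_def)
    define z where "z = Q *\<^sub>v x"
    have zc: "z \<in> carrier_vec n" using Q xc by (simp add: z_def)
    have zsupp: "z $ r = 0" if "r < n" "i \<le> r" for r using x(1) that by (simp add: flag_space_def z_def)
    have Jzz: "J *\<^sub>v z = \<mu> \<cdot>\<^sub>v z" using Ax[OF xc] x(3) mult_mat_vec[OF Q xc] by (simp add: z_def)
    have "z \<noteq> 0\<^sub>v n" using mult_inverse_vec[OF Q P PQ xc] mult_mat_zero_vec[OF P] x(2) unfolding z_def by metis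
    then obtain r where r: "r < n" "z $ r \<noteq> 0" using vec_nonzero_index[OF zc] by blast
    \<comment> \<open>The shift moves the last nonzero coordinate of \<open>z\<close> to the
      position \<open>t + 1\<close>, where every multiple of \<open>z\<close> vanishes.\<close>
    define t where "t = (GREATEST k. k < n \<and> z $ k \<noteq> 0)"
    have t: "t < n" "z $ t \<noteq> 0" using GreatestI_nat[of "\<lambda>k. k < n \<and> z $ k \<noteq> 0" r n] r unfolding t_def by auto
    have tmax: "z $ k = 0" if "t < k" "k < n" for k
      using that Greatest_le_nat[of "\<lambda>k. k < n \<and> z $ k \<noteq> 0" k n] unfolding t_def by fastforce
    have ti: "t < i" using t zsupp by (meson not_le)
    then have tn: "Suc t < n" using i by simp
    have "(J *\<^sub>v z) $ Suc t = z $ t" unfolding Jz[OF zc tn] using ti by simp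
    moreover have "(\<mu> \<cdot>\<^sub>v z) $ Suc t = 0" using tmax[OF _ tn] zc tn by simp
    ultimately show False using Jzz t by simp
  qed
  then show "flag_variety i \<noteq> flag_variety (Suc i)" using in1 by auto
qed

text \<open>The first member of the flag is the line of \<open>v\<close>, so the condition is that
  \<open>B v\<close> is a multiple of \<open>v\<close>: the coordinates \<open>1, ..., n - 1\<close>
  of \<open>Q B v\<close> vanish, which are \<open>n - 1\<close> linear equations in
  \<open>B\<close>.\<close>

lemma flag_variety_1_linear: "\<exists>es. length es + 1 = n \<and> flag_variety 1 = linear_variety n es"
proof -
  define e where "e r = vec (n * n) (\<lambda>k. Q $$ (r, k div n) * v $ (k mod n))" for r
  define es where "es = map e [1..<n]"
  have n: "n > 0" using vec_nonzero_index[OF v] by (metis gr_zeroI not_less_zero)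
  have form: "linear_form n (e r) B = (Q *\<^sub>v (B *\<^sub>v v)) $ r" if B: "B \<in> carrier_mat n n" and r: "r < n" for B r
  proof -
    have Bv: "B *\<^sub>v v \<in> carrier_vec n" using B v(1) by (rule mult_mat_vec_carrier)
    have "linear_form n (e r) B = (\<Sum>k<n * n. Q $$ (r, k div n) * (B $$ (k div n, k mod n) * v $ (k mod n)))"
      unfolding linear_form_def by (intro sum.cong refl) (simp add: e_def mat_entry_def)
    also have "\<dots> = (\<Sum>a<n. \<Sum>c<n. Q $$ (r, a) * (B $$ (a, c) * v $ c))" by (rule sum_mat_entries)
    also have "\<dots> = (\<Sum>a<n. Q $$ (r, a) * (B *\<^sub>v v) $ a)"
      using mult_mat_vec_entry[OF B v(1)] by (intro sum.cong refl) (simp add: sum_distrib_left)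
    finally show ?thesis unfolding mult_mat_vec_entry[OF Q Bv r] .
  qed
  have vmult: "x \<in> flag_space 1 \<longleftrightarrow> (\<exists>c. x = c \<cdot>\<^sub>v v)" if x: "x \<in> carrier_vec n" for x
  proof
    assume xf: "x \<in> flag_space 1"
    have "Q *\<^sub>v x = (Q *\<^sub>v x) $ 0 \<cdot>\<^sub>v unit_vec n 0"
    proof (rule eq_vecI)
      fix r assume "r < dim_vec ((Q *\<^sub>v x) $ 0 \<cdot>\<^sub>v unit_vec n 0)"
      then have "r < n" by simp
      then show "(Q *\<^sub>v x) $ r = ((Q *\<^sub>v x) $ 0 \<cdot>\<^sub>v unit_vec n 0) $ r"
        using xf n by (cases "r = 0") (auto simp: flag_space_def simp del: index_mult_mat_vec)
    qed (use Q in simp)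
    then have "P *\<^sub>v (Q *\<^sub>v x) = (Q *\<^sub>v x) $ 0 \<cdot>\<^sub>v (P *\<^sub>v (Q *\<^sub>v v))"
      unfolding Qv using mult_mat_vec[OF P unit_vec_carrier, of "(Q *\<^sub>v x) $ 0" 0] by simp
    then show "\<exists>c. x = c \<cdot>\<^sub>v v" unfolding mult_inverse_vec[OF Q P PQ x] mult_inverse_vec[OF Q P PQ v(1)] by blast
  next
    assume "\<exists>c. x = c \<cdot>\<^sub>v v"
    then show "x \<in> flag_space 1" using v_in_flag[of 1] flag_subspace[of 1] by (auto simp: subspace_vec_iff)
  qed
  have cones: "cone n (flag_variety 1) = cone n (linear_variety n es)"
  proof -
    have "(\<exists>x\<in>flag_space 1. x \<noteq> 0\<^sub>v n \<and> (\<exists>\<mu>. B *\<^sub>v x = \<mu> \<cdot>\<^sub>v x)) \<longleftrightarrow> (\<forall>e\<in>set es. linear_form n e B = 0)"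
      if B: "B \<in> carrier_mat n n" for B
    proof -
      have Bv: "B *\<^sub>v v \<in> carrier_vec n" using B v(1) by (rule mult_mat_vec_carrier)
      have "(\<forall>e\<in>set es. linear_form n e B = 0) \<longleftrightarrow> (\<forall>r<n. 1 \<le> r \<longrightarrow> (Q *\<^sub>v (B *\<^sub>v v)) $ r = 0)"
        unfolding es_def using form[OF B] by auto
      also have "\<dots> \<longleftrightarrow> B *\<^sub>v v \<in> flag_space 1" using Bv by (simp add: flag_space_def)
      also have "\<dots> \<longleftrightarrow> (\<exists>c. B *\<^sub>v v = c \<cdot>\<^sub>v v)" by (rule vmult[OF Bv])
      also have "\<dots> \<longleftrightarrow> (\<exists>x\<in>flag_space 1. x \<noteq> 0\<^sub>v n \<and> (\<exists>\<mu>. B *\<^sub>v x = \<mu> \<cdot>\<^sub>v x))"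
      proof
        assume "\<exists>c. B *\<^sub>v v = c \<cdot>\<^sub>v v"
        then show "\<exists>x\<in>flag_space 1. x \<noteq> 0\<^sub>v n \<and> (\<exists>\<mu>. B *\<^sub>v x = \<mu> \<cdot>\<^sub>v x)" using v(2) v_in_flag[of 1] by auto
      next
        assume "\<exists>x\<in>flag_space 1. x \<noteq> 0\<^sub>v n \<and> (\<exists>\<mu>. B *\<^sub>v x = \<mu> \<cdot>\<^sub>v x)"
        then obtain x \<mu> where x: "x \<in> flag_space 1" "x \<noteq> 0\<^sub>v n" "B *\<^sub>v x = \<mu> \<cdot>\<^sub>v x" by blast
        have xc: "x \<in> carrier_vec n" using x by (simp add: flag_space_def)
        obtain c where c: "x = c \<cdot>\<^sub>v v" using x(1) vmult[OF xc] by blast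
        have "c \<noteq> 0" using x(2) c zero_smult_vec[OF v(1)] by auto
        then have "v = inverse c \<cdot>\<^sub>v x" using c by (simp add: smult_smult_assoc)
        then have "B *\<^sub>v v = \<mu> \<cdot>\<^sub>v v" using eigenvector_smult[OF B xc x(3)] by simp
        then show "\<exists>c. B *\<^sub>v v = c \<cdot>\<^sub>v v" by blast
      qed
      finally show ?thesis by simp
    qed
    then show ?thesis unfolding cone_kalman_variety_1[OF flag_subspace] cone_linear_variety by (auto simp: nonzero_mats_def)
  qed
  have cl: "proj_closed n (flag_variety 1)" using flag_variety_irreducible[of 1] by (simp add: proj_irreducible_def)
  have "flag_variety 1 = linear_variety n es"
    using subset_if_cone_subset[OF cl] subset_if_cone_subset[OF proj_closed_linear_variety] cones by blast
  moreover have "length es + 1 = n" using n by (simp add: es_def)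
  ultimately show ?thesis by blast
qed

lemma flag_chain:
  assumes A: "A \<in> nonzero_mats n" "A *\<^sub>v v = \<mu> \<cdot>\<^sub>v v" and d: "1 \<le> d" "d \<le> n"
  shows "\<exists>Z. Z (n * (n - 1) + (d - 1)) = flag_variety d \<and>
    (\<forall>i\<le>n * (n - 1) + (d - 1). proj_irreducible n (Z i) \<and> proj_point A \<in> Z i) \<and>
    (\<forall>i<n * (n - 1) + (d - 1). Z i \<subset> Z (Suc i))"
proof -
  obtain es where es: "length es + 1 = n" "flag_variety 1 = linear_variety n es" using flag_variety_1_linear by blast
  have Ain: "A \<in> cone n (flag_variety i)" if "1 \<le> i" for i
    unfolding cone_kalman_variety_1[OF flag_subspace] using A v(2) v_in_flag[OF that] by blast
  let ?N = "n * (n - 1)"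
  have "length es + ?N + 1 = n * n" using es(1) by (cases n) auto
  from linear_chain[OF _ this, of A] Ain[of 1] es(2)
  obtain Z where Z: "Z ?N = flag_variety 1" "\<forall>i\<le>?N. proj_irreducible n (Z i) \<and> proj_point A \<in> Z i" "\<forall>i<?N. Z i \<subset> Z (Suc i)"
    by auto
  \<comment> \<open>The linear chain ends at the variety of the line; from there the dimension of
    the flag space grows by one per step, up to \<open>d\<close>.\<close>
  define Z' where "Z' i = (if i \<le> ?N then Z i else flag_variety (i - ?N + 1))" for i
  have hi: "Z' i = flag_variety (i - ?N + 1)" if "?N \<le> i" for i
    using that Z(1) by (cases "i = ?N") (auto simp: Z'_def)
  have "Z' i \<subset> Z' (Suc i)" if i: "i < ?N + (d - 1)" for i
  proof (cases "i < ?N")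
    case True
    then show ?thesis using Z(3) by (simp add: Z'_def)
  next
    case False
    then have "flag_variety (i - ?N + 1) \<subset> flag_variety (Suc (i - ?N + 1))"
      using i d by (intro flag_variety_strict) auto
    then show ?thesis using hi[of i] hi[of "Suc i"] False by (simp add: Suc_diff_le)
  qed
  moreover have "proj_irreducible n (Z' i) \<and> proj_point A \<in> Z' i" for i
    using Z(2) flag_variety_irreducible[of "i - ?N + 1"] Ain[of "i - ?N + 1"] by (auto simp: Z'_def cone_def)
  moreover have "Z' (?N + (d - 1)) = flag_variety d" using hi[of "?N + (d - 1)"] d by simp
  ultimately show ?thesis by (intro exI[of _ Z']) auto
qed

end

section \<open>The singular locus\<close>

text \<open>One elimination step on the rows of \<open>Q\<close>: a pivot \<open>q < d\<close> with
  nonzero coordinate of \<open>v\<close> is moved to row 0 by \<sigma>, normalised, and used to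
  clear the other coordinates of \<open>v\<close>. Rows from \<open>d\<close> on are unchanged since
  \<open>v\<close> already has coordinate 0 there; so they still describe \<open>L\<close>.\<close>

lemma adapted_flag_exists:
  fixes P Q :: "'a::field mat"
  assumes ad: "adapted_coords d n L P Q" and d: "d \<le> n" and v: "v \<in> L" "v \<noteq> 0\<^sub>v n"
  obtains P' Q' where "P' \<in> carrier_mat n n" "Q' \<in> carrier_mat n n" "P' * Q' = 1\<^sub>m n" "Q' * P' = 1\<^sub>m n"
    and "Q' *\<^sub>v v = unit_vec n 0" and "L = {x \<in> carrier_vec n. \<forall>r<n. d \<le> r \<longrightarrow> (Q' *\<^sub>v x) $ r = 0}"
proof -
  note adD = adapted_coordsD[OF ad d]
  note Lm = adapted_mem_iff[OF ad d]
  have vc: "v \<in> carrier_vec n" and vd: "\<And>i. i < n \<Longrightarrow> d \<le> i \<Longrightarrow> (Q *\<^sub>v v) $ i = 0" using v(1) Lm by auto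
  define y where "y = Q *\<^sub>v v"
  have y: "y \<in> carrier_vec n" unfolding y_def using adD(2) vc by (rule mult_mat_vec_carrier)
  have "y \<noteq> 0\<^sub>v n" using mult_inverse_vec[OF adD(2,1,3) vc] mult_mat_zero_vec[OF adD(1)] v(2) unfolding y_def by metis
  then obtain q where q: "q < n" "y $ q \<noteq> 0" using vec_nonzero_index[OF y] by blast
  have yd: "y $ i = 0" if "i < n" "d \<le> i" for i using vd[OF that] by (simp add: y_def)
  have qd: "q < d" using q yd by (meson not_le)
  define \<sigma> where "\<sigma> j = (if j = 0 then q else if j = q then 0 else j)" for j
  have \<sigma>n: "\<sigma> j < n" if "j < n" for j using that q by (auto simp: \<sigma>_def)
  have \<sigma>d: "\<sigma> j = j" if "d \<le> j" for j using that qd by (auto simp: \<sigma>_def)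
  have \<sigma>\<sigma>: "\<sigma> (\<sigma> j) = j" for j by (auto simp: \<sigma>_def)
  define Q' where "Q' = mat n n (\<lambda>(j,c). if j = 0 then Q $$ (q,c) / y $ q
    else Q $$ (\<sigma> j, c) - y $ \<sigma> j / y $ q * Q $$ (q,c))"
  have Q': "Q' \<in> carrier_mat n n" by (simp add: Q'_def)
  have entry: "(Q' *\<^sub>v x) $ j = (if j = 0 then (Q *\<^sub>v x) $ q / y $ q
    else (Q *\<^sub>v x) $ \<sigma> j - y $ \<sigma> j / y $ q * (Q *\<^sub>v x) $ q)" if x: "x \<in> carrier_vec n" and j: "j < n" for x j
    unfolding mult_mat_vec_entry[OF Q' x j] mult_mat_vec_entry[OF adD(2) x q(1)] mult_mat_vec_entry[OF adD(2) x \<sigma>n[OF j]]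
    using j by (cases "j = 0")
      (auto simp: Q'_def sum_divide_distrib sum_distrib_left sum_subtractf[symmetric] algebra_simps intro!: sum.cong)
  have "Q' *\<^sub>v x \<noteq> 0\<^sub>v n" if x: "x \<in> carrier_vec n" "x \<noteq> 0\<^sub>v n" for x
  proof
    assume 0: "Q' *\<^sub>v x = 0\<^sub>v n"
    then have z: "(Q' *\<^sub>v x) $ j = 0" if "j < n" for j using that by simp
    have Qq: "(Q *\<^sub>v x) $ q = 0" using z[of 0] entry[OF x(1), of 0] q by simp
    have "(Q *\<^sub>v x) $ i = 0" if i: "i < n" for i
    proof (cases "i = q")
      case False
      then have "\<sigma> i \<noteq> 0" by (auto simp: \<sigma>_def)
      then show ?thesis using z[OF \<sigma>n[OF i]] entry[OF x(1) \<sigma>n[OF i]] Qq by (simp add: \<sigma>\<sigma>)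
    qed (use Qq in simp)
    then have "Q *\<^sub>v x = 0\<^sub>v n" using adD(2) by (intro eq_vecI) (auto simp del: index_mult_mat_vec)
    then show False using mult_inverse_vec[OF adD(2,1,3) x(1)] mult_mat_zero_vec[OF adD(1)] x(2) by simp
  qed
  then have det: "det Q' \<noteq> 0" unfolding det_0_iff_vec_prod_zero_field[OF Q'] by blast
  define P' where "P' = inverse (det Q') \<cdot>\<^sub>m adj_mat Q'"
  have "inverse (det Q') \<cdot>\<^sub>m (det Q' \<cdot>\<^sub>m 1\<^sub>m n) = 1\<^sub>m n" using det by (intro eq_matI) auto
  then have inv: "P' * Q' = 1\<^sub>m n" "Q' * P' = 1\<^sub>m n"
    unfolding P'_def mult_smult_assoc_mat[OF adj_mat(1)[OF Q'] Q'] mult_smult_distrib[OF Q' adj_mat(1)[OF Q']]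
      adj_mat(2,3)[OF Q'] by auto
  have "Q' *\<^sub>v v = unit_vec n 0"
  proof (rule eq_vecI)
    fix j assume "j < dim_vec (unit_vec n 0 :: 'a vec)"
    then have j: "j < n" by simp
    show "(Q' *\<^sub>v v) $ j = unit_vec n 0 $ j" unfolding entry[OF vc j] y_def[symmetric] using q j by auto
  qed (use Q' in simp)
  moreover have "(Q' *\<^sub>v x) $ r = (Q *\<^sub>v x) $ r" if "x \<in> carrier_vec n" "r < n" "d \<le> r" for x r
    unfolding entry[OF that(1,2)] using that qd yd[OF that(2,3)] by (simp add: \<sigma>d)
  then have "L = {x \<in> carrier_vec n. \<forall>r<n. d \<le> r \<longrightarrow> (Q' *\<^sub>v x) $ r = 0}" using Lm by auto
  ultimately show thesis using that[of P' Q'] inv Q' adj_mat(1)[OF Q'] by (simp add: P'_def)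
qed

lemma local_dim_kalman_variety:
  fixes L :: "'a::alg_closed_field vec set"
  assumes ad: "adapted_coords d n L P Q" and d: "d \<le> n" "0 < d"
    and L: "VectorSpace.subspace class_ring L (module_vec TYPE('a) n)"
    and A: "A \<in> cone n (kalman_variety 1 n L)"
  shows "local_dim n (kalman_variety 1 n L) (proj_point A) = enat (n * (n - 1) + (d - 1))"
  unfolding local_dim_def
proof (rule antisym)
  let ?D = "n * (n - 1) + (d - 1)" and ?X = "kalman_variety 1 n L"
  let ?S = "{enat k | k. \<exists>Z :: nat \<Rightarrow> 'a mat set set.
     (\<forall>i\<le>k. proj_irreducible n (Z i) \<and> proj_point A \<in> Z i \<and> Z i \<subseteq> ?X) \<and> (\<forall>i<k. Z i \<subset> Z (Suc i))}"
  show "Sup ?S \<le> enat ?D"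
  proof (rule Sup_least)
    fix e assume "e \<in> ?S"
    then obtain k Z where k: "e = enat k" "\<forall>i\<le>k. proj_irreducible n (Z i) \<and> proj_point A \<in> Z i \<and> Z i \<subseteq> ?X"
      "\<forall>i<k. Z i \<subset> Z (Suc i)" by blast
    then show "e \<le> enat ?D" using chain_length_le[OF ad d L, of k Z] by simp
  qed
  obtain v \<mu> where v: "v \<in> L" "v \<noteq> 0\<^sub>v n" "A *\<^sub>v v = \<mu> \<cdot>\<^sub>v v" and A0: "A \<in> nonzero_mats n"
    using A unfolding cone_kalman_variety_1[OF L] by blast
  have vc: "v \<in> carrier_vec n" using v(1) L by (auto simp: subspace_vec_iff)
  obtain P' Q' where Q': "P' \<in> carrier_mat n n" "Q' \<in> carrier_mat n n" "P' * Q' = 1\<^sub>m n" "Q' * P' = 1\<^sub>m n"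
    "Q' *\<^sub>v v = unit_vec n 0" and L': "L = {x \<in> carrier_vec n. \<forall>r<n. d \<le> r \<longrightarrow> (Q' *\<^sub>v x) $ r = 0}"
    by (rule adapted_flag_exists[OF ad d(1) v(1,2)])
  have "\<exists>Z. Z ?D = ?X \<and> (\<forall>i\<le>?D. proj_irreducible n (Z i) \<and> proj_point A \<in> Z i) \<and> (\<forall>i<?D. Z i \<subset> Z (Suc i))"
    using flag_chain[OF Q'(1-4) vc v(2) Q'(5) A0 v(3), of d] d
    unfolding flag_space_def[OF Q'(1-4) vc v(2) Q'(5)] L'[symmetric] by simp
  then obtain Z where Z: "Z ?D = ?X" "\<forall>i\<le>?D. proj_irreducible n (Z i) \<and> proj_point A \<in> Z i" "\<forall>i<?D. Z i \<subset> Z (Suc i)"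
    by blast
  have "Z i \<subseteq> ?X" if "i \<le> ?D" for i
    using that
  proof (induction rule: inc_induct)
    case (step i)
    then show ?case using Z(3) by blast
  qed (use Z(1) in blast)
  then have "enat ?D \<in> ?S" using Z(2,3) by blast
  then show "enat ?D \<le> Sup ?S" by (rule Sup_upper)
qed

text \<open>The local dimension plus one is \<open>n (n - 1) + d\<close> at every point. It equals
  the tangent dimension of the cone where \<delta> is 1 and, as \<open>d < n\<close>, is smaller
  than \<open>n * n\<close>, the tangent dimension where \<delta> is at least 2.\<close>

lemma singular_locus_kalman_variety:
  fixes C :: "'a::alg_closed_field mat"
  assumes C: "C \<in> carrier_mat m n" and ad: "adapted_coords d n (mat_kernel C) P Q" and d: "0 < d" "d < n"
    and dim: "subspace_dim n (mat_kernel C) = d"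
  shows "singular_locus n (kalman_variety 1 n (mat_kernel C)) =
    {proj_point A | A. A \<in> nonzero_mats n \<and> 2 \<le> subspace_dim n (mat_kernel (kalman_matrix d C A))}"
proof -
  let ?X = "kalman_variety 1 n (mat_kernel C)" and ?\<delta> = "\<lambda>A. subspace_dim n (mat_kernel (kalman_matrix d C A))"
  have L: "VectorSpace.subspace class_ring (mat_kernel C) (module_vec TYPE('a) n)" by (rule subspace_mat_kernel[OF C])
  have cone_iff: "proj_point A \<in> ?X \<longleftrightarrow> 1 \<le> ?\<delta> A" if A: "A \<in> nonzero_mats n" for A
  proof
    assume "proj_point A \<in> ?X"
    then have "A \<in> cone n ?X" using A by (simp add: cone_def)
    then obtain v \<mu> where v: "v \<in> mat_kernel C" "v \<noteq> 0\<^sub>v n" "A *\<^sub>v v = \<mu> \<cdot>\<^sub>v v"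
      unfolding cone_kalman_variety_1[OF L] by blast
    have vc: "v \<in> carrier_vec n" using v(1) C by (auto simp: mat_kernel)
    have Ac: "A \<in> carrier_mat n n" using A by (simp add: nonzero_mats_def)
    let ?W = "range (\<lambda>c. c \<cdot>\<^sub>v v)"
    have W: "VectorSpace.subspace class_ring ?W (module_vec TYPE('a) n)" by (rule subspace_line[OF vc])
    have "A *\<^sub>v (c \<cdot>\<^sub>v v) = (c * \<mu>) \<cdot>\<^sub>v v" for c
      using mult_mat_vec[OF Ac vc] v(3) by (simp add: smult_smult_assoc)
    then have Winv: "\<forall>w\<in>?W. A *\<^sub>v w \<in> ?W" by auto
    have WL: "?W \<subseteq> mat_kernel C" using L v(1) by (auto simp: subspace_vec_iff)
    have "?W \<subseteq> mat_kernel (kalman_matrix d C A)"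
      by (rule invariant_subset_kernel_kalman_matrix[OF C Ac WL]) (use Winv in blast)
    moreover have "v \<in> ?W" by (rule range_eqI[of _ _ 1]) simp
    ultimately have "v \<in> mat_kernel (kalman_matrix d C A)" by blast
    then show "1 \<le> ?\<delta> A" using subspace_dim_ge_1[OF subspace_mat_kernel[OF kalman_matrix_carrier[OF C Ac]] _ v(2)] by simp
  next
    assume "1 \<le> ?\<delta> A"
    then show "proj_point A \<in> ?X" using kalman_variety_eq[OF C, of d 1] dim A by auto
  qed
  have sing: "enat (cone_tangent_dim n ?X A) \<noteq> local_dim n ?X (proj_point A) + 1 \<longleftrightarrow> 2 \<le> ?\<delta> A"
    if A: "A \<in> nonzero_mats n" "proj_point A \<in> ?X" for A
  proof -
    have Ac: "A \<in> carrier_mat n n" and Ain: "A \<in> cone n ?X" using A by (auto simp: nonzero_mats_def cone_def)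
    have ld: "local_dim n ?X (proj_point A) + 1 = enat (n * (n - 1) + d)"
      using local_dim_kalman_variety[OF ad _ d(1) L Ain] d by (simp add: one_enat_def)
    have nn: "n * n = n * (n - 1) + n" by (cases n) auto
    show ?thesis
    proof (cases "2 \<le> ?\<delta> A")
      case True
      then show ?thesis using cone_tangent_dim_singular[OF C dim Ac] ld nn d by simp
    next
      case False
      then have "?\<delta> A = 1" using cone_iff[OF A(1)] A(2) by simp
      then show ?thesis using cone_tangent_dim_regular[OF C dim Ac] ld nn d False by simp
    qed
  qed
  have "A \<in> nonzero_mats n \<and> proj_point A \<in> ?X \<and> enat (cone_tangent_dim n ?X A) \<noteq> local_dim n ?X (proj_point A) + 1
    \<longleftrightarrow> A \<in> nonzero_mats n \<and> 2 \<le> ?\<delta> A" for A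
    using sing[of A] cone_iff[of A] by auto
  then show ?thesis unfolding singular_locus_def by simp
qed

theorem theorem4p5:
  fixes C :: "'a::alg_closed_field mat" and s d n :: nat
  assumes "1 \<le> s" and "s \<le> d" and "d \<le> n - 1"
    and "C \<in> carrier_mat (n - d) n" and "mat_rank C = n - d"
  shows "proj_closed n (kalman_variety s n (mat_kernel C)) \<and>
    kalman_variety s n (mat_kernel C) =
      {proj_point A | A. A \<in> nonzero_mats n \<and>
         (\<forall>\<mu>\<in>minors (n - s + 1) (kalman_matrix d C A). \<mu> = 0)} \<and>
    (\<forall>P Q. adapted_coords d n (mat_kernel C) P Q \<longrightarrow>
      kalman_variety s n (mat_kernel C) =
        {proj_point A | A. A \<in> nonzero_mats n \<and>
           (\<forall>\<mu>\<in>minors (d - s + 1) (reduced_kalman_matrix d (Q * A * P)). \<mu> = 0)} \<and>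
      singular_locus n (kalman_variety 1 n (mat_kernel C)) =
        {proj_point A | A. A \<in> nonzero_mats n \<and>
           int (mat_rank (reduced_kalman_matrix d (Q * A * P))) \<le> int d - 2})"
proof (intro conjI allI impI)
  note C = assms(4)
  have d: "0 < d" "d < n" and sn: "s \<le> n" using assms(1-3) by auto
  have dim: "subspace_dim n (mat_kernel C) = d" using rank_plus_nullity[OF C] assms(5) d by simp
  then have dim': "subspace_dim n (mat_kernel C) \<le> d" by simp
  show "proj_closed n (kalman_variety s n (mat_kernel C))" by (rule proj_closed_kalman_variety[OF C dim' sn])
  show "kalman_variety s n (mat_kernel C) = {proj_point A | A. A \<in> nonzero_mats n \<and>
      (\<forall>\<mu>\<in>minors (n - s + 1) (kalman_matrix d C A). \<mu> = 0)}" by (rule kalman_variety_minors[OF C dim' sn])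
  fix P Q assume ad: "adapted_coords d n (mat_kernel C) P Q"
  note facts = reduced_kalman_matrix_facts[OF C ad less_imp_le[OF d(2)]]
  have Ac: "A \<in> nonzero_mats n \<Longrightarrow> A \<in> carrier_mat n n" for A :: "'a mat" by (simp add: nonzero_mats_def)
  \<comment> \<open>The rank of the reduced matrix and \<delta> add up to \<open>d\<close>, so rank
    at most \<open>d - s\<close> means that \<delta> is at least \<open>s\<close>.\<close>
  have "(\<forall>\<mu>\<in>minors (d - s + 1) (reduced_kalman_matrix d (Q * A * P)). \<mu> = 0) \<longleftrightarrow>
      s \<le> subspace_dim n (mat_kernel (kalman_matrix d C A))" if "A \<in> nonzero_mats n" for A
    unfolding minors_vanish_iff_rank[OF facts(1)[OF Ac[OF that]]] using facts(2)[OF Ac[OF that]] assms(1,2) by linarith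
  then show "kalman_variety s n (mat_kernel C) = {proj_point A | A. A \<in> nonzero_mats n \<and>
      (\<forall>\<mu>\<in>minors (d - s + 1) (reduced_kalman_matrix d (Q * A * P)). \<mu> = 0)}"
    unfolding kalman_variety_eq[OF C dim'] by (intro Collect_cong iff_exI) blast
  \<comment> \<open>The comparison is made over the integers: for \<open>d = 1\<close> the bound is
    negative, and the singular locus is empty.\<close>
  have "int (mat_rank (reduced_kalman_matrix d (Q * A * P))) \<le> int d - 2 \<longleftrightarrow>
      2 \<le> subspace_dim n (mat_kernel (kalman_matrix d C A))" if "A \<in> nonzero_mats n" for A
    using facts(2)[OF Ac[OF that]] by linarith
  then show "singular_locus n (kalman_variety 1 n (mat_kernel C)) = {proj_point A | A. A \<in> nonzero_mats n \<and>
      int (mat_rank (reduced_kalman_matrix d (Q * A * P))) \<le> int d - 2}"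
    unfolding singular_locus_kalman_variety[OF C ad d dim] by (intro Collect_cong iff_exI) blast
qed

end
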